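(* Let $d\ge 2$ and $q\ge 2$ be integers, let $\beta\ge 0$ and $\vec H=(H_1,\dots,H_q)\in\mathbb{R}^q$. Let $\mu$ be a completely homogeneous splitting Gibbs measure for the $q$-state Potts model on $\mathbb{T}^d$ at inverse temperature $\beta$ with uniform external field $\vec H$. Then $\mu$ satisfies the following dichotomy: (i) either $\mu$ is extremal, i.e. $\mu\in\mathrm{ex}\,\mathscr{G}_{\beta,\vec H}$; (ii) or the extremal decomposition measure $\lambda_\mu$ has no atoms, i.e. $\lambda_\mu(\{\nu\})=0$ for each $\nu\in\mathrm{ex}\,\mathscr{G}_{\beta,\vec H}$. In particular, in this case the support of $\lambda_\mu$ contains uncountably many extremal measures.
   Context: $\mathbb{T}^d$ is the Cayley tree with branching factor $d$, i.e. the infinite tree in which every vertex has degree $d+1$; $V(\mathbb{T}^d)$ is its vertex set, $u\sim v$ means that $uv$ is an edge, and $\Lambda\Subset V(\mathbb{T}^d)$ means that $\Lambda$ is a finite subset. Fix a root $o\in V(\mathbb{T}^d)$; $d(\cdot,\cdot)$ is graph distance, $W_n=\{x:d(x,o)=n\}$, $V_n=\{x:d(x,o)\le n\}$, and $E(V_n)$ is the set of edges with both endpoints in $V_n$. Put $\Omega_0=\{1,\dots,q\}$ and $\Omega=\Omega_0^{V(\mathbb{T}^d)}$ with the product $\sigma$-algebra. For $\Lambda\Subset V(\mathbb{T}^d)$ and $\eta\in\Omega_0^{\Lambda^c}$ (or $\eta\in\Omega$, using only its restriction to $\Lambda^c$) define the probability measure on $\Omega_0^\Lambda$ $$\mu^{\eta}_{\Lambda,\beta,\vec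 H}(\sigma)\propto\exp\Big[\beta\sum_{u,v\in\Lambda:\,u\sim v}\delta_{\sigma_u,\sigma_v}+\beta\sum_{u\in\Lambda,\,v\in\Lambda^c:\,u\sim v}\delta_{\sigma_u,\eta_v}+\sum_{u\in\Lambda}H_{\sigma_u}\Big],$$ where $\delta$ is the Kronecker delta and each edge is counted once. A probability measure $\mu$ on $\Omega$ is a Gibbs measure if $\mu(A)=\int\mu^{\eta}_{\Lambda,\beta,\vec H}(A)\,\mu(d\eta)$ for every $\Lambda\Subset V(\mathbb{T}^d)$ and every local event $A$ in $\Lambda$ (an event depending only on the spins in $\Lambda$). $\mathscr{G}_{\beta,\vec H}$ is the set of Gibbs measures and $\mathrm{ex}\,\mathscr{G}_{\beta,\vec H}$ the set of extremal ones, i.e. those $\mu \in\mathscr{G}_{\beta,\vec H}$ that cannot be written as $\lambda\mu_1+(1-\lambda)\mu_2$ with $\lambda\in(0,1)$, $\mu_1\neq\mu_2\in\mathscr{G}_{\beta,\vec H}$. For each $\mu\in\mathscr{G}_{\beta,\vec H}$, $\lambda_\mu$ (the extremal decomposition measure) is the unique probability measure on $\mathrm{ex}\,\mathscr{G}_{\beta,\vec H}$ (with the $\sigma$-algebra generated by the maps $\nu\mapsto\nu(B)$, $B$ an event) such that $\mu(\cdot)=\int\nu(\cdot)\,\lambda_\mu(d\nu)$; its existence and uniqueness is a standard fact. A completely homogeneous splitting Gibbs measure (CHSGM) is a measure $\mu\in\mathscr{G}_{\beta,\vec H}$ for which there is $\vec h=(h_1,\dots,h_q)\in\mathbb{R}^q$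 such that $$\mu(\sigma_{V_n}=s)\propto\exp\Big[\beta\sum_{uv\in E(V_n)}\delta_{s_u,s_v}+\sum_{u\in V_n}H_{s_u}+\sum_{u\in W_n}h_{s_u}\Big],\quad \forall n\in\mathbb{N}=\{1,2,\dots\},\ s\in\Omega_0^{V_n},$$ and such that $$h_i-h_q=d\,\ln\frac{\exp[\beta+H_i+h_i]+\sum_{j\ne i}\exp[H_j+h_j]}{\exp[\beta+H_q+h_q]+\sum_{j\ne q}\exp[H_j+h_j]},\quad\forall i\in\Omega_0.$$ *)

theory Defs
  imports "HOL-Probability.Probability"
begin

section \<open>Regular trees\<close>

text \<open>
  The Cayley tree is described up to isomorphism: \<open>E\<close> is the adjacency relation, the vertex set
  is the whole type \<open>'v\<close>. The clause on lists excludes cycles; since \<open>card\<close> vanishes on infinite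
  sets, the last clause also says that the tree is locally finite.
\<close>

definition regular_tree :: "nat \<Rightarrow> ('v \<Rightarrow> 'v \<Rightarrow> bool) \<Rightarrow> bool" where
  "regular_tree d E \<longleftrightarrow>
     symp E \<and> irreflp E \<and>
     (\<forall>u v. E\<^sup>*\<^sup>* u v) \<and>
     \<not> (\<exists>xs. 3 \<le> length xs \<and> distinct xs \<and> successively E xs \<and> E (last xs) (hd xs)) \<and>
     (\<forall>u. card {v. E u v} = d + 1)"

definition graph_dist :: "('v \<Rightarrow> 'v \<Rightarrow> bool) \<Rightarrow> 'v \<Rightarrow> 'v \<Rightarrow> nat" where
  "graph_dist E u v = (LEAST n. (E ^^ n) u v)"

definition tree_sphere :: "('v \<Rightarrow> 'v \<Rightarrow> bool) \<Rightarrow> 'v \<Rightarrow> nat \<Rightarrow> 'v set" where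
  "tree_sphere E r n = {x. graph_dist E x r = n}"

definition tree_ball :: "('v \<Rightarrow> 'v \<Rightarrow> bool) \<Rightarrow> 'v \<Rightarrow> nat \<Rightarrow> 'v set" where
  "tree_ball E r n = {x. graph_dist E x r \<le> n}"

definition edges_within :: "('v \<Rightarrow> 'v \<Rightarrow> bool) \<Rightarrow> 'v set \<Rightarrow> 'v set set" where
  "edges_within E \<Lambda> = {{u, v} | u v. u \<in> \<Lambda> \<and> v \<in> \<Lambda> \<and> E u v}"

definition edge_boundary :: "('v \<Rightarrow> 'v \<Rightarrow> bool) \<Rightarrow> 'v set \<Rightarrow> ('v \<times> 'v) set" where
  "edge_boundary E \<Lambda> = {(u, v). u \<in> \<Lambda> \<and> v \<notin> \<Lambda> \<and> E u v}"


section \<open>Configurations and Gibbs measures of the Potts model\<close>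

definition configs :: "nat \<Rightarrow> 'v set \<Rightarrow> ('v \<Rightarrow> nat) set" where
  "configs q \<Lambda> = (\<Pi>\<^sub>E x\<in>\<Lambda>. {1..q})"

definition config_space :: "nat \<Rightarrow> ('v \<Rightarrow> nat) measure" where
  "config_space q = (\<Pi>\<^sub>M x\<in>UNIV. count_space {1..q})"

text \<open>The event that the configuration in \<open>\<Lambda>\<close> belongs to \<open>A\<close>; for finite \<open>\<Lambda>\<close> and
  \<open>A \<subseteq> configs q \<Lambda>\<close> these are exactly the local events in \<open>\<Lambda>\<close>.\<close>

definition cylinder :: "nat \<Rightarrow> 'v set \<Rightarrow> ('v \<Rightarrow> nat) set \<Rightarrow> ('v \<Rightarrow> nat) set" where
  "cylinder q \<Lambda> A = {\<omega> \<in> space (config_space q). restrict \<omega> \<Lambda> \<in> A}"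

text \<open>The sum over edges of the Kronecker delta of the spins at the two endpoints.\<close>

definition interaction :: "('v \<Rightarrow> 'v \<Rightarrow> bool) \<Rightarrow> 'v set \<Rightarrow> ('v \<Rightarrow> nat) \<Rightarrow> real" where
  "interaction E \<Lambda> \<sigma> = (\<Sum>e\<in>edges_within E \<Lambda>. of_bool (\<forall>u\<in>e. \<forall>v\<in>e. \<sigma> u = \<sigma> v))"

definition finvol_weight ::
    "('v \<Rightarrow> 'v \<Rightarrow> bool) \<Rightarrow> real \<Rightarrow> (nat \<Rightarrow> real) \<Rightarrow> 'v set \<Rightarrow> ('v \<Rightarrow> nat) \<Rightarrow> ('v \<Rightarrow> nat) \<Rightarrow> real" where
  "finvol_weight E \<beta> H \<Lambda> \<eta> \<sigma> =
     exp (\<beta> * interaction E \<Lambda> \<sigma>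
          + \<beta> * (\<Sum>(u, v)\<in>edge_boundary E \<Lambda>. of_bool (\<sigma> u = \<eta> v))
          + (\<Sum>u\<in>\<Lambda>. H (\<sigma> u)))"

definition finvol_gibbs ::
    "('v \<Rightarrow> 'v \<Rightarrow> bool) \<Rightarrow> nat \<Rightarrow> real \<Rightarrow> (nat \<Rightarrow> real) \<Rightarrow> 'v set \<Rightarrow> ('v \<Rightarrow> nat) \<Rightarrow> ('v \<Rightarrow> nat) measure" where
  "finvol_gibbs E q \<beta> H \<Lambda> \<eta> =
     point_measure (configs q \<Lambda>)
       (\<lambda>\<sigma>. ennreal (finvol_weight E \<beta> H \<Lambda> \<eta> \<sigma> / (\<Sum>\<tau>\<in>configs q \<Lambda>. finvol_weight E \<beta> H \<Lambda> \<eta> \<tau>)))"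

definition gibbs_measures ::
    "('v \<Rightarrow> 'v \<Rightarrow> bool) \<Rightarrow> nat \<Rightarrow> real \<Rightarrow> (nat \<Rightarrow> real) \<Rightarrow> ('v \<Rightarrow> nat) measure set" where
  "gibbs_measures E q \<beta> H =
     {\<mu>. prob_space \<mu> \<and> sets \<mu> = sets (config_space q) \<and>
         (\<forall>\<Lambda> A. finite \<Lambda> \<longrightarrow> A \<subseteq> configs q \<Lambda> \<longrightarrow>
            emeasure \<mu> (cylinder q \<Lambda> A) = (\<integral>\<^sup>+ \<eta>. emeasure (finvol_gibbs E q \<beta> H \<Lambda> \<eta>) A \<partial>\<mu>))}"

definition extremal_measures :: "'a measure set \<Rightarrow> 'a measure set" where
  "extremal_measures G =
     {\<mu> \<in> G. \<not> (\<exists>t \<mu>1 \<mu>2. 0 < t \<and> t < 1 \<and> \<mu>1 \<in> G \<and> \<mu>2 \<in> G \<and> \<mu>1 \<noteq> \<mu>2 \<and>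
        (\<forall>B\<in>sets \<mu>. measure \<mu> B = t * measure \<mu>1 B + (1 - t) * measure \<mu>2 B))}"

abbreviation extremal_gibbs_measures ::
    "('v \<Rightarrow> 'v \<Rightarrow> bool) \<Rightarrow> nat \<Rightarrow> real \<Rightarrow> (nat \<Rightarrow> real) \<Rightarrow> ('v \<Rightarrow> nat) measure set" where
  "extremal_gibbs_measures E q \<beta> H \<equiv> extremal_measures (gibbs_measures E q \<beta> H)"


section \<open>The extremal decomposition measure\<close>

text \<open>
  \<open>prob_algebra M\<close> carries the \<open>\<sigma>\<close>-algebra generated by the evaluations at the events of \<open>M\<close>.
  The defining properties below determine \<open>\<Theta>\<close> uniquely for every Gibbs measure \<open>\<mu>\<close>.
\<close>

definition extremal_decomposition ::
    "('v \<Rightarrow> 'v \<Rightarrow> bool) \<Rightarrow> nat \<Rightarrow> real \<Rightarrow> (nat \<Rightarrow> real) \<Rightarrow> ('v \<Rightarrow> nat) measure \<Rightarrow>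
     ('v \<Rightarrow> nat) measure measure \<Rightarrow> bool" where
  "extremal_decomposition E q \<beta> H \<mu> \<Theta> \<longleftrightarrow>
     prob_space \<Theta> \<and>
     sets \<Theta> = sets (restrict_space (prob_algebra (config_space q)) (extremal_gibbs_measures E q \<beta> H)) \<and>
     (\<forall>B\<in>sets (config_space q). emeasure \<mu> B = (\<integral>\<^sup>+ \<nu>. emeasure \<nu> B \<partial>\<Theta>))"

text \<open>
  The topology of local convergence, i.e. the coarsest one making \<open>\<nu> \<mapsto> \<nu>(B)\<close> continuous for every
  local event \<open>B\<close>. As the single-spin space is finite, it is the weak topology on the probability
  measures on \<open>config_space q\<close>.
\<close>

definition local_events :: "nat \<Rightarrow> ('v \<Rightarrow> nat) set set" where
  "local_events q = {cylinder q \<Lambda> A | \<Lambda> A. finite \<Lambda> \<and> A \<subseteq> configs q \<Lambda>}"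

definition local_topology :: "nat \<Rightarrow> ('v \<Rightarrow> nat) measure topology" where
  "local_topology q =
     pullback_topology (space (prob_algebra (config_space q)))
       (\<lambda>\<nu>. restrict (measure \<nu>) (local_events q))
       (product_topology (\<lambda>_. euclideanreal) (local_events q))"

text \<open>The topological support of a measure carried by a subset of the underlying space of a topology,
  intersected with that subset.\<close>

definition support_of :: "'a topology \<Rightarrow> 'a measure \<Rightarrow> 'a set" where
  "support_of X M =
     {x \<in> topspace X \<inter> space M. \<forall>U. openin X U \<longrightarrow> x \<in> U \<longrightarrow> emeasure M (U \<inter> space M) > 0}"


section \<open>Completely homogeneous splitting Gibbs measures\<close>

definition splitting_weight ::
    "('v \<Rightarrow> 'v \<Rightarrow> bool) \<Rightarrow> real \<Rightarrow> (nat \<Rightarrow> real) \<Rightarrow> (nat \<Rightarrow> real) \<Rightarrow> 'v \<Rightarrow> nat \<Rightarrow> ('v \<Rightarrow> nat) \<Rightarrow> real" where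
  "splitting_weight E \<beta> H h r n s =
     exp (\<beta> * interaction E (tree_ball E r n) s
          + (\<Sum>u\<in>tree_ball E r n. H (s u))
          + (\<Sum>u\<in>tree_sphere E r n. h (s u)))"

definition CHSGM ::
    "nat \<Rightarrow> ('v \<Rightarrow> 'v \<Rightarrow> bool) \<Rightarrow> 'v \<Rightarrow> nat \<Rightarrow> real \<Rightarrow> (nat \<Rightarrow> real) \<Rightarrow> ('v \<Rightarrow> nat) measure \<Rightarrow> bool" where
  "CHSGM d E r q \<beta> H \<mu> \<longleftrightarrow>
     \<mu> \<in> gibbs_measures E q \<beta> H \<and>
     (\<exists>h :: nat \<Rightarrow> real.
        (\<forall>n\<ge>1. \<forall>s\<in>configs q (tree_ball E r n).
           measure \<mu> (cylinder q (tree_ball E r n) {s}) =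
             splitting_weight E \<beta> H h r n s /
             (\<Sum>s'\<in>configs q (tree_ball E r n). splitting_weight E \<beta> H h r n s')) \<and>
        (\<forall>i\<in>{1..q}.
           h i - h q =
             real d * ln ((exp (\<beta> + H i + h i) + (\<Sum>j\<in>{1..q} - {i}. exp (H j + h j))) /
                          (exp (\<beta> + H q + h q) + (\<Sum>j\<in>{1..q} - {q}. exp (H j + h j))))))"

end

theory Submission
  imports Defs
begin

text \<open>
  A Gibbs measure is characterised by its quasi-invariance under the maps exchanging two spin values
  at one vertex, so an extremal Gibbs measure gives every event that is invariant under these maps up
  to null sets the mass 0 or 1. If \<open>\<nu>\<close> is an atom of the decomposition measure, then \<open>\<nu>\<close> is absolutely
  continuous with respect to \<open>\<mu>\<close>, with an invariant density \<open>f\<close>. A splitting measure is a tree-indexed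
  Markov chain with the same transition matrix along every oriented edge; it is therefore invariant
  under all tree automorphisms, and it is mixing along automorphisms that move the root to infinity.
  For an invariant event \<open>A\<close> and an automorphism \<open>g\<close>, the event \<open>g A\<close> is again invariant, so that
  \<open>\<nu> (g A)\<close> is 0 or 1 and \<open>\<mu> ({f > 0} \<inter> g A)\<close> is 0 or \<open>\<mu> {f > 0}\<close>; since mixing makes it approach
  \<open>\<mu> {f > 0} * \<mu> A\<close>, also \<open>\<mu> A\<close> is 0 or 1. Applied to \<open>A = {f > 1}\<close> this gives \<open>\<nu> = \<mu>\<close>.
\<close>

section \<open>Geometry of regular trees\<close>

text \<open>The obstacle is that a splitting measure may have invariant events of intermediate mass.
  Mixing alone does not exclude them, since it relates a fixed event to far images
  \<open>g A\<close> and never \<open>A\<close> to itself. An atom supplies what is missing: one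
  fixed event \<open>{f > 0}\<close> that sees every such image as null or full. Spin exchanges
  stand in for the tail \<sigma>-algebra. They generate all changes of finitely many spins, their
  densities are explicit, and conjugating one by an automorphism gives another, so images of
  invariant events stay invariant. The equation for \<open>h\<close> yields homogeneity: after
  taking a \<open>d\<close>-th root it is the fixed-point equation of a boundary law, and the law on
  a finite subtree gets a form that no longer mentions the root. Triviality of
  \<open>{f > 1}\<close> suffices because one of the two measures then dominates the other, and both
  have mass 1. The support is uncountable because the local topology has a countable base: countably
  many null boxes cover its complement, and a countable support would be null too.\<close>

locale reg_tree =
  fixes d :: nat and E :: "'v \<Rightarrow> 'v \<Rightarrow> bool"
  assumes regular: "regular_tree d E"
begin

definition nbrs :: "'v \<Rightarrow> 'v set" where
  "nbrs v = {u. E v u}"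

definition conn :: "'v set \<Rightarrow> bool" where
  "conn V \<longleftrightarrow> (\<forall>u\<in>V. \<forall>v\<in>V. (\<lambda>x y. E x y \<and> x \<in> V \<and> y \<in> V)\<^sup>*\<^sup>* u v)"

lemma E_sym: "E u v \<Longrightarrow> E v u"
  using regular by (auto simp: regular_tree_def symp_def)

lemma E_irrefl: "\<not> E u u"
  using regular by (auto simp: regular_tree_def irreflp_def)

lemma reachable: "E\<^sup>*\<^sup>* u v"
  using regular by (auto simp: regular_tree_def)

lemma no_cycle:
  "3 \<le> length xs \<Longrightarrow> distinct xs \<Longrightarrow> successively E xs \<Longrightarrow> \<not> E (last xs) (hd xs)"
  using regular unfolding regular_tree_def by blast

lemma card_nbrs: "card (nbrs v) = d + 1"
  using regular by (auto simp: regular_tree_def nbrs_def)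

lemma finite_nbrs [simp]: "finite (nbrs v)"
  using card_nbrs[of v] by (metis Suc_eq_plus1 card.infinite nat.distinct(1))

lemma mem_nbrs [simp]: "u \<in> nbrs v \<longleftrightarrow> E v u"
  by (simp add: nbrs_def)

section \<open>Connected sets, simple paths and growth by leaves\<close>

lemma connD: "conn V \<Longrightarrow> u \<in> V \<Longrightarrow> v \<in> V \<Longrightarrow> (\<lambda>x y. E x y \<and> x \<in> V \<and> y \<in> V)\<^sup>*\<^sup>* u v"
  by (simp add: conn_def)

lemma conn_singleton [simp]: "conn {v}"
  by (auto simp: conn_def)

lemma conn_Un:
  assumes "conn U" "conn V" "U \<inter> V \<noteq> {}"
  shows "conn (U \<union> V)"
proof -
  obtain c where c: "c \<in> U" "c \<in> V" using assms(3) by blast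
  let ?R = "\<lambda>x y. E x y \<and> x \<in> U \<union> V \<and> y \<in> U \<union> V"
  have *: "?R\<^sup>*\<^sup>* x y" if "x \<in> U \<and> y \<in> U \<or> x \<in> V \<and> y \<in> V" for x y
  proof -
    have "(\<lambda>x y. E x y \<and> x \<in> U \<and> y \<in> U)\<^sup>*\<^sup>* x y \<or> (\<lambda>x y. E x y \<and> x \<in> V \<and> y \<in> V)\<^sup>*\<^sup>* x y"
      using that assms(1,2) by (auto dest: connD)
    moreover have "(\<lambda>x y. E x y \<and> x \<in> U \<and> y \<in> U) \<le> ?R" "(\<lambda>x y. E x y \<and> x \<in> V \<and> y \<in> V) \<le> ?R"
      by auto
    ultimately show ?thesis by (meson predicate2D rtranclp_mono)
  qed
  have "?R\<^sup>*\<^sup>* x c \<and> ?R\<^sup>*\<^sup>* c x" if "x \<in> U \<union> V" for x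
    using that c * by blast
  then show ?thesis unfolding conn_def by (meson rtranclp_trans)
qed

lemma conn_edge: "E u w \<Longrightarrow> conn {u, w}"
  unfolding conn_def by (auto intro!: r_into_rtranclp dest: E_sym)

lemma conn_insert: "conn V \<Longrightarrow> u \<in> V \<Longrightarrow> E u w \<Longrightarrow> conn (insert w V)"
  using conn_Un[OF _ conn_edge, of V u w] by (auto simp: insert_commute insert_absorb)

text \<open>Loop erasure: if the new starting point already lies on the path, everything before its
  occurrence is dropped.\<close>

lemma simple_path:
  assumes "R\<^sup>*\<^sup>* a b"
  shows "\<exists>xs. xs \<noteq> [] \<and> distinct xs \<and> successively R xs \<and> hd xs = a \<and> last xs = b"
  using assms
proof (induction rule: converse_rtranclp_induct)
  case base
  show ?case by (rule exI[of _ "[b]"]) simp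
next
  case (step a c)
  then obtain xs where xs: "xs \<noteq> []" "distinct xs" "successively R xs" "hd xs = c" "last xs = b"
    by blast
  show ?case
  proof (cases "a \<in> set xs")
    case False
    then show ?thesis using xs step.hyps(1)
      by (intro exI[of _ "a # xs"]) (auto simp: successively_Cons)
  next
    case True
    then obtain ys zs where "xs = ys @ a # zs" by (meson split_list)
    then show ?thesis using xs
      by (intro exI[of _ "a # zs"]) (auto simp: successively_append_iff)
  qed
qed

text \<open>A simple path inside \<open>V\<close> between two different neighbours of
  \<open>w\<close> would close up through \<open>w\<close> to a cycle. All later appeals to
  acyclicity go through this lemma.\<close>

lemma unique_nbr:
  assumes "conn V" "w \<notin> V" "u \<in> V" "u' \<in> V" "E w u" "E w u'"
  shows "u = u'"
proof (rule ccontr)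
  assume "u \<noteq> u'"
  obtain xs where xs: "xs \<noteq> []" "distinct xs" "successively (\<lambda>x y. E x y \<and> x \<in> V \<and> y \<in> V) xs"
      "hd xs = u" "last xs = u'"
    using simple_path[OF connD[OF assms(1,3,4)]] by blast
  have "successively E xs" using xs(3) by (rule successively_mono) auto
  moreover have "length xs \<ge> 2"
    using xs(1,4,5) \<open>u \<noteq> u'\<close> by (cases xs) (auto simp: Suc_le_eq split: if_splits)
  moreover have "w \<notin> set xs"
  proof
    assume "w \<in> set xs"
    then obtain ys zs where eq: "xs = ys @ w # zs" by (meson split_list)
    show False
    proof (cases zs)
      case Nil
      then show ?thesis using eq xs(5) assms by auto
    next
      case (Cons a list)
      then show ?thesis using eq xs(3) assms(2) by (auto simp: successively_append_iff)
    qed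
  qed
  ultimately have "\<not> E (last (w # xs)) (hd (w # xs))"
    using xs assms(5) by (intro no_cycle) (auto simp: successively_Cons)
  then show False using xs assms(6) E_sym by auto
qed

lemma frontier_edge:
  assumes "conn V'" "V \<subseteq> V'" "V \<noteq> {}" "V \<noteq> V'"
  shows "\<exists>u\<in>V. \<exists>w\<in>V' - V. E u w"
proof (rule ccontr)
  assume no: "\<not> ?thesis"
  obtain a b where ab: "a \<in> V" "b \<in> V'" "b \<notin> V" using assms by blast
  have "(\<lambda>x y. E x y \<and> x \<in> V' \<and> y \<in> V')\<^sup>*\<^sup>* a b" using ab assms by (auto dest: connD)
  then have "b \<in> V" by (induction) (use ab no in auto)
  then show False using ab by simp
qed

text \<open>A proper connected part always has an edge leading out of it inside \<open>V'\<close>.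
  By \<open>unique_nbr\<close> the vertex \<open>w\<close> is joined to \<open>U\<close> by the edge
  to \<open>u\<close> alone, so each step attaches a leaf; this is what makes product formulas on
  subtrees provable by induction.\<close>

lemma grow_induct [consumes 5, case_names base grow]:
  assumes "finite V'" "conn V'" "conn V" "V \<subseteq> V'" "V \<noteq> {}"
    and "P V"
    and "\<And>U u w. conn U \<Longrightarrow> finite U \<Longrightarrow> V \<subseteq> U \<Longrightarrow> insert w U \<subseteq> V' \<Longrightarrow> u \<in> U \<Longrightarrow> w \<notin> U \<Longrightarrow> E u w
           \<Longrightarrow> P U \<Longrightarrow> P (insert w U)"
  shows "P V'"
proof -
  have "P V'" if "conn U" "V \<subseteq> U" "U \<subseteq> V'" "P U" for U
    using that
  proof (induction "card (V' - U)" arbitrary: U rule: less_induct)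
    case less
    show ?case
    proof (cases "U = V'")
      case False
      then obtain u w where uw: "u \<in> U" "w \<in> V' - U" "E u w"
        using frontier_edge[of V' U] assms less.prems by blast
      have "finite U" using less.prems assms finite_subset by blast
      have "P (insert w U)" using assms(7)[of U w u] uw less.prems \<open>finite U\<close> by auto
      moreover have "card (V' - insert w U) < card (V' - U)"
        by (rule psubset_card_mono) (use uw assms(1) in auto)
      moreover have "conn (insert w U)" using conn_insert uw less.prems by blast
      ultimately show ?thesis using less.hyps[of "insert w U"] uw less.prems by auto
    qed (use less.prems in simp)
  qed
  then show ?thesis using assms by blast
qed

section \<open>Balls around a vertex\<close>

lemma mem_ball_iff: "x \<in> tree_ball E r n \<longleftrightarrow> (\<exists>k\<le>n. (E ^^ k) x r)"
proof -
  have ex: "\<exists>k. (E ^^ k) x r" using reachable[of x r] by (simp add: rtranclp_power)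
  show ?thesis
  proof
    assume "x \<in> tree_ball E r n"
    then show "\<exists>k\<le>n. (E ^^ k) x r"
      unfolding tree_ball_def graph_dist_def using LeastI_ex[OF ex] by auto
  next
    assume "\<exists>k\<le>n. (E ^^ k) x r"
    then show "x \<in> tree_ball E r n"
      unfolding tree_ball_def graph_dist_def by (auto intro: order_trans[OF Least_le])
  qed
qed

lemma ball_0 [simp]: "tree_ball E r 0 = {r}"
  by (auto simp: mem_ball_iff)

lemma ball_Suc: "tree_ball E r (Suc n) = tree_ball E r n \<union> (\<Union>x\<in>tree_ball E r n. nbrs x)"
proof (intro set_eqI iffI)
  fix x assume "x \<in> tree_ball E r (Suc n)"
  then obtain k where k: "k \<le> Suc n" "(E ^^ k) x r" by (auto simp: mem_ball_iff)
  show "x \<in> tree_ball E r n \<union> (\<Union>x\<in>tree_ball E r n. nbrs x)"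
  proof (cases k)
    case 0
    then show ?thesis using k by (auto simp: mem_ball_iff)
  next
    case (Suc m)
    then obtain y where y: "E x y" "(E ^^ m) y r" using k by (metis relpowp_Suc_E2)
    then have "y \<in> tree_ball E r n" using k Suc unfolding mem_ball_iff by (intro exI[of _ m]) auto
    then show ?thesis using y(1) E_sym by auto
  qed
next
  fix x assume "x \<in> tree_ball E r n \<union> (\<Union>x\<in>tree_ball E r n. nbrs x)"
  then show "x \<in> tree_ball E r (Suc n)"
  proof (elim UnE UN_E)
    assume "x \<in> tree_ball E r n"
    then show ?thesis by (simp add: tree_ball_def)
  next
    fix y assume "y \<in> tree_ball E r n" and "x \<in> nbrs y"
    then obtain k where k: "k \<le> n" "(E ^^ k) y r" and "E x y"
      using E_sym[of y x] by (auto simp: mem_ball_iff)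
    have "(E ^^ Suc k) x r" by (rule relpowp_Suc_I2) (fact \<open>E x y\<close>, fact k(2))
    with k(1) show ?thesis unfolding mem_ball_iff by (intro exI[of _ "Suc k"]) (simp del: relpowp.simps)
  qed
qed

lemma finite_ball [simp]: "finite (tree_ball E r n)"
  by (induction n) (auto simp: ball_Suc)

lemma ball_mono: "m \<le> n \<Longrightarrow> tree_ball E r m \<subseteq> tree_ball E r n"
  by (auto simp: tree_ball_def)

lemma root_in_ball [simp]: "r \<in> tree_ball E r n"
  using ball_mono[of 0 n r] by auto

lemma ball_nonempty [simp]: "tree_ball E r n \<noteq> {}"
  using root_in_ball by blast

lemma ball_exhausts: "\<exists>n. x \<in> tree_ball E r n"
  by (auto simp: tree_ball_def)

lemma finite_subset_ball:
  assumes "finite V"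
  shows "\<exists>n. V \<subseteq> tree_ball E r n"
  using assms
proof (induction V)
  case (insert x V)
  then obtain n m where "V \<subseteq> tree_ball E r n" "x \<in> tree_ball E r m" using ball_exhausts by blast
  then show ?case
    by (intro exI[of _ "max n m"]) (use ball_mono[of n "max n m" r] ball_mono[of m "max n m" r] in auto)
qed auto

lemma conn_ball [simp]: "conn (tree_ball E r n)"
proof (induction n)
  case (Suc n)
  let ?B = "tree_ball E r n"
  have "conn (?B \<union> F)" if "finite F" "F \<subseteq> (\<Union>x\<in>?B. nbrs x)" for F
    using that
  proof (induction F)
    case (insert y F)
    then obtain x where "x \<in> ?B" "E x y" by auto
    then show ?case using insert conn_insert[of "?B \<union> F" x y] by auto
  qed (use Suc in simp)
  then show ?case by (simp add: ball_Suc)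
qed simp

lemma countable_vertices: "countable (UNIV :: 'v set)"
proof -
  have "countable (\<Union>n. tree_ball E r n)" for r by (rule countable_UN) (auto intro: countable_finite)
  moreover have "(\<Union>n. tree_ball E r n) = UNIV" for r using ball_exhausts by auto
  ultimately show ?thesis by simp
qed

text \<open>In a finite tree the vertex attached last would be a leaf, with at most one neighbour,
  whereas every degree is \<open>d + 1\<close>, which is at least 2.\<close>

lemma infinite_vertices:
  assumes "d \<ge> 1"
  shows "infinite (UNIV :: 'v set)"
proof
  assume fin: "finite (UNIV :: 'v set)"
  obtain n where n: "tree_ball E undefined n = (UNIV :: 'v set)"
    using finite_subset_ball[OF fin] by blast
  have "finite (UNIV :: 'v set)" "conn (UNIV :: 'v set)" "conn {undefined :: 'v}"
    "{undefined :: 'v} \<subseteq> UNIV" "{undefined :: 'v} \<noteq> {}"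
    using fin n conn_ball[of undefined n] by simp_all
  \<comment> \<open>The induction predicate remembers only the last vertex attached.\<close>
  then have "UNIV = {undefined :: 'v} \<or> (\<exists>u w U. conn U \<and> u \<in> U \<and> w \<notin> U \<and> E u w \<and> UNIV = insert w U)"
    by (induction rule: grow_induct) blast+
  then show False
  proof (elim disjE exE conjE)
    assume U: "UNIV = {undefined :: 'v}"
    have "v = undefined" for v :: 'v using U by blast
    then have "nbrs undefined = {}" using E_irrefl by (metis all_not_in_conv mem_nbrs)
    then show False using card_nbrs[of undefined] by simp
  next
    fix u w U assume *: "conn U" "u \<in> U" "w \<notin> U" "E u w" "UNIV = insert w U"
    have "nbrs w \<subseteq> {u}"
      proof
      fix x assume "x \<in> nbrs w"
      then have "x \<in> U" using E_irrefl[of w] \<open>UNIV = insert w U\<close> by (cases "x = w") auto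
      then show "x \<in> {u}" using unique_nbr[of U w u x] *(1-4) E_sym[of u w] \<open>x \<in> nbrs w\<close> by auto
    qed
    then have "card (nbrs w) \<le> 1" using card_mono[of "{u}" "nbrs w"] by simp
    then show False using card_nbrs[of w] assms by simp
  qed
qed

section \<open>Embeddings of finite subtrees and automorphisms\<close>

definition partial_iso :: "'v set \<Rightarrow> ('v \<Rightarrow> 'v) \<Rightarrow> bool" where
  "partial_iso V f \<longleftrightarrow> inj_on f V \<and> (\<forall>u\<in>V. \<forall>v\<in>V. E (f u) (f v) \<longleftrightarrow> E u v)"

lemma conn_image:
  assumes "partial_iso V f" "conn V"
  shows "conn (f ` V)"
proof -
  have "(\<lambda>x y. E x y \<and> x \<in> f ` V \<and> y \<in> f ` V)\<^sup>*\<^sup>* (f u) (f v)" if "u \<in> V" "v \<in> V" for u v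
    using connD[OF assms(2) that]
  proof induction
    case (step y z)
    then have "E (f y) (f z) \<and> f y \<in> f ` V \<and> f z \<in> f ` V"
      using assms(1) by (auto simp: partial_iso_def)
    then show ?case using step.IH by (rule rtranclp.rtrancl_into_rtrancl[rotated])
  qed simp
  then show ?thesis by (auto simp: conn_def)
qed

text \<open>Inside the image, \<open>f u\<close> has as many neighbours as \<open>u\<close> has
  inside \<open>V\<close>, hence fewer than \<open>d + 1\<close>, because \<open>w\<close> is
  missing. A free neighbour of \<open>f u\<close> therefore exists and can serve as image of
  \<open>w\<close>; by \<open>unique_nbr\<close> it creates no further adjacency.\<close>

lemma partial_iso_insert:
  assumes f: "partial_iso V f" and "conn V" "finite V" "u \<in> V" "w \<notin> V" "E u w"
  shows "\<exists>w'. partial_iso (insert w V) (f(w := w'))"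
proof -
  have inj: "inj_on f V" using f by (simp add: partial_iso_def)
  have "nbrs (f u) \<inter> f ` V = f ` (nbrs u \<inter> V)"
    using f assms(4) by (auto simp: partial_iso_def)
  then have "card (nbrs (f u) \<inter> f ` V) = card (nbrs u \<inter> V)"
    using inj by (metis card_image inf_le2 inj_on_subset)
  also have "\<dots> < card (nbrs u)"
    by (rule psubset_card_mono) (use assms(5,6) in \<open>simp, fastforce\<close>)
  finally have "card (nbrs (f u) \<inter> f ` V) < card (nbrs (f u))" by (simp add: card_nbrs)
  then have "\<not> nbrs (f u) \<subseteq> f ` V" by (metis inf.absorb1 less_irrefl)
  then obtain w' where w': "E (f u) w'" "w' \<notin> f ` V"
    unfolding subset_iff mem_nbrs by blast
  have nbr: "E w v \<longleftrightarrow> v = u" if "v \<in> V" for v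
    using unique_nbr[of V w u v] assms(2,4-6) that E_sym[of u w] by blast
  have nbr': "E w' (f v) \<longleftrightarrow> v = u" if "v \<in> V" for v
  proof
    assume "E w' (f v)"
    then have "f u = f v"
      using unique_nbr[OF conn_image[OF f assms(2)], of w' "f u" "f v"] w' that assms(4) E_sym[of "f u" w'] by blast
    then show "v = u" using inj that assms(4) by (simp add: inj_on_eq_iff)
  qed (use w'(1) E_sym in blast)
  have "partial_iso (insert w V) (f(w := w'))"
    unfolding partial_iso_def
  proof (intro conjI ballI)
    show "inj_on (f(w := w')) (insert w V)" using inj w' assms(5) by (auto simp: inj_on_def)
    fix a b assume ab: "a \<in> insert w V" "b \<in> insert w V"
    have flip: "E x y \<longleftrightarrow> E y x" for x y using E_sym by blast
    show "E ((f(w := w')) a) ((f(w := w')) b) \<longleftrightarrow> E a b"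
    proof (cases "a = w"; cases "b = w")
      assume "a \<noteq> w" "b = w"
      then show ?thesis using ab nbr[of a] nbr'[of a] flip[of "f a" w'] flip[of a w] by simp
    qed (use ab f nbr nbr' E_irrefl in \<open>simp_all add: partial_iso_def\<close>)
  qed
  then show ?thesis ..
qed

lemma partial_iso_extend:
  assumes "partial_iso V f" "conn V" "V \<noteq> {}" "finite V'" "conn V'" "V \<subseteq> V'"
  shows "\<exists>f'. partial_iso V' f' \<and> (\<forall>x\<in>V. f' x = f x)"
  using assms(4,5,2,6,3)
proof (induction rule: grow_induct)
  case base
  then show ?case using assms(1) by blast
next
  case (grow U u w)
  then obtain f' where f': "partial_iso U f'" "\<forall>x\<in>V. f' x = f x" using assms(2,3) by blast
  obtain w' where "partial_iso (insert w U) (f'(w := w'))"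
    using partial_iso_insert[OF f'(1)] grow by blast
  moreover have "(f'(w := w')) x = f x" if "x \<in> V" for x
    using f'(2) that grow.hyps by auto
  ultimately show ?case by blast
qed

definition automorphism :: "('v \<Rightarrow> 'v) \<Rightarrow> bool" where
  "automorphism g \<longleftrightarrow> bij g \<and> (\<forall>u v. E (g u) (g v) \<longleftrightarrow> E u v)"

text \<open>Embeddings of the balls around \<open>r\<close>, each extending the previous one, glue
  to a map of the whole tree. Regularity then gives surjectivity.\<close>

lemma automorphism_transitive: "\<exists>g. automorphism g \<and> g r = v"
proof -
  let ?P = "\<lambda>n f. partial_iso (tree_ball E r n) f \<and> f r = v"
  have "\<exists>f. \<forall>n. ?P n (f n) \<and> (\<forall>x\<in>tree_ball E r n. f (Suc n) x = f n x)"
  proof (rule dependent_nat_choice)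
    show "\<exists>f. ?P 0 f" using E_irrefl by (intro exI[of _ "\<lambda>_. v"]) (auto simp: partial_iso_def)
  next
    fix f n assume "?P n f"
    moreover obtain f' where "partial_iso (tree_ball E r (Suc n)) f'" "\<forall>x\<in>tree_ball E r n. f' x = f x"
      using partial_iso_extend[of "tree_ball E r n" f "tree_ball E r (Suc n)"] calculation ball_mono[of n "Suc n" r]
      by (metis conn_ball empty_iff finite_ball le_SucI order_refl root_in_ball)
    ultimately show "\<exists>f'. ?P (Suc n) f' \<and> (\<forall>x\<in>tree_ball E r n. f' x = f x)"
      by (metis root_in_ball)
  qed
  then obtain f where f: "\<And>n. partial_iso (tree_ball E r n) (f n)" "\<And>n. f n r = v"
    and f_Suc: "\<And>n x. x \<in> tree_ball E r n \<Longrightarrow> f (Suc n) x = f n x"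
    by blast
  have f_mono: "f m x = f n x" if "x \<in> tree_ball E r n" "n \<le> m" for n m x
    using that(2)
  proof (induction rule: dec_induct)
    case (step k)
    then show ?case using f_Suc that(1) ball_mono[of n k r] by auto
  qed simp
  \<comment> \<open>The index is the radius of the smallest ball that contains \<open>x\<close>; by
    \<open>f_mono\<close> every larger one gives the same value.\<close>
  define g where "g x = f (graph_dist E x r) x" for x
  have g: "g x = f n x" if "x \<in> tree_ball E r n" for x n
    using f_mono[of x "graph_dist E x r" n] that by (auto simp: g_def tree_ball_def)
  have common: "\<exists>n. x \<in> tree_ball E r n \<and> y \<in> tree_ball E r n" for x y
    using finite_subset_ball[of "{x, y}" r] by auto
  have adj: "E (g x) (g y) \<longleftrightarrow> E x y" for x y
    using common[of x y] f(1) by (auto simp: g partial_iso_def)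
  have "inj g"
  proof (rule injI)
    fix x y assume "g x = g y"
    moreover obtain n where "x \<in> tree_ball E r n" "y \<in> tree_ball E r n" using common by blast
    ultimately show "x = y" using f(1)[of n] by (auto simp: g partial_iso_def inj_on_def)
  qed
  \<comment> \<open>An injection between neighbour sets of the same finite size is onto, so the
    range of \<open>g\<close> is closed under adjacency and, by connectedness, everything.\<close>
  have nbrs_g: "g ` nbrs x = nbrs (g x)" for x
  proof (rule card_subset_eq)
    show "card (g ` nbrs x) = card (nbrs (g x))"
      using card_image[OF inj_on_subset[OF \<open>inj g\<close>, of "nbrs x"]] by (simp add: card_nbrs)
  qed (use adj in auto)
  have "y \<in> range g" for y
    using reachable[of "g r" y]
  proof induction
    case (step y z)
    then obtain x where "y = g x" by blast
    then have "z \<in> g ` nbrs x" using step.hyps(2) nbrs_g by simp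
    then show ?case by blast
  qed simp
  then have "automorphism g"
    unfolding automorphism_def bij_def using \<open>inj g\<close> adj by blast
  moreover have "g r = v" using g[of r 0] f(2) by simp
  ultimately show ?thesis by blast
qed

lemma automorphism_partial_iso: "automorphism g \<Longrightarrow> partial_iso V g"
  unfolding automorphism_def partial_iso_def by (meson bij_is_inj inj_on_subset top_greatest)

lemma automorphism_relpowp:
  assumes "automorphism g" shows "(E ^^ k) x y \<Longrightarrow> (E ^^ k) (g x) (g y)"
proof (induction k arbitrary: y)
  case (Suc k)
  then obtain z where "(E ^^ k) x z" "E z y" by auto
  then show ?case using Suc.IH assms by (auto simp: automorphism_def)
qed simp

text \<open>The root is moved to a vertex \<open>v\<close> outside the ball of radius
  \<open>m + n\<close>. A common point of the two balls would join \<open>v\<close> to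
  \<open>r\<close> by a walk of length at most \<open>m + n\<close>.\<close>

lemma far_automorphism:
  assumes "d \<ge> 1"
  shows "\<exists>g. automorphism g \<and> g ` tree_ball E r m \<inter> tree_ball E r n = {}"
proof -
  obtain v where v: "v \<notin> tree_ball E r (m + n)"
    using infinite_vertices[OF assms] finite_ball[of r "m + n"] by (metis UNIV_eq_I)
  obtain g where g: "automorphism g" "g r = v" using automorphism_transitive by blast
  have sym: "(E ^^ k) y x" if "(E ^^ k) x y" for k x y
    using that
  proof (induction k arbitrary: y)
    case (Suc k)
    then show ?case using E_sym by (metis relpowp_Suc_E relpowp_Suc_I2)
  qed simp
  have False if x: "x \<in> tree_ball E r m" "g x \<in> tree_ball E r n" for x
  proof -
    obtain k l where "k \<le> m" "(E ^^ k) x r" "l \<le> n" "(E ^^ l) (g x) r"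
      using x by (auto simp: mem_ball_iff)
    then have "(E ^^ k) v (g x)" using automorphism_relpowp[OF g(1), of k x r] g(2) sym by auto
    then have "(E ^^ (k + l)) v r" using \<open>(E ^^ l) (g x) r\<close> by (auto simp: relpowp_add)
    moreover have "k + l \<le> m + n" using \<open>k \<le> m\<close> \<open>l \<le> n\<close> by simp
    ultimately show False using v by (auto simp: mem_ball_iff)
  qed
  then show ?thesis using g by blast
qed

end


section \<open>Events of the configuration space\<close>

text \<open>Unlike the members of \<open>configs\<close>, \<open>s\<close> need not be extensional,
  so a single function can name patterns on several vertex sets.\<close>

definition pattern :: "nat \<Rightarrow> 'v set \<Rightarrow> ('v \<Rightarrow> nat) \<Rightarrow> ('v \<Rightarrow> nat) set" where
  "pattern q V s = {\<omega> \<in> space (config_space q). \<forall>x\<in>V. \<omega> x = s x}"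

lemma space_config_space: "space (config_space q) = {\<omega>. \<forall>x. \<omega> x \<in> {1..q}}"
  by (auto simp: config_space_def space_PiM PiE_def Pi_def)

lemma measurable_spin [measurable]: "(\<lambda>\<omega>. \<omega> x) \<in> measurable (config_space q) (count_space {1..q})"
  unfolding config_space_def by (rule measurable_component_singleton) simp

lemma measurable_into_config_space:
  assumes "\<And>x. (\<lambda>\<omega>. f \<omega> x) \<in> measurable M (count_space {1..q})"
  shows "f \<in> measurable M (config_space q)"
  unfolding config_space_def
  by (rule measurable_PiM_single') (use assms measurable_space[OF assms] in auto)

lemma finite_configs [simp]: "finite V \<Longrightarrow> finite (configs q V)"
  by (auto simp: configs_def intro: finite_PiE)

lemma configs_iff: "s \<in> configs q V \<longleftrightarrow> s \<in> extensional V \<and> (\<forall>x\<in>V. s x \<in> {1..q})"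
  by (auto simp: configs_def PiE_def Pi_def)

lemma restrict_in_configs: "\<omega> \<in> space (config_space q) \<Longrightarrow> restrict \<omega> V \<in> configs q V"
  by (auto simp: configs_iff space_config_space)

lemma pattern_sets [measurable, simp]:
  assumes "finite V" shows "pattern q V s \<in> sets (config_space q)"
proof -
  have "Measurable.pred (config_space q) (\<lambda>\<omega>. \<omega> x = s x)" for x
    by (rule measurable_compose[OF measurable_spin]) simp
  then show ?thesis using assms unfolding pattern_def by measurable
qed

lemma pattern_cong: "(\<And>x. x \<in> V \<Longrightarrow> s x = t x) \<Longrightarrow> pattern q V s = pattern q V t"
  by (auto simp: pattern_def)

lemma pattern_Int:
  assumes "\<And>x. x \<in> V \<Longrightarrow> u x = s x" "\<And>x. x \<in> W \<Longrightarrow> u x = t x"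
  shows "pattern q V s \<inter> pattern q W t = pattern q (V \<union> W) u"
  using assms by (auto simp: pattern_def)

lemma disjoint_patterns: "disjoint_family_on (pattern q V) (configs q V)"
proof (unfold disjoint_family_on_def, intro ballI impI)
  fix s t assume st: "s \<in> configs q V" "t \<in> configs q V" "s \<noteq> t"
  then obtain x where "x \<in> V" "s x \<noteq> t x" by (metis configs_iff extensionalityI)
  then show "pattern q V s \<inter> pattern q V t = {}" by (auto simp: pattern_def)
qed

lemma cylinder_eq_UN:
  assumes "S \<subseteq> configs q V"
  shows "cylinder q V S = (\<Union>t\<in>S. pattern q V t)"
proof (intro set_eqI iffI)
  fix \<omega> assume "\<omega> \<in> cylinder q V S"
  then show "\<omega> \<in> (\<Union>t\<in>S. pattern q V t)"
    by (auto simp: cylinder_def pattern_def intro!: bexI[of _ "restrict \<omega> V"])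
next
  fix \<omega> assume "\<omega> \<in> (\<Union>t\<in>S. pattern q V t)"
  then obtain t where t: "t \<in> S" "\<omega> \<in> pattern q V t" by blast
  then have "restrict \<omega> V = t"
    using assms by (auto simp: pattern_def configs_iff fun_eq_iff extensional_def)
  then show "\<omega> \<in> cylinder q V S" using t by (auto simp: cylinder_def pattern_def)
qed

lemma cylinder_singleton: "s \<in> configs q V \<Longrightarrow> cylinder q V {s} = pattern q V s"
  using cylinder_eq_UN[of "{s}" q V] by simp

lemma cylinder_sets [measurable, simp]:
  assumes "finite V" "S \<subseteq> configs q V"
  shows "cylinder q V S \<in> sets (config_space q)"
  unfolding cylinder_eq_UN[OF assms(2)]
  by (rule sets.finite_UN) (use assms finite_subset[OF assms(2)] in auto)

lemma cylinder_enlarge: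
  assumes "V \<subseteq> W"
  shows "cylinder q V S = cylinder q W {t \<in> configs q W. restrict t V \<in> S}"
proof -
  have "restrict (restrict \<omega> W) V = restrict \<omega> V" for \<omega> :: "'a \<Rightarrow> nat"
    using assms by (auto simp: fun_eq_iff restrict_def)
  then show ?thesis by (auto simp: cylinder_def intro: restrict_in_configs)
qed

lemma pattern_eq_cylinder:
  assumes "V \<subseteq> W"
  shows "pattern q V s = cylinder q W {t \<in> configs q W. \<forall>x\<in>V. t x = s x}"
  using assms by (auto simp: cylinder_def pattern_def restrict_in_configs subset_iff)

lemma emeasure_cylinder:
  assumes "finite V" "S \<subseteq> configs q V" "sets M = sets (config_space q)"
  shows "emeasure M (cylinder q V S) = (\<Sum>t\<in>S. emeasure M (pattern q V t))"
  unfolding cylinder_eq_UN[OF assms(2)]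
  by (rule sum_emeasure[symmetric])
     (use assms finite_subset[OF assms(2)] disjoint_family_on_mono[OF _ disjoint_patterns] in auto)

lemma measure_cylinder:
  assumes "finite_measure M" "finite V" "S \<subseteq> configs q V" "sets M = sets (config_space q)"
  shows "measure M (cylinder q V S) = (\<Sum>t\<in>S. measure M (pattern q V t))"
  unfolding cylinder_eq_UN[OF assms(3)]
  by (rule finite_measure.finite_measure_finite_Union)
     (use assms finite_subset[OF assms(3)] disjoint_family_on_mono[OF _ disjoint_patterns] in auto)

section \<open>Determination and approximation of measures by cylinder events\<close>

definition patterns :: "nat \<Rightarrow> ('v \<Rightarrow> nat) set set" where
  "patterns q = insert {} {pattern q V s | V s. finite V}"

lemma Int_stable_patterns: "Int_stable (patterns q)"
proof (rule Int_stableI)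
  fix A B :: "('v \<Rightarrow> nat) set" assume "A \<in> patterns q" "B \<in> patterns q"
  then consider "A \<inter> B = {}" | V W s t where "A = pattern q V s" "B = pattern q W t" "finite V" "finite W" "A \<inter> B \<noteq> {}"
    unfolding patterns_def by blast
  then show "A \<inter> B \<in> patterns q"
  proof cases
    case 2
    then obtain \<omega> where "\<omega> \<in> A \<inter> B" by blast
    \<comment> \<open>Any point of the intersection carries both prescribed patterns and can name
      their union.\<close>
    then have "A \<inter> B = pattern q (V \<union> W) \<omega>"
      using pattern_Int[of V \<omega> s W t q] 2 by (auto simp: pattern_def)
    then show ?thesis using 2 by (auto simp: patterns_def)
  qed (simp add: patterns_def)
qed

lemma sets_config_space:
  "sets (config_space q) = sigma_sets (space (config_space q)) (patterns q :: ('v \<Rightarrow> nat) set set)"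
proof (rule antisym)
  have "{f \<in> space (config_space q). f x \<in> A} \<in> sigma_sets (space (config_space q)) (patterns q)"
    if "A \<subseteq> {1..q}" for x :: 'v and A
  proof -
    have "{f \<in> space (config_space q). f x \<in> A} = (\<Union>a\<in>A. pattern q {x} (\<lambda>_. a))"
      by (auto simp: pattern_def)
    moreover have "countable A" using that by (auto intro: countable_finite finite_subset)
    moreover have "pattern q {x} (\<lambda>_. a) \<in> sigma_sets (space (config_space q)) (patterns q)" for a
      by (rule sigma_sets.Basic) (auto simp: patterns_def)
    ultimately show ?thesis by (auto intro: sigma_sets_UNION)
  qed
  then show "sets (config_space q) \<subseteq> sigma_sets (space (config_space q)) (patterns q :: ('v \<Rightarrow> nat) set set)"
    unfolding config_space_def sets_PiM_single
    by (subst space_PiM[symmetric], intro sigma_sets_mono) (auto simp: space_PiM)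
  show "sigma_sets (space (config_space q)) (patterns q) \<subseteq> sets (config_space q)"
    by (rule sets.sigma_sets_subset) (auto simp: patterns_def)
qed

text \<open>A pattern on \<open>V\<close> is a finite disjoint union of patterns on a larger
  \<open>W\<close>. Hence a cofinal family of vertex sets is enough, for instance all balls, or all
  sets containing a given vertex and its neighbours.\<close>

lemma config_measure_eqI:
  assumes sets_M: "sets M = sets (config_space q)" "sets N = sets (config_space q)" and "finite_measure M"
    and eq: "\<And>V. finite V \<Longrightarrow>
      \<exists>W. finite W \<and> V \<subseteq> W \<and> (\<forall>t\<in>configs q W. emeasure M (pattern q W t) = emeasure N (pattern q W t))"
  shows "M = N"
proof (rule measure_eqI_generator_eq_countable)
  interpret finite_measure M by fact
  show "Int_stable (patterns q :: ('a \<Rightarrow> nat) set set)" by (rule Int_stable_patterns)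
  show "patterns q \<subseteq> Pow (space (config_space q))" by (auto simp: patterns_def pattern_def)
  show "sets M = sigma_sets (space (config_space q)) (patterns q)"
    "sets N = sigma_sets (space (config_space q)) (patterns q)"
    using sets_M sets_config_space by auto
  show "emeasure M X = emeasure N X" if mem: "X \<in> patterns q" for X
  proof (cases "X = {}")
    case False
    then obtain V s where X: "X = pattern q V s" "finite V" using mem unfolding patterns_def by blast
    obtain W where W: "finite W" "V \<subseteq> W"
      "\<forall>t\<in>configs q W. emeasure M (pattern q W t) = emeasure N (pattern q W t)"
      using eq[OF X(2)] by blast
    show ?thesis
      using W by (simp add: X(1) pattern_eq_cylinder[OF W(2)] emeasure_cylinder sets_M)
  qed simp
  have "space (config_space q) = pattern q {} undefined" by (simp add: pattern_def)
  then show "{space (config_space q)} \<subseteq> (patterns q :: ('a \<Rightarrow> nat) set set)"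
    by (auto simp: patterns_def)
qed (use \<open>finite_measure M\<close> in \<open>auto simp: finite_measure.emeasure_finite\<close>)

text \<open>There are finitely many configurations on \<open>V\<close>, so every preimage is a
  cylinder event, whatever the target set.\<close>

lemma borel_measurable_local:
  fixes f :: "('v \<Rightarrow> nat) \<Rightarrow> 'b :: topological_space"
  assumes "finite V" and loc: "\<And>\<omega> \<omega>'. (\<And>x. x \<in> V \<Longrightarrow> \<omega> x = \<omega>' x) \<Longrightarrow> f \<omega> = f \<omega>'"
  shows "f \<in> borel_measurable (config_space q)"
proof (rule measurableI)
  fix A :: "'b set"
  have "f -` A \<inter> space (config_space q) = cylinder q V {t \<in> configs q V. f t \<in> A}"
    using loc[of "restrict _ V"] by (auto simp: cylinder_def restrict_in_configs)
  then show "f -` A \<inter> space (config_space q) \<in> sets (config_space q)"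
    using assms(1) by simp
qed simp

text \<open>Induction over the generated \<sigma>-algebra: complementation does not change symmetric
  differences, and a countable union is cut off at a finite stage before its members are
  approximated.\<close>

lemma cylinder_approximation:
  assumes "finite_measure M" and sets_M: "sets M = sets (config_space q)" and "A \<in> sets (config_space q)" "0 < e"
  shows "\<exists>V S. finite V \<and> S \<subseteq> configs q V \<and> measure M (sym_diff A (cylinder q V S)) < e"
  using assms(3,4) unfolding sets_config_space
proof (induction arbitrary: e rule: sigma_sets.induct)
  case (Basic A)
  have "\<exists>V S. finite V \<and> S \<subseteq> configs q V \<and> A = cylinder q V S"
  proof (cases "A = {}")
    case True
    then show ?thesis by (intro exI[of _ "{}"]) (simp add: cylinder_def)
  next
    case False
    then obtain V s where "A = pattern q V s" "finite V" using Basic(1) unfolding patterns_def by blast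
    then show ?thesis using pattern_eq_cylinder[of V V q s]
      by (intro exI[of _ V] exI[of _ "{t \<in> configs q V. \<forall>x\<in>V. t x = s x}"]) auto
  qed
  then obtain V S where VS: "finite V" "S \<subseteq> configs q V" "A = cylinder q V S" by blast
  then show ?case using Basic(2) by (intro exI[of _ V] exI[of _ S]) simp
next
  case Empty
  then show ?case by (intro exI[of _ "{}"]) (simp add: cylinder_def)
next
  case (Compl A)
  then obtain V S where VS: "finite V" "S \<subseteq> configs q V" "measure M (sym_diff A (cylinder q V S)) < e"
    by blast
  have "cylinder q V (configs q V - S) = space (config_space q) - cylinder q V S"
    by (auto simp: cylinder_def restrict_in_configs)
  moreover have "A \<subseteq> space (config_space q)"
    using Compl(1) sets.sets_into_space unfolding sets_config_space[symmetric] by blast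
  ultimately have "sym_diff (space (config_space q) - A) (cylinder q V (configs q V - S))
      = sym_diff A (cylinder q V S)"
    by (auto simp: cylinder_def)
  then show ?case using VS by (intro exI[of _ V] exI[of _ "configs q V - S"]) auto
next
  case (Union A)
  interpret finite_measure M by fact
  have A: "A n \<in> sets M" for n using Union(1) unfolding sets_M sets_config_space .
  let ?B = "\<lambda>n. \<Union>i<n. A i"
  have "(\<lambda>n. measure M (?B n)) \<longlonglongrightarrow> measure M (\<Union>n. ?B n)"
    by (rule finite_Lim_measure_incseq) (use A in \<open>auto simp: incseq_def\<close>, force)
  moreover have "(\<Union>n. ?B n) = (\<Union>n. A n)" by blast
  ultimately obtain n where n: "\<bar>measure M (?B n) - measure M (\<Union>n. A n)\<bar> < e / 2"
    using Union.prems unfolding lim_sequentially dist_real_def by (metis (no_types, lifting) half_gt_zero order_refl)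
  have "measure M ((\<Union>n. A n) - ?B n) = measure M (\<Union>n. A n) - measure M (?B n)"
    by (rule finite_measure_Diff) (use A in auto)
  with n have tail: "measure M ((\<Union>n. A n) - ?B n) < e / 2" by linarith
  \<comment> \<open>Half of \<open>e\<close> is left for the \<open>n\<close> retained members;
    \<open>n + 1\<close> keeps the denominator positive when \<open>n = 0\<close>.\<close>
  have "\<forall>i. \<exists>V S. finite V \<and> S \<subseteq> configs q V \<and>
      measure M (sym_diff (A i) (cylinder q V S)) < e / (2 * (real n + 1))"
    using Union.IH Union.prems by (auto intro!: divide_pos_pos)
  then obtain V S where VS: "\<And>i. finite (V i)" "\<And>i. S i \<subseteq> configs q (V i)"
    "\<And>i. measure M (sym_diff (A i) (cylinder q (V i) (S i))) < e / (2 * (real n + 1))"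
    by metis
  let ?W = "\<Union>i<n. V i"
  let ?T = "{t \<in> configs q ?W. \<exists>i<n. restrict t (V i) \<in> S i}"
  have "cylinder q ?W ?T = (\<Union>i<n. cylinder q (V i) (S i))"
  proof -
    have "cylinder q (V i) (S i) = cylinder q ?W {t \<in> configs q ?W. restrict t (V i) \<in> S i}" if "i < n" for i
      by (rule cylinder_enlarge) (use that in auto)
    moreover have "cylinder q ?W ?T = (\<Union>i<n. cylinder q ?W {t \<in> configs q ?W. restrict t (V i) \<in> S i})"
      by (auto simp: cylinder_def)
    ultimately show ?thesis by simp
  qed
  then have sub: "sym_diff (\<Union>n. A n) (cylinder q ?W ?T) \<subseteq>
      ((\<Union>n. A n) - ?B n) \<union> (\<Union>i<n. sym_diff (A i) (cylinder q (V i) (S i)))"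
    by auto
  have C: "cylinder q (V i) (S i) \<in> sets M" for i using VS by (simp add: sets_M)
  have "measure M (sym_diff (\<Union>n. A n) (cylinder q ?W ?T)) \<le>
      measure M (((\<Union>n. A n) - ?B n) \<union> (\<Union>i<n. sym_diff (A i) (cylinder q (V i) (S i))))"
    by (rule finite_measure_mono[OF sub]) (use A C in auto)
  also have "\<dots> \<le> measure M ((\<Union>n. A n) - ?B n) + measure M (\<Union>i<n. sym_diff (A i) (cylinder q (V i) (S i)))"
    by (rule measure_Un_le) (use A C in auto)
  also have "\<dots> \<le> measure M ((\<Union>n. A n) - ?B n) + (\<Sum>i<n. measure M (sym_diff (A i) (cylinder q (V i) (S i))))"
    by (intro add_left_mono finite_measure_subadditive_finite) (use A C in auto)
  also have "\<dots> \<le> measure M ((\<Union>n. A n) - ?B n) + (\<Sum>i<n. e / (2 * (real n + 1)))"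
    by (intro add_left_mono sum_mono less_imp_le VS)
  also have "\<dots> < e / 2 + e / 2"
  proof (rule add_less_le_mono[OF tail])
    show "(\<Sum>i<n. e / (2 * (real n + 1))) \<le> e / 2" using Union.prems by (simp add: field_simps)
  qed
  finally show ?case
    by (intro exI[of _ ?W] exI[of _ ?T]) (use VS in auto)
qed


section \<open>Gibbs measures and spin exchanges\<close>

definition swap_val :: "'a \<Rightarrow> 'a \<Rightarrow> 'a \<Rightarrow> 'a" where
  "swap_val i j k = (if k = i then j else if k = j then i else k)"

lemma swap_val_involutory [simp]: "swap_val i j (swap_val i j k) = k"
  by (simp add: swap_val_def)

text \<open>Transposing two values, rather than prescribing a new one, gives an involution of the
  configuration space, so image measures and preimages of patterns are easily computed.\<close>

definition swap_spins :: "'v \<Rightarrow> nat \<Rightarrow> nat \<Rightarrow> ('v \<Rightarrow> nat) \<Rightarrow> 'v \<Rightarrow> nat" where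
  "swap_spins v i j s = s(v := swap_val i j (s v))"

lemma swap_spins_involutory [simp]: "swap_spins v i j (swap_spins v i j \<omega>) = \<omega>"
  by (simp add: swap_spins_def)

lemma swap_spins_apply: "swap_spins v i j \<omega> x = (if x = v then swap_val i j (\<omega> v) else \<omega> x)"
  by (simp add: swap_spins_def)

lemma swap_spins_in_space:
  "i \<in> {1..q} \<Longrightarrow> j \<in> {1..q} \<Longrightarrow> \<omega> \<in> space (config_space q) \<Longrightarrow>
    swap_spins v i j \<omega> \<in> space (config_space q)"
  unfolding space_config_space by (auto simp: swap_spins_apply swap_val_def)

lemma swap_spins_in_configs:
  "i \<in> {1..q} \<Longrightarrow> j \<in> {1..q} \<Longrightarrow> s \<in> configs q V \<Longrightarrow> v \<in> V \<Longrightarrow> swap_spins v i j s \<in> configs q V"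
  unfolding configs_iff by (auto simp: swap_spins_apply swap_val_def extensional_def)

lemma measurable_swap_spins [measurable]:
  assumes "i \<in> {1..q}" "j \<in> {1..q}"
  shows "swap_spins v i j \<in> measurable (config_space q) (config_space q)"
proof (rule measurable_into_config_space)
  fix x
  have "swap_val i j \<in> measurable (count_space {1..q}) (count_space {1..q})"
    using assms by (auto simp: swap_val_def)
  from measurable_compose[OF measurable_spin[of v] this]
  show "(\<lambda>\<omega>. swap_spins v i j \<omega> x) \<in> measurable (config_space q) (count_space {1..q})"
    using measurable_spin[of x q] by (cases "x = v") (simp_all add: swap_spins_apply)
qed

lemma swap_spins_mem_pattern:
  assumes "i \<in> {1..q}" "j \<in> {1..q}" "v \<in> V" "\<omega> \<in> space (config_space q)"
  shows "swap_spins v i j \<omega> \<in> pattern q V s \<longleftrightarrow> \<omega> \<in> pattern q V (swap_spins v i j s)"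
proof -
  have "swap_val i j (\<omega> v) = s v \<longleftrightarrow> \<omega> v = swap_val i j (s v)" by (auto simp: swap_val_def)
  then show ?thesis
    using assms swap_spins_in_space[OF assms(1,2,4)]
    by (auto simp: pattern_def swap_spins_apply)
qed

section \<open>Boltzmann weights and their change under a spin exchange\<close>

context reg_tree
begin

lemma edges_within_insert:
  assumes "w \<notin> V"
  shows "edges_within E (insert w V) = edges_within E V \<union> (\<lambda>u. {w, u}) ` (V \<inter> nbrs w)"
proof (intro set_eqI iffI)
  fix e assume "e \<in> edges_within E (insert w V)"
  then obtain u v where "e = {u, v}" "u \<in> insert w V" "v \<in> insert w V" "E u v"
    by (auto simp: edges_within_def)
  then show "e \<in> edges_within E V \<union> (\<lambda>u. {w, u}) ` (V \<inter> nbrs w)"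
    using E_irrefl[of w] E_sym[of u v] by (auto simp: edges_within_def insert_commute)
next
  fix e assume "e \<in> edges_within E V \<union> (\<lambda>u. {w, u}) ` (V \<inter> nbrs w)"
  then show "e \<in> edges_within E (insert w V)"
    unfolding edges_within_def by (elim UnE imageE) auto
qed

lemma finite_edges_within: "finite V \<Longrightarrow> finite (edges_within E V)"
  by (rule finite_subset[of _ "(\<lambda>(u, v). {u, v}) ` (V \<times> V)"]) (auto simp: edges_within_def)

lemma interaction_insert:
  assumes "finite V" "w \<notin> V"
  shows "interaction E (insert w V) \<sigma> = interaction E V \<sigma> + (\<Sum>u\<in>V \<inter> nbrs w. of_bool (\<sigma> u = \<sigma> w))"
proof -
  have "inj_on (\<lambda>u. {w, u}) (V \<inter> nbrs w)" by (auto simp: inj_on_def doubleton_eq_iff)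
  moreover have "edges_within E V \<inter> (\<lambda>u. {w, u}) ` (V \<inter> nbrs w) = {}"
    using assms(2) by (auto simp: edges_within_def doubleton_eq_iff)
  moreover have "(\<Sum>u\<in>V \<inter> nbrs w. of_bool (\<forall>a\<in>{w, u}. \<forall>b\<in>{w, u}. \<sigma> a = \<sigma> b) :: real) =
      (\<Sum>u\<in>V \<inter> nbrs w. of_bool (\<sigma> u = \<sigma> w))"
    by (intro sum.cong refl arg_cong[where f = of_bool]) auto
  ultimately show ?thesis
    unfolding interaction_def edges_within_insert[OF assms(2)]
    using assms(1) by (simp only: sum.union_disjoint finite_edges_within finite_imageI finite_Int
      sum.reindex o_def disjI1)
qed

lemma interaction_cong:
  assumes "\<And>x. x \<in> V \<Longrightarrow> \<sigma> x = \<tau> x"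
  shows "interaction E V \<sigma> = interaction E V \<tau>"
proof -
  have "\<sigma> x = \<tau> x" if "e \<in> edges_within E V" "x \<in> e" for e x
    using that assms by (auto simp: edges_within_def)
  then show ?thesis unfolding interaction_def
    by (intro sum.cong refl arg_cong[where f = of_bool]) simp
qed

lemma finite_edge_boundary: "finite V \<Longrightarrow> finite (edge_boundary E V)"
  by (rule finite_subset[of _ "Sigma V nbrs"]) (auto simp: edge_boundary_def)

end

locale potts = reg_tree d E for d :: nat and E :: "'v \<Rightarrow> 'v \<Rightarrow> bool" +
  fixes q :: nat and \<beta> :: real and H :: "nat \<Rightarrow> real"
begin

abbreviation \<Omega> :: "('v \<Rightarrow> nat) measure" where
  "\<Omega> \<equiv> config_space q"

definition spin_weight :: "'v \<Rightarrow> ('v \<Rightarrow> nat) \<Rightarrow> nat \<Rightarrow> real" where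
  "spin_weight v \<omega> k = exp (\<beta> * (\<Sum>u\<in>nbrs v. of_bool (\<omega> u = k)) + H k)"

text \<open>The ratio of Boltzmann weights after and before the exchange. Only terms at
  \<open>v\<close> change, so the ratio depends on the spins at \<open>v\<close> and its neighbours
  alone.\<close>

definition swap_density :: "'v \<Rightarrow> nat \<Rightarrow> nat \<Rightarrow> ('v \<Rightarrow> nat) \<Rightarrow> real" where
  "swap_density v i j \<omega> = spin_weight v \<omega> (swap_val i j (\<omega> v)) / spin_weight v \<omega> (\<omega> v)"

lemma spin_weight_cong: "(\<And>x. x \<in> nbrs v \<Longrightarrow> \<omega> x = \<omega>' x) \<Longrightarrow> spin_weight v \<omega> k = spin_weight v \<omega>' k"
  unfolding spin_weight_def
  by (intro arg_cong[where f = exp] arg_cong2[where f = "(+)"] arg_cong2[where f = "(*)"] sum.cong) auto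

lemma spin_weight_pos: "spin_weight v \<omega> k > 0"
  by (simp add: spin_weight_def)

lemma swap_density_cong:
  "(\<And>x. x \<in> insert v (nbrs v) \<Longrightarrow> \<omega> x = \<omega>' x) \<Longrightarrow> swap_density v i j \<omega> = swap_density v i j \<omega>'"
  unfolding swap_density_def using spin_weight_cong[of v \<omega> \<omega>'] by simp

lemma swap_density_pos: "swap_density v i j \<omega> > 0"
  by (simp add: swap_density_def spin_weight_pos)

lemma measurable_swap_density [measurable]: "swap_density v i j \<in> borel_measurable \<Omega>"
  by (rule borel_measurable_local[of "insert v (nbrs v)"]) (auto intro: swap_density_cong)

text \<open>All terms of the exponent that involve the spin at \<open>v\<close> are split off. Edges
  from \<open>v\<close> inside \<open>\<Lambda>\<close> and edges from \<open>v\<close> across its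
  boundary merge into one sum over neighbours, taken in the configuration that is
  \<open>\<sigma>\<close> inside and \<open>\<eta>\<close> outside.\<close>

lemma finvol_weight_factor:
  assumes "finite \<Lambda>" "v \<in> \<Lambda>"
  shows "finvol_weight E \<beta> H \<Lambda> \<eta> \<sigma> =
    exp (\<beta> * interaction E (\<Lambda> - {v}) \<sigma>
       + \<beta> * (\<Sum>(u, w)\<in>{(u, w) \<in> edge_boundary E \<Lambda>. u \<noteq> v}. of_bool (\<sigma> u = \<eta> w))
       + (\<Sum>u\<in>\<Lambda> - {v}. H (\<sigma> u))) * spin_weight v (override_on \<eta> \<sigma> \<Lambda>) (\<sigma> v)"
proof -
  have "interaction E \<Lambda> \<sigma> = interaction E (\<Lambda> - {v}) \<sigma> + (\<Sum>u\<in>(\<Lambda> - {v}) \<inter> nbrs v. of_bool (\<sigma> u = \<sigma> v))"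
    using interaction_insert[of "\<Lambda> - {v}" v \<sigma>] assms by (simp add: insert_absorb)
  also have "(\<Lambda> - {v}) \<inter> nbrs v = nbrs v \<inter> \<Lambda>" using E_irrefl by auto
  finally have 1: "interaction E \<Lambda> \<sigma> = interaction E (\<Lambda> - {v}) \<sigma> + (\<Sum>u\<in>nbrs v \<inter> \<Lambda>. of_bool (\<sigma> u = \<sigma> v))" .
  let ?g = "\<lambda>(u, w). of_bool (\<sigma> u = \<eta> w) :: real"
  have "edge_boundary E \<Lambda> = {(u, w) \<in> edge_boundary E \<Lambda>. u \<noteq> v} \<union> Pair v ` (nbrs v - \<Lambda>)"
    using assms(2) by (auto simp: edge_boundary_def)
  moreover have "sum ?g ({(u, w) \<in> edge_boundary E \<Lambda>. u \<noteq> v} \<union> Pair v ` (nbrs v - \<Lambda>)) =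
      sum ?g {(u, w) \<in> edge_boundary E \<Lambda>. u \<noteq> v} + sum ?g (Pair v ` (nbrs v - \<Lambda>))"
    by (rule sum.union_disjoint)
      (use finite_subset[OF _ finite_edge_boundary[OF assms(1)], of "{(u, w) \<in> edge_boundary E \<Lambda>. u \<noteq> v}"] in auto)
  moreover have "sum ?g (Pair v ` (nbrs v - \<Lambda>)) = (\<Sum>w\<in>nbrs v - \<Lambda>. of_bool (\<eta> w = \<sigma> v))"
    by (subst sum.reindex) (auto simp: inj_on_def eq_commute simp del: sum_of_bool_eq intro!: sum.cong)
  ultimately have 2: "sum ?g (edge_boundary E \<Lambda>) =
      sum ?g {(u, w) \<in> edge_boundary E \<Lambda>. u \<noteq> v} + (\<Sum>w\<in>nbrs v - \<Lambda>. of_bool (\<eta> w = \<sigma> v))"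
    by (simp only:)
  have "(\<Sum>u\<in>nbrs v. of_bool (override_on \<eta> \<sigma> \<Lambda> u = \<sigma> v) :: real) =
      (\<Sum>u\<in>nbrs v \<inter> \<Lambda>. of_bool (override_on \<eta> \<sigma> \<Lambda> u = \<sigma> v)) +
      (\<Sum>u\<in>nbrs v - \<Lambda>. of_bool (override_on \<eta> \<sigma> \<Lambda> u = \<sigma> v))"
    by (rule sum.Int_Diff) simp
  then have 3: "(\<Sum>u\<in>nbrs v. of_bool (override_on \<eta> \<sigma> \<Lambda> u = \<sigma> v) :: real) =
      (\<Sum>u\<in>nbrs v \<inter> \<Lambda>. of_bool (\<sigma> u = \<sigma> v)) + (\<Sum>w\<in>nbrs v - \<Lambda>. of_bool (\<eta> w = \<sigma> v))"
    by (simp add: override_on_def cong: sum.cong_simp del: sum_of_bool_eq)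
  have 4: "(\<Sum>u\<in>\<Lambda>. H (\<sigma> u)) = H (\<sigma> v) + (\<Sum>u\<in>\<Lambda> - {v}. H (\<sigma> u))"
    using assms by (simp add: sum.remove)
  show ?thesis
    unfolding finvol_weight_def spin_weight_def 1 2 3 4
    by (simp add: exp_add[symmetric] algebra_simps del: sum_of_bool_eq)
qed

lemma finvol_weight_swap:
  assumes "finite \<Lambda>" "v \<in> \<Lambda>"
  shows "finvol_weight E \<beta> H \<Lambda> \<eta> (swap_spins v i j \<sigma>) =
    swap_density v i j (override_on \<eta> \<sigma> \<Lambda>) * finvol_weight E \<beta> H \<Lambda> \<eta> \<sigma>"
proof -
  let ?s = "swap_spins v i j \<sigma>"
  have "interaction E (\<Lambda> - {v}) ?s = interaction E (\<Lambda> - {v}) \<sigma>"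
    by (rule interaction_cong) (simp add: swap_spins_apply)
  moreover have "(\<Sum>(u, w)\<in>{(u, w) \<in> edge_boundary E \<Lambda>. u \<noteq> v}. of_bool (?s u = \<eta> w) :: real)
      = (\<Sum>(u, w)\<in>{(u, w) \<in> edge_boundary E \<Lambda>. u \<noteq> v}. of_bool (\<sigma> u = \<eta> w))"
    by (intro sum.cong) (auto simp: swap_spins_apply)
  moreover have "(\<Sum>u\<in>\<Lambda> - {v}. H (?s u)) = (\<Sum>u\<in>\<Lambda> - {v}. H (\<sigma> u))"
    by (intro sum.cong) (auto simp: swap_spins_apply)
  moreover have "spin_weight v (override_on \<eta> ?s \<Lambda>) k = spin_weight v (override_on \<eta> \<sigma> \<Lambda>) k" for k
    by (rule spin_weight_cong) (use E_irrefl in \<open>auto simp: override_on_def swap_spins_apply\<close>)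
  moreover have "override_on \<eta> \<sigma> \<Lambda> v = \<sigma> v" "?s v = swap_val i j (\<sigma> v)"
    using assms by (auto simp: swap_spins_apply)
  ultimately show ?thesis
    unfolding finvol_weight_factor[OF assms] swap_density_def
    using spin_weight_pos[of v "override_on \<eta> \<sigma> \<Lambda>" "\<sigma> v"] by simp
qed

lemma finvol_weight_pos: "finvol_weight E \<beta> H \<Lambda> \<eta> \<sigma> > 0"
  by (simp add: finvol_weight_def)

lemma finvol_weight_cong_boundary:
  "(\<And>x. x \<notin> \<Lambda> \<Longrightarrow> \<eta> x = \<eta>' x) \<Longrightarrow> finvol_weight E \<beta> H \<Lambda> \<eta> \<sigma> = finvol_weight E \<beta> H \<Lambda> \<eta>' \<sigma>"
  unfolding finvol_weight_def by (intro arg_cong[where f = exp] arg_cong2[where f = "(+)"]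
      arg_cong2[where f = "(*)"] sum.cong refl) (auto simp: edge_boundary_def)

lemma measurable_finvol_weight [measurable]:
  assumes "finite \<Lambda>"
  shows "(\<lambda>\<eta>. finvol_weight E \<beta> H \<Lambda> \<eta> \<sigma>) \<in> borel_measurable \<Omega>"
proof (rule borel_measurable_local)
  show "finite (snd ` edge_boundary E \<Lambda>)" using assms finite_edge_boundary by blast
  show "finvol_weight E \<beta> H \<Lambda> \<eta> \<sigma> = finvol_weight E \<beta> H \<Lambda> \<eta>' \<sigma>"
    if "\<And>x. x \<in> snd ` edge_boundary E \<Lambda> \<Longrightarrow> \<eta> x = \<eta>' x" for \<eta> \<eta>'
    unfolding finvol_weight_def using that
    by (intro arg_cong[where f = exp] arg_cong2[where f = "(+)"]
      arg_cong2[where f = "(*)"] sum.cong refl) force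
qed

definition finvol_prob :: "'v set \<Rightarrow> ('v \<Rightarrow> nat) \<Rightarrow> ('v \<Rightarrow> nat) \<Rightarrow> real" where
  "finvol_prob \<Lambda> \<eta> \<sigma> = finvol_weight E \<beta> H \<Lambda> \<eta> \<sigma> / (\<Sum>\<tau>\<in>configs q \<Lambda>. finvol_weight E \<beta> H \<Lambda> \<eta> \<tau>)"

lemma emeasure_finvol_gibbs:
  assumes "finite \<Lambda>" "A \<subseteq> configs q \<Lambda>"
  shows "emeasure (finvol_gibbs E q \<beta> H \<Lambda> \<eta>) A = (\<Sum>\<sigma>\<in>A. ennreal (finvol_prob \<Lambda> \<eta> \<sigma>))"
  unfolding finvol_gibbs_def finvol_prob_def
  by (rule emeasure_point_measure_finite) (use assms in auto)

lemma partition_function_pos: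
  assumes "finite \<Lambda>" "\<sigma> \<in> configs q \<Lambda>"
  shows "(\<Sum>\<tau>\<in>configs q \<Lambda>. finvol_weight E \<beta> H \<Lambda> \<eta> \<tau>) > 0"
  by (rule sum_pos2[OF _ assms(2)]) (use assms finvol_weight_pos in \<open>auto intro: less_imp_le\<close>)

lemma finvol_prob_pos: "finite \<Lambda> \<Longrightarrow> \<sigma> \<in> configs q \<Lambda> \<Longrightarrow> finvol_prob \<Lambda> \<eta> \<sigma> > 0"
  using partition_function_pos finvol_weight_pos by (simp add: finvol_prob_def)

lemma sum_finvol_prob:
  assumes "finite \<Lambda>" "\<sigma> \<in> configs q \<Lambda>"
  shows "(\<Sum>\<tau>\<in>configs q \<Lambda>. finvol_prob \<Lambda> \<eta> \<tau>) = 1"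
  using partition_function_pos[OF assms, of \<eta>] by (simp add: finvol_prob_def sum_divide_distrib[symmetric])

lemma measurable_finvol_prob [measurable]:
  "finite \<Lambda> \<Longrightarrow> (\<lambda>\<eta>. finvol_prob \<Lambda> \<eta> \<sigma>) \<in> borel_measurable \<Omega>"
  unfolding finvol_prob_def by measurable

lemma finvol_prob_swap:
  assumes "finite \<Lambda>" "v \<in> \<Lambda>"
  shows "finvol_prob \<Lambda> \<eta> (swap_spins v i j \<sigma>) = swap_density v i j (override_on \<eta> \<sigma> \<Lambda>) * finvol_prob \<Lambda> \<eta> \<sigma>"
  by (simp add: finvol_prob_def finvol_weight_swap[OF assms])

lemma finvol_prob_swap_boundary:
  "v \<in> \<Lambda> \<Longrightarrow> finvol_prob \<Lambda> (swap_spins v i j \<eta>) \<sigma> = finvol_prob \<Lambda> \<eta> \<sigma>"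
  unfolding finvol_prob_def
  by (intro arg_cong2[where f = "(/)"] sum.cong refl finvol_weight_cong_boundary)
    (auto simp: swap_spins_apply)

text \<open>A one-site form of the Gibbs property without boundary conditions. As an exchange is its
  own inverse, the mass moved to \<open>\<omega>\<close> comes from the exchanged configuration,
  whose weight is therefore the numerator of the density.\<close>

definition quasi_invariant :: "('v \<Rightarrow> nat) measure \<Rightarrow> bool" where
  "quasi_invariant M \<longleftrightarrow> (\<forall>v. \<forall>i\<in>{1..q}. \<forall>j\<in>{1..q}.
     distr M \<Omega> (swap_spins v i j) = density M (\<lambda>\<omega>. ennreal (swap_density v i j \<omega>)))"

lemma gibbs_imp_quasi_invariant:
  assumes "M \<in> gibbs_measures E q \<beta> H"
  shows "quasi_invariant M"
  unfolding quasi_invariant_def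
proof (intro allI ballI)
  fix v i j assume ij: "i \<in> {1..q}" "j \<in> {1..q}"
  have "prob_space M" and sets_M [measurable_cong]: "sets M = sets \<Omega>"
    and gibbs: "\<And>\<Lambda> A. finite \<Lambda> \<Longrightarrow> A \<subseteq> configs q \<Lambda> \<Longrightarrow>
      emeasure M (cylinder q \<Lambda> A) = (\<integral>\<^sup>+\<eta>. emeasure (finvol_gibbs E q \<beta> H \<Lambda> \<eta>) A \<partial>M)"
    using assms by (auto simp: gibbs_measures_def)
  interpret prob_space M by fact
  have space: "space M = space \<Omega>" using sets_M by (rule sets_eq_imp_space_eq)
  have T: "swap_spins v i j \<in> measurable M \<Omega>" using measurable_swap_spins[OF ij] sets_M by (simp cong: measurable_cong_sets)
  show "distr M \<Omega> (swap_spins v i j) = density M (\<lambda>\<omega>. ennreal (swap_density v i j \<omega>))"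
  proof (rule config_measure_eqI)
    fix V :: "'v set" assume "finite V"
    \<comment> \<open>Since \<open>W\<close> contains \<open>v\<close> and its neighbours, the
      density is constant on each pattern on \<open>W\<close> and unaffected by the boundary
      condition, so it comes out of the integral.\<close>
    define W where "W = V \<union> insert v (nbrs v)"
    have W: "finite W" "v \<in> W" "nbrs v \<subseteq> W" "V \<subseteq> W" using \<open>finite V\<close> by (auto simp: W_def)
    have "emeasure (distr M \<Omega> (swap_spins v i j)) (pattern q W t) =
        emeasure (density M (\<lambda>\<omega>. ennreal (swap_density v i j \<omega>))) (pattern q W t)" if t: "t \<in> configs q W" for t
    proof -
      let ?t = "swap_spins v i j t" and ?r = "swap_density v i j t"
      have t': "?t \<in> configs q W" using swap_spins_in_configs[OF ij t W(2)] .
      have r: "swap_density v i j (override_on \<eta> t W) = ?r" for \<eta>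
        by (rule swap_density_cong) (use W in auto)
      have "swap_spins v i j -` pattern q W t \<inter> space M = pattern q W ?t"
        using swap_spins_mem_pattern[OF ij W(2)] by (auto simp: space pattern_def)
      then have "emeasure (distr M \<Omega> (swap_spins v i j)) (pattern q W t) = emeasure M (pattern q W ?t)"
        using T W by (simp add: emeasure_distr)
      also have "\<dots> = (\<integral>\<^sup>+\<eta>. ennreal (finvol_prob W \<eta> ?t) \<partial>M)"
        using gibbs[of W "{?t}"] W t' by (simp add: cylinder_singleton emeasure_finvol_gibbs)
      also have "\<dots> = (\<integral>\<^sup>+\<eta>. ennreal ?r * ennreal (finvol_prob W \<eta> t) \<partial>M)"
        using W by (simp add: finvol_prob_swap r ennreal_mult' less_imp_le[OF swap_density_pos])
      also have "\<dots> = ennreal ?r * (\<integral>\<^sup>+\<eta>. ennreal (finvol_prob W \<eta> t) \<partial>M)"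
        by (rule nn_integral_cmult) (use W in measurable)
      also have "\<dots> = ennreal ?r * emeasure M (pattern q W t)"
        using gibbs[of W "{t}"] W t by (simp add: cylinder_singleton emeasure_finvol_gibbs)
      also have "\<dots> = (\<integral>\<^sup>+\<omega>. ennreal ?r * indicator (pattern q W t) \<omega> \<partial>M)"
        using W by (simp add: nn_integral_cmult_indicator sets_M)
      also have "\<dots> = (\<integral>\<^sup>+\<omega>. ennreal (swap_density v i j \<omega>) * indicator (pattern q W t) \<omega> \<partial>M)"
      proof (rule nn_integral_cong)
        fix \<omega>
        have "swap_density v i j \<omega> = ?r" if "\<omega> \<in> pattern q W t"
          by (rule swap_density_cong) (use that W in \<open>auto simp: pattern_def\<close>)
        then show "ennreal ?r * indicator (pattern q W t) \<omega> =
            ennreal (swap_density v i j \<omega>) * indicator (pattern q W t) \<omega>"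
          by (auto simp: indicator_def)
      qed
      also have "\<dots> = emeasure (density M (\<lambda>\<omega>. ennreal (swap_density v i j \<omega>))) (pattern q W t)"
        by (subst emeasure_density) (use W in \<open>auto simp: sets_M cong: measurable_cong_sets\<close>)
      finally show ?thesis .
    qed
    then show "\<exists>W. finite W \<and> V \<subseteq> W \<and> (\<forall>t\<in>configs q W.
        emeasure (distr M \<Omega> (swap_spins v i j)) (pattern q W t) =
        emeasure (density M (\<lambda>\<omega>. ennreal (swap_density v i j \<omega>))) (pattern q W t))"
      using W by blast
  qed (use sets_M T in \<open>auto intro: finite_measure_distr\<close>)
qed

lemma nn_integral_swap:
  assumes "quasi_invariant M" and sets_M: "sets M = sets \<Omega>" and ij: "i \<in> {1..q}" "j \<in> {1..q}"
    and f: "f \<in> borel_measurable \<Omega>"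
  shows "(\<integral>\<^sup>+\<omega>. f (swap_spins v i j \<omega>) \<partial>M) = (\<integral>\<^sup>+\<omega>. ennreal (swap_density v i j \<omega>) * f \<omega> \<partial>M)"
proof -
  note [measurable_cong] = sets_M
  have T: "swap_spins v i j \<in> measurable M \<Omega>" using measurable_swap_spins[OF ij] sets_M by (simp cong: measurable_cong_sets)
  have "(\<integral>\<^sup>+\<omega>. f (swap_spins v i j \<omega>) \<partial>M) = (\<integral>\<^sup>+\<omega>. f \<omega> \<partial>distr M \<Omega> (swap_spins v i j))"
    by (rule nn_integral_distr[OF T, symmetric]) (use f in simp)
  also have "\<dots> = (\<integral>\<^sup>+\<omega>. f \<omega> \<partial>density M (\<lambda>\<omega>. ennreal (swap_density v i j \<omega>)))"
    using assms by (simp add: quasi_invariant_def)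
  also have "\<dots> = (\<integral>\<^sup>+\<omega>. ennreal (swap_density v i j \<omega>) * f \<omega> \<partial>M)"
    by (rule nn_integral_density) (use f sets_M in \<open>auto cong: measurable_cong_sets\<close>)
  finally show ?thesis .
qed

text \<open>At a vertex of disagreement, exchanging the two values there sets the spin to its target
  and disturbs no other vertex; the number of disagreements drops.\<close>

lemma configs_swap_connected:
  assumes "finite \<Lambda>" "s \<in> configs q \<Lambda>" "t \<in> configs q \<Lambda>"
    and step: "\<And>u v i j. u \<in> configs q \<Lambda> \<Longrightarrow> v \<in> \<Lambda> \<Longrightarrow> i \<in> {1..q} \<Longrightarrow> j \<in> {1..q} \<Longrightarrow>
      b (swap_spins v i j u) = b u"
  shows "b s = b t"
  using assms(2)
proof (induction "card {x \<in> \<Lambda>. s x \<noteq> t x}" arbitrary: s rule: less_induct)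
  case less
  show ?case
  proof (cases "s = t")
    case False
    then obtain x where x: "x \<in> \<Lambda>" "s x \<noteq> t x" using less.prems assms(3) by (metis configs_iff extensionalityI)
    have ij: "s x \<in> {1..q}" "t x \<in> {1..q}" using x less.prems assms(3) by (auto simp: configs_iff)
    let ?s = "swap_spins x (s x) (t x) s"
    have "{y \<in> \<Lambda>. ?s y \<noteq> t y} \<subset> {y \<in> \<Lambda>. s y \<noteq> t y}"
    proof
      show "{y \<in> \<Lambda>. ?s y \<noteq> t y} \<subseteq> {y \<in> \<Lambda>. s y \<noteq> t y}"
        using x by (auto simp: swap_spins_apply split: if_splits)
      have "?s x = t x" by (simp add: swap_spins_apply swap_val_def)
      then show "{y \<in> \<Lambda>. ?s y \<noteq> t y} \<noteq> {y \<in> \<Lambda>. s y \<noteq> t y}" using x by blast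
    qed
    then have "card {y \<in> \<Lambda>. ?s y \<noteq> t y} < card {y \<in> \<Lambda>. s y \<noteq> t y}"
      using assms(1) by (intro psubset_card_mono) auto
    then have "b ?s = b t" using less.hyps swap_spins_in_configs[OF ij less.prems x(1)] by blast
    then show ?thesis using step[OF less.prems x(1) ij] by simp
  qed simp
qed

text \<open>The finite-volume kernel satisfies detailed balance with respect to \<open>M\<close>.
  Summing the balance over \<open>c\<close> gives the Gibbs identity: the kernel has total mass 1 on
  the one side, and the patterns partition the space on the other.\<close>

lemma quasi_invariant_imp_gibbs:
  assumes "prob_space M" and sets_M [measurable_cong]: "sets M = sets \<Omega>" and QI: "quasi_invariant M"
  shows "M \<in> gibbs_measures E q \<beta> H"
proof -
  interpret prob_space M by fact
  have space: "space M = space \<Omega>" using sets_M by (rule sets_eq_imp_space_eq)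
  have "emeasure M (cylinder q \<Lambda> A) = (\<integral>\<^sup>+\<eta>. emeasure (finvol_gibbs E q \<beta> H \<Lambda> \<eta>) A \<partial>M)"
    if \<Lambda>: "finite \<Lambda>" and A: "A \<subseteq> configs q \<Lambda>" for \<Lambda> A
  proof -
    let ?\<gamma> = "finvol_prob \<Lambda>"
    let ?P = "\<lambda>s. pattern q \<Lambda> s"
    have meas [measurable]: "(\<lambda>\<eta>. ?\<gamma> \<eta> s) \<in> borel_measurable M" for s using \<Lambda> by measurable
    have P [measurable]: "?P s \<in> sets M" for s using \<Lambda> sets_M by simp
    have balance: "(\<integral>\<^sup>+\<omega>. indicator (?P a) \<omega> * ennreal (?\<gamma> \<omega> c) \<partial>M) =
        (\<integral>\<^sup>+\<omega>. indicator (?P c) \<omega> * ennreal (?\<gamma> \<omega> a) \<partial>M)"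
      if ac: "a \<in> configs q \<Lambda>" "c \<in> configs q \<Lambda>" for a c
    proof -
      \<comment> \<open>\<open>K\<close> is symmetric in \<open>a\<close> and \<open>c\<close> and
        depends only on spins outside \<open>\<Lambda>\<close>. The function \<open>b\<close>
        interpolates between the two sides of the balance, which are \<open>b a\<close> and
        \<open>b c\<close>, and is constant along exchanges.\<close>
      define K where "K \<omega> = ?\<gamma> \<omega> a * ?\<gamma> \<omega> c" for \<omega>
      define b where "b s = (\<integral>\<^sup>+\<omega>. indicator (?P s) \<omega> * ennreal (K \<omega> / ?\<gamma> \<omega> s) \<partial>M)" for s
      have "b (swap_spins v i j s) = b s"
        if s: "s \<in> configs q \<Lambda>" "v \<in> \<Lambda>" and ij: "i \<in> {1..q}" "j \<in> {1..q}" for s v i j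
      proof -
        let ?T = "swap_spins v i j"
        have "b (?T s) = (\<integral>\<^sup>+\<omega>. indicator (?P s) (?T \<omega>) * ennreal (K (?T \<omega>) / ?\<gamma> (?T \<omega>) (?T s)) \<partial>M)"
          unfolding b_def K_def
          by (intro nn_integral_cong)
            (simp add: finvol_prob_swap_boundary s(2) indicator_def swap_spins_mem_pattern[OF ij s(2)] space)
        also have "\<dots> = (\<integral>\<^sup>+\<omega>. ennreal (swap_density v i j \<omega>) *
            (indicator (?P s) \<omega> * ennreal (K \<omega> / ?\<gamma> \<omega> (?T s))) \<partial>M)"
          by (rule nn_integral_swap[OF QI sets_M ij]) (use \<Lambda> in \<open>auto simp: K_def\<close>)
        also have "\<dots> = b s"
          unfolding b_def
        proof (rule nn_integral_cong)
          fix \<omega>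
          show "ennreal (swap_density v i j \<omega>) * (indicator (?P s) \<omega> * ennreal (K \<omega> / ?\<gamma> \<omega> (?T s))) =
              indicator (?P s) \<omega> * ennreal (K \<omega> / ?\<gamma> \<omega> s)"
          proof (cases "\<omega> \<in> ?P s")
            case True
            \<comment> \<open>On the pattern \<open>s\<close> the configuration supplies both the
              inside and the outside, so the kernel ratio is exactly the exchange density and
              cancels it.\<close>
            then have "override_on \<omega> s \<Lambda> = \<omega>" by (auto simp: override_on_def pattern_def fun_eq_iff)
            then have "?\<gamma> \<omega> (?T s) = swap_density v i j \<omega> * ?\<gamma> \<omega> s"
              using finvol_prob_swap[OF \<Lambda> s(2), of \<omega> i j s] by simp
            then have "swap_density v i j \<omega> * (K \<omega> / ?\<gamma> \<omega> (?T s)) = K \<omega> / ?\<gamma> \<omega> s"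
              using swap_density_pos[of v i j \<omega>] by simp
            then show ?thesis
              using True less_imp_le[OF swap_density_pos, of v i j \<omega>] by (simp add: ennreal_mult'[symmetric])
          qed simp
        qed
        finally show ?thesis .
      qed
      then have "b a = b c" by (rule configs_swap_connected[OF \<Lambda> ac]) auto
      moreover have "K \<omega> / ?\<gamma> \<omega> a = ?\<gamma> \<omega> c" "K \<omega> / ?\<gamma> \<omega> c = ?\<gamma> \<omega> a" for \<omega>
        using finvol_prob_pos[OF \<Lambda>] ac less_imp_neq[THEN not_sym] by (auto simp: K_def)
      ultimately show ?thesis by (simp add: b_def)
    qed
    have single: "emeasure M (?P a) = (\<integral>\<^sup>+\<omega>. ennreal (?\<gamma> \<omega> a) \<partial>M)" if a: "a \<in> configs q \<Lambda>" for a
    proof -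
      have "emeasure M (?P a) = (\<integral>\<^sup>+\<omega>. indicator (?P a) \<omega> * ennreal (\<Sum>c\<in>configs q \<Lambda>. ?\<gamma> \<omega> c) \<partial>M)"
        by (simp add: sum_finvol_prob[OF \<Lambda> a])
      also have "\<dots> = (\<integral>\<^sup>+\<omega>. (\<Sum>c\<in>configs q \<Lambda>. indicator (?P a) \<omega> * ennreal (?\<gamma> \<omega> c)) \<partial>M)"
        by (intro nn_integral_cong)
          (subst sum_ennreal[symmetric], auto simp: sum_distrib_left intro: less_imp_le finvol_prob_pos[OF \<Lambda>])
      also have "\<dots> = (\<Sum>c\<in>configs q \<Lambda>. \<integral>\<^sup>+\<omega>. indicator (?P a) \<omega> * ennreal (?\<gamma> \<omega> c) \<partial>M)"
        by (rule nn_integral_sum) measurable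
      also have "\<dots> = (\<Sum>c\<in>configs q \<Lambda>. \<integral>\<^sup>+\<omega>. indicator (?P c) \<omega> * ennreal (?\<gamma> \<omega> a) \<partial>M)"
        by (intro sum.cong refl balance a)
      also have "\<dots> = (\<integral>\<^sup>+\<omega>. (\<Sum>c\<in>configs q \<Lambda>. indicator (?P c) \<omega> * ennreal (?\<gamma> \<omega> a)) \<partial>M)"
        by (rule nn_integral_sum[symmetric]) measurable
      also have "\<dots> = (\<integral>\<^sup>+\<omega>. ennreal (?\<gamma> \<omega> a) \<partial>M)"
      proof (rule nn_integral_cong)
        fix \<omega> assume "\<omega> \<in> space M"
        then have "restrict \<omega> \<Lambda> \<in> configs q \<Lambda>" by (simp add: space restrict_in_configs)
        moreover have "indicator (?P c) \<omega> = (of_bool (restrict \<omega> \<Lambda> = c) :: ennreal)" if "c \<in> configs q \<Lambda>" for c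
          using that \<open>\<omega> \<in> space M\<close> cylinder_singleton[OF that]
          by (auto simp: cylinder_def space indicator_def)
        ultimately show "(\<Sum>c\<in>configs q \<Lambda>. indicator (?P c) \<omega> * ennreal (?\<gamma> \<omega> a)) = ennreal (?\<gamma> \<omega> a)"
          using \<Lambda> by (simp add: sum_distrib_right[symmetric] of_bool_def)
      qed
      finally show ?thesis .
    qed
    have "emeasure M (cylinder q \<Lambda> A) = (\<Sum>a\<in>A. emeasure M (?P a))"
      by (rule emeasure_cylinder[OF \<Lambda> A sets_M])
    also have "\<dots> = (\<Sum>a\<in>A. \<integral>\<^sup>+\<omega>. ennreal (?\<gamma> \<omega> a) \<partial>M)"
      using A by (intro sum.cong refl single) auto
    also have "\<dots> = (\<integral>\<^sup>+\<omega>. (\<Sum>a\<in>A. ennreal (?\<gamma> \<omega> a)) \<partial>M)"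
      by (rule nn_integral_sum[symmetric]) measurable
    finally show ?thesis by (simp add: emeasure_finvol_gibbs[OF \<Lambda> A])
  qed
  then show ?thesis using assms by (simp add: gibbs_measures_def)
qed

end


section \<open>Mixing of splitting measures\<close>

lemma measure_cylinder_Int:
  assumes "finite_measure M" "sets M = sets (config_space q)" "finite V" "S \<subseteq> configs q V" "B \<in> sets M"
  shows "measure M (cylinder q V S \<inter> B) = (\<Sum>t\<in>S. measure M (pattern q V t \<inter> B))"
proof -
  have "cylinder q V S \<inter> B = (\<Union>t\<in>S. pattern q V t \<inter> B)"
    using cylinder_eq_UN[OF assms(4)] by blast
  moreover have "measure M (\<Union>t\<in>S. pattern q V t \<inter> B) = (\<Sum>t\<in>S. measure M (pattern q V t \<inter> B))"
  proof (rule finite_measure.finite_measure_finite_Union[OF assms(1)])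
    show "disjoint_family_on (\<lambda>t. pattern q V t \<inter> B) S"
      using disjoint_family_on_mono[OF assms(4) disjoint_patterns] by (auto simp: disjoint_family_on_def)
  qed (use assms finite_subset[OF assms(4)] in auto)
  ultimately show ?thesis by simp
qed

lemma measure_pattern_split:
  assumes "finite_measure M" "sets M = sets (config_space q)" "finite V" "w \<notin> V"
  shows "measure M (pattern q V s) = (\<Sum>j\<in>{1..q}. measure M (pattern q (insert w V) (s(w := j))))"
proof -
  have "pattern q V s = (\<Union>j\<in>{1..q}. pattern q (insert w V) (s(w := j)))"
    using assms(4) by (auto simp: pattern_def space_config_space)
  moreover have "measure M (\<Union>j\<in>{1..q}. pattern q (insert w V) (s(w := j))) =
      (\<Sum>j\<in>{1..q}. measure M (pattern q (insert w V) (s(w := j))))"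
  proof (rule finite_measure.finite_measure_finite_Union[OF assms(1)])
    have "pattern q (insert w V) (s(w := i)) \<inter> pattern q (insert w V) (s(w := j)) = {}" if "i \<noteq> j" for i j
      using that by (auto simp: pattern_def)
    then show "disjoint_family_on (\<lambda>j. pattern q (insert w V) (s(w := j))) {1..q}"
      unfolding disjoint_family_on_def by blast
    show "(\<lambda>j. pattern q (insert w V) (s(w := j))) ` {1..q} \<subseteq> sets M"
      using assms(3) unfolding assms(2) by (intro image_subsetI pattern_sets) simp
  qed simp
  ultimately show ?thesis by simp
qed

text \<open>Doeblin's argument: since \<open>r\<close> has total 0, subtracting
  \<open>\<epsilon>\<close> from every entry does not change its image. The reduced entries are
  nonnegative, with row sums \<open>1 - card I * \<epsilon>\<close>.\<close>

lemma stochastic_contraction: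
  fixes P :: "'i \<Rightarrow> 'i \<Rightarrow> real" and r :: "'i \<Rightarrow> real"
  assumes "\<And>i j. i \<in> I \<Longrightarrow> j \<in> I \<Longrightarrow> \<epsilon> \<le> P i j" "\<And>i. i \<in> I \<Longrightarrow> (\<Sum>j\<in>I. P i j) = 1" "(\<Sum>i\<in>I. r i) = 0"
  shows "(\<Sum>j\<in>I. \<bar>\<Sum>i\<in>I. r i * P i j\<bar>) \<le> (1 - real (card I) * \<epsilon>) * (\<Sum>i\<in>I. \<bar>r i\<bar>)"
proof -
  have "(\<Sum>i\<in>I. r i * P i j) = (\<Sum>i\<in>I. r i * (P i j - \<epsilon>))" for j
    using assms(3) by (simp add: right_diff_distrib sum_subtractf sum_distrib_right[symmetric])
  then have "(\<Sum>j\<in>I. \<bar>\<Sum>i\<in>I. r i * P i j\<bar>) = (\<Sum>j\<in>I. \<bar>\<Sum>i\<in>I. r i * (P i j - \<epsilon>)\<bar>)" by simp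
  also have "\<dots> \<le> (\<Sum>j\<in>I. \<Sum>i\<in>I. \<bar>r i\<bar> * (P i j - \<epsilon>))"
  proof (rule sum_mono)
    fix j assume "j \<in> I"
    then have "\<bar>r i * (P i j - \<epsilon>)\<bar> = \<bar>r i\<bar> * (P i j - \<epsilon>)" if "i \<in> I" for i
      using assms(1)[OF that] by (simp add: abs_mult)
    then show "\<bar>\<Sum>i\<in>I. r i * (P i j - \<epsilon>)\<bar> \<le> (\<Sum>i\<in>I. \<bar>r i\<bar> * (P i j - \<epsilon>))"
      by (intro order_trans[OF sum_abs] sum_mono) simp
  qed
  also have "\<dots> = (\<Sum>i\<in>I. \<bar>r i\<bar> * (\<Sum>j\<in>I. P i j - \<epsilon>))"
    by (subst sum.swap) (simp add: sum_distrib_left)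
  also have "\<dots> = (\<Sum>i\<in>I. \<bar>r i\<bar> * (1 - real (card I) * \<epsilon>))"
    by (intro sum.cong refl) (simp add: sum_subtractf assms(2))
  finally show ?thesis by (simp add: sum_distrib_right[symmetric] mult.commute)
qed

context reg_tree
begin

lemma sphere_eq: "tree_sphere E r (Suc n) = tree_ball E r (Suc n) - tree_ball E r n"
  by (auto simp: tree_sphere_def tree_ball_def)

text \<open>A vertex of the outer sphere has exactly one neighbour in the ball, its parent. The
  radius must be positive: a root alone has \<open>d + 1\<close> outer neighbours.\<close>

lemma card_outer_nbrs:
  assumes "x \<in> tree_ball E r (Suc n)"
  shows "card (nbrs x - tree_ball E r (Suc n)) = (if x \<in> tree_sphere E r (Suc n) then d else 0)"
proof (cases "x \<in> tree_ball E r n")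
  case True
  then have "nbrs x \<subseteq> tree_ball E r (Suc n)" by (auto simp: ball_Suc)
  then have "nbrs x - tree_ball E r (Suc n) = {}" by blast
  then show ?thesis using True by (simp add: sphere_eq)
next
  case False
  then obtain y where y: "y \<in> tree_ball E r n" "E y x" using assms by (auto simp: ball_Suc)
  have "nbrs x \<inter> tree_ball E r (Suc n) \<subseteq> {y}"
  proof
    fix w assume w: "w \<in> nbrs x \<inter> tree_ball E r (Suc n)"
    then have "w \<noteq> x" using E_irrefl by auto
    \<comment> \<open>A neighbour \<open>w\<close> in the same sphere is not ruled out at once;
      adding it to the smaller ball gives a connected set without \<open>x\<close>, where
      \<open>unique_nbr\<close> identifies it with the parent \<open>y\<close>.\<close>
    have "conn (insert w (tree_ball E r n))"
    proof (cases "w \<in> tree_ball E r n")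
      case True
      then show ?thesis by (simp add: insert_absorb)
    next
      case False
      then obtain u where "u \<in> tree_ball E r n" "E u w" using w by (auto simp: ball_Suc)
      then show ?thesis by (intro conn_insert) auto
    qed
    then have "w = y"
      by (rule unique_nbr[of _ x]) (use w y False E_sym[of y x] \<open>w \<noteq> x\<close> in auto)
    then show "w \<in> {y}" by simp
  qed
  moreover have "y \<in> nbrs x \<inter> tree_ball E r (Suc n)"
    using y E_sym[of y x] ball_mono[of n "Suc n" r] by auto
  ultimately have "nbrs x \<inter> tree_ball E r (Suc n) = {y}" by blast
  then have "card (nbrs x - tree_ball E r (Suc n)) = d"
    by (simp add: card_Diff_subset_Int card_nbrs)
  then show ?thesis using False assms by (simp add: sphere_eq)
qed

end

locale splitting_measure = potts d E q \<beta> H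
  for d :: nat and E :: "'v \<Rightarrow> 'v \<Rightarrow> bool" and q :: nat and \<beta> :: real and H :: "nat \<Rightarrow> real" +
  fixes \<mu> :: "('v \<Rightarrow> nat) measure" and r :: 'v and h :: "nat \<Rightarrow> real"
  assumes degree: "d \<ge> 1" and states: "q \<ge> 1"
    and gibbs: "\<mu> \<in> gibbs_measures E q \<beta> H"
    and ball_law: "\<And>n s. n \<ge> 1 \<Longrightarrow> s \<in> configs q (tree_ball E r n) \<Longrightarrow>
      measure \<mu> (cylinder q (tree_ball E r n) {s}) =
        splitting_weight E \<beta> H h r n s / (\<Sum>s'\<in>configs q (tree_ball E r n). splitting_weight E \<beta> H h r n s')"
    and field_eq: "\<And>i. i \<in> {1..q} \<Longrightarrow> h i - h q =
      real d * ln ((exp (\<beta> + H i + h i) + (\<Sum>j\<in>{1..q} - {i}. exp (H j + h j))) /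
                   (exp (\<beta> + H q + h q) + (\<Sum>j\<in>{1..q} - {q}. exp (H j + h j))))"
begin

section \<open>The boundary law and the Markov chain it defines\<close>

lemma prob_space_\<mu>: "prob_space \<mu>" and sets_\<mu> [measurable_cong, simp]: "sets \<mu> = sets \<Omega>"
  using gibbs by (auto simp: gibbs_measures_def)

sublocale prob_space \<mu> by (rule prob_space_\<mu>)

lemma finite_measure_\<mu>: "finite_measure \<mu>" by unfold_locales

lemma space_\<mu> [simp]: "space \<mu> = space \<Omega>"
  by (rule sets_eq_imp_space_eq) simp

text \<open>The boundary law: each edge leaving a finite subtree at a vertex of spin \<open>i\<close> contributes a factor
  \<open>z i\<close> to the weight, so that a vertex of \<open>W\<^sub>n\<close> with its \<open>d\<close> outer neighbours contributes \<open>exp (h i)\<close>.\<close>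

definition z :: "nat \<Rightarrow> real" where "z i = exp (h i / real d)"

text \<open>The weight of the branch behind an edge leaving a vertex of spin \<open>i\<close>,
  summed over the spin \<open>j\<close> at the far end, whose own \<open>d\<close> outer edges each
  carry \<open>z j\<close>.\<close>

definition branch_sum :: "nat \<Rightarrow> real" where
  "branch_sum i = (\<Sum>j\<in>{1..q}. exp (\<beta> * of_bool (i = j) + H j) * z j ^ d)"

definition \<kappa> :: real where "\<kappa> = branch_sum q / z q"

lemma z_pos: "z i > 0" by (simp add: z_def)

lemma z_power: "z i ^ d = exp (h i)"
  using degree by (simp add: z_def exp_of_nat_mult[symmetric])

lemma branch_sum_pos: "branch_sum i > 0"
  unfolding branch_sum_def by (rule sum_pos) (use states z_pos in auto)

lemma \<kappa>_pos: "\<kappa> > 0" by (simp add: \<kappa>_def branch_sum_pos z_pos)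

text \<open>Divided by \<open>d\<close> and exponentiated, \<open>field_eq\<close> says that
  \<open>branch_sum / z\<close> has the same value at \<open>i\<close> as at \<open>q\<close>;
  \<open>\<kappa>\<close> is that value.\<close>

lemma branch_sum_eq:
  assumes "i \<in> {1..q}"
  shows "branch_sum i = \<kappa> * z i"
proof -
  have S: "branch_sum i = exp (\<beta> + H i + h i) + (\<Sum>j\<in>{1..q} - {i}. exp (H j + h j))" if "i \<in> {1..q}" for i
  proof -
    have "branch_sum i = exp (\<beta> * of_bool (i = i) + H i) * z i ^ d
        + (\<Sum>j\<in>{1..q} - {i}. exp (\<beta> * of_bool (i = j) + H j) * z j ^ d)"
      unfolding branch_sum_def by (rule sum.remove) (use that in auto)
    also have "(\<Sum>j\<in>{1..q} - {i}. exp (\<beta> * of_bool (i = j) + H j) * z j ^ d) = (\<Sum>j\<in>{1..q} - {i}. exp (H j + h j))"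
      by (intro sum.cong) (auto simp: z_power exp_add)
    finally show ?thesis by (simp add: z_power exp_add)
  qed
  have "h i - h q = real d * ln (branch_sum i / branch_sum q)"
    using field_eq[OF assms] S[OF assms] S[of q] states by simp
  then have "h i / real d - h q / real d = ln (branch_sum i / branch_sum q)"
    using degree by (simp add: field_simps)
  then have "exp (h i / real d - h q / real d) = branch_sum i / branch_sum q"
    using branch_sum_pos by simp
  then have "z i / z q = branch_sum i / branch_sum q" by (simp add: z_def exp_diff)
  then show ?thesis using z_pos[of q] branch_sum_pos[of q] by (simp add: \<kappa>_def field_simps)
qed

text \<open>Attaching a vertex of spin \<open>j\<close> to one of spin \<open>i\<close> brings an
  edge factor, a field factor and \<open>d\<close> new outer edges, and uses up one outer edge at
  \<open>i\<close>. The constant \<open>\<kappa>\<close> normalises the rows, by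
  \<open>branch_sum_eq\<close>.\<close>

definition trans_prob :: "nat \<Rightarrow> nat \<Rightarrow> real" where
  "trans_prob i j = exp (\<beta> * of_bool (i = j) + H j) * z j ^ d / (\<kappa> * z i)"

lemma trans_prob_pos: "trans_prob i j > 0"
  using z_pos \<kappa>_pos by (simp add: trans_prob_def)

lemma sum_trans_prob:
  assumes "i \<in> {1..q}" shows "(\<Sum>j\<in>{1..q}. trans_prob i j) = 1"
proof -
  have "(\<Sum>j\<in>{1..q}. trans_prob i j) = branch_sum i / (\<kappa> * z i)"
    by (simp add: trans_prob_def branch_sum_def sum_divide_distrib)
  then show ?thesis using branch_sum_eq[OF assms] z_pos[of i] \<kappa>_pos by simp
qed

text \<open>The unnormalised law on a finite subtree, with a factor \<open>z\<close> for every edge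
  leaving it. On balls of positive radius it is \<open>splitting_weight\<close>, but it makes sense
  for any finite set and does not refer to the root.\<close>

definition tree_weight :: "'v set \<Rightarrow> ('v \<Rightarrow> nat) \<Rightarrow> real" where
  "tree_weight V s = exp (\<beta> * interaction E V s + (\<Sum>u\<in>V. H (s u))) * (\<Prod>u\<in>V. z (s u) ^ card (nbrs u - V))"

lemma tree_weight_cong: "(\<And>x. x \<in> V \<Longrightarrow> s x = t x) \<Longrightarrow> tree_weight V s = tree_weight V t"
  unfolding tree_weight_def using interaction_cong[of V s t] by simp

text \<open>The edge from \<open>u\<close> to \<open>w\<close> ceases to be an outer edge and
  \<open>w\<close> contributes \<open>d\<close> new ones: a factor \<open>z (s u)\<close> is traded
  for \<open>z (s w) ^ d\<close>.\<close>

lemma tree_weight_insert: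
  assumes "conn V" "finite V" "u \<in> V" "w \<notin> V" "E u w"
  shows "tree_weight (insert w V) s = tree_weight V s * (\<kappa> * trans_prob (s u) (s w))"
proof -
  have nbr_w: "V \<inter> nbrs w = {u}"
  proof
    show "V \<inter> nbrs w \<subseteq> {u}"
      using unique_nbr[OF assms(1,4,3) _ E_sym[OF assms(5)]] by auto
    show "{u} \<subseteq> V \<inter> nbrs w" using assms(3) E_sym[OF assms(5)] by simp
  qed
  have w_nbr: "w \<in> nbrs x \<longleftrightarrow> x = u" if "x \<in> V" for x
    using unique_nbr[OF assms(1,4,3) that E_sym[OF assms(5)]] E_sym[of x w] assms(5) by auto
  have inter: "interaction E (insert w V) s = interaction E V s + of_bool (s u = s w)"
    using interaction_insert[OF assms(2,4), of s] nbr_w by simp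
  have "w \<notin> nbrs w" using E_irrefl by simp
  then have "nbrs w - insert w V = nbrs w - {u}" "u \<in> nbrs w" using nbr_w by blast+
  then have "card (nbrs w - insert w V) = d"
    using card_nbrs[of w] by (simp add: card_Diff_singleton)
  moreover have "z (s x) ^ card (nbrs x - V) = (if x = u then z (s u) else 1) * z (s x) ^ card (nbrs x - insert w V)"
    if "x \<in> V" for x
  proof (cases "x = u")
    case True
    have "w \<in> nbrs u" using assms(5) by simp
    then have "nbrs u - V = insert w (nbrs u - insert w V)" using assms(4) by blast
    then have "card (nbrs u - V) = Suc (card (nbrs u - insert w V))"
      by (metis Diff_iff card_insert_disjoint finite_Diff finite_nbrs insertI1)
    then show ?thesis using True by simp
  next
    case False
    then have "nbrs x - insert w V = nbrs x - V" using w_nbr[OF that] by blast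
    then show ?thesis using False by simp
  qed
  ultimately have "(\<Prod>x\<in>insert w V. z (s x) ^ card (nbrs x - insert w V)) * z (s u) =
      z (s w) ^ d * (\<Prod>x\<in>V. z (s x) ^ card (nbrs x - V))"
    using assms(2-4) by (simp add: prod.distrib prod.delta cong: prod.cong)
  then have "(\<Prod>x\<in>insert w V. z (s x) ^ card (nbrs x - insert w V)) =
      (\<Prod>x\<in>V. z (s x) ^ card (nbrs x - V)) * (z (s w) ^ d / z (s u))"
    using z_pos[of "s u"] by (simp add: field_simps)
  moreover have "(\<Sum>x\<in>insert w V. H (s x)) = (\<Sum>x\<in>V. H (s x)) + H (s w)"
    using assms(2,4) by simp
  ultimately show ?thesis
    unfolding tree_weight_def inter trans_prob_def
    using \<kappa>_pos by (simp add: exp_add[symmetric] algebra_simps)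
qed

lemma splitting_weight_eq_tree_weight:
  "splitting_weight E \<beta> H h r (Suc n) s = tree_weight (tree_ball E r (Suc n)) s"
proof -
  let ?B = "tree_ball E r (Suc n)" and ?S = "tree_sphere E r (Suc n)"
  have "(\<Prod>u\<in>?B. z (s u) ^ card (nbrs u - ?B)) = (\<Prod>u\<in>?B. if u \<in> ?S then exp (h (s u)) else 1)"
    by (intro prod.cong refl) (simp add: card_outer_nbrs z_power)
  also have "\<dots> = (\<Prod>u\<in>?B \<inter> ?S. exp (h (s u)))" by (simp add: prod.inter_restrict)
  also have "?B \<inter> ?S = ?S" by (auto simp: sphere_eq)
  also have "(\<Prod>u\<in>?S. exp (h (s u))) = exp (\<Sum>u\<in>?S. h (s u))"
    by (rule exp_sum[symmetric]) (simp add: sphere_eq)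
  finally show ?thesis by (simp add: splitting_weight_def tree_weight_def exp_add)
qed

text \<open>Known for large balls, the formula descends to \<open>V\<close> by summing out one leaf
  at a time; each summation costs the constant factor \<open>\<kappa>\<close>, because rows of
  \<open>trans_prob\<close> sum to 1.\<close>

lemma pattern_law:
  assumes "finite V" "conn V" "V \<noteq> {}"
  shows "\<exists>c. \<forall>s. (\<forall>x\<in>V. s x \<in> {1..q}) \<longrightarrow> measure \<mu> (pattern q V s) = c * tree_weight V s"
proof -
  let ?F = "\<lambda>V. \<exists>c. \<forall>s. (\<forall>x\<in>V. s x \<in> {1..q}) \<longrightarrow> measure \<mu> (pattern q V s) = c * tree_weight V s"
  obtain m where m: "V \<subseteq> tree_ball E r m" using finite_subset_ball[OF assms(1)] by blast
  let ?B = "tree_ball E r (Suc m)"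
  have V: "V \<subseteq> ?B" using m ball_mono[of m "Suc m" r] by auto
  have "?F ?B"
  proof (intro exI allI impI)
    fix s assume s: "\<forall>x\<in>?B. s x \<in> {1..q}"
    then have "restrict s ?B \<in> configs q ?B" by (auto simp: configs_iff)
    moreover have "pattern q ?B (restrict s ?B) = pattern q ?B s" by (rule pattern_cong) simp
    moreover have "tree_weight ?B (restrict s ?B) = tree_weight ?B s" by (rule tree_weight_cong) simp
    ultimately show "measure \<mu> (pattern q ?B s) = (1 / (\<Sum>t\<in>configs q ?B. tree_weight ?B t)) * tree_weight ?B s"
      using ball_law[of "Suc m" "restrict s ?B"] by (simp add: cylinder_singleton splitting_weight_eq_tree_weight)
  qed
  moreover have "?F ?B \<longrightarrow> ?F V"
  \<comment> \<open>The induction grows from \<open>V\<close> to the ball; an implication as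
    predicate makes the law travel the other way.\<close>
  proof (rule grow_induct[of ?B V "\<lambda>U. ?F U \<longrightarrow> ?F V"])
    fix U u w
    assume U: "conn U" "finite U" "u \<in> U" "w \<notin> U" "E u w" and IH: "?F U \<longrightarrow> ?F V"
    show "?F (insert w U) \<longrightarrow> ?F V"
    proof
      assume "?F (insert w U)"
      then obtain c where c: "\<And>s. (\<And>x. x \<in> insert w U \<Longrightarrow> s x \<in> {1..q}) \<Longrightarrow>
          measure \<mu> (pattern q (insert w U) s) = c * tree_weight (insert w U) s" by blast
      have "measure \<mu> (pattern q U s) = (c * \<kappa>) * tree_weight U s" if s: "\<forall>x\<in>U. s x \<in> {1..q}" for s
      proof -
        have "measure \<mu> (pattern q U s) = (\<Sum>j\<in>{1..q}. measure \<mu> (pattern q (insert w U) (s(w := j))))"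
          by (rule measure_pattern_split[OF finite_measure_\<mu> sets_\<mu> U(2,4)])
        also have "\<dots> = (\<Sum>j\<in>{1..q}. c * (tree_weight U s * (\<kappa> * trans_prob (s u) j)))"
        proof (rule sum.cong[OF refl])
          fix j assume j: "j \<in> {1..q}"
          have "measure \<mu> (pattern q (insert w U) (s(w := j))) = c * tree_weight (insert w U) (s(w := j))"
            by (rule c) (use s j in auto)
          also have "tree_weight (insert w U) (s(w := j)) =
              tree_weight U (s(w := j)) * (\<kappa> * trans_prob ((s(w := j)) u) ((s(w := j)) w))"
            by (rule tree_weight_insert[OF U])
          also have "tree_weight U (s(w := j)) = tree_weight U s"
            by (rule tree_weight_cong) (use U in auto)
          also have "(s(w := j)) u = s u" using U by auto
          also have "(s(w := j)) w = j" by simp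
          finally show "measure \<mu> (pattern q (insert w U) (s(w := j))) = c * (tree_weight U s * (\<kappa> * trans_prob (s u) j))" .
        qed
        also have "\<dots> = c * (tree_weight U s * (\<kappa> * (\<Sum>j\<in>{1..q}. trans_prob (s u) j)))"
          by (simp add: sum_distrib_left)
        finally show ?thesis using sum_trans_prob[of "s u"] s U(3) by simp
      qed
      then have "?F U" by blast
      then show "?F V" using IH by simp
    qed
  qed (use assms V in auto)
  ultimately show ?thesis by blast
qed

text \<open>Summing out \<open>w\<close> identifies the prefactor as the mass of the pattern on
  \<open>V\<close>. The root has dropped out, so the same matrix governs both orientations of an
  edge.\<close>

lemma measure_pattern_insert:
  assumes "conn V" "finite V" "u \<in> V" "w \<notin> V" "E u w" and s: "\<And>x. x \<in> insert w V \<Longrightarrow> s x \<in> {1..q}"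
  shows "measure \<mu> (pattern q (insert w V) s) = measure \<mu> (pattern q V s) * trans_prob (s u) (s w)"
proof -
  have "conn (insert w V)" using conn_insert assms by blast
  then obtain c where c: "\<And>s. (\<And>x. x \<in> insert w V \<Longrightarrow> s x \<in> {1..q}) \<Longrightarrow>
      measure \<mu> (pattern q (insert w V) s) = c * tree_weight (insert w V) s"
    using pattern_law[of "insert w V"] assms(2) by blast
  have ins: "measure \<mu> (pattern q (insert w V) (s(w := j))) = (c * tree_weight V s * \<kappa>) * trans_prob (s u) j"
    if j: "j \<in> {1..q}" for j
  proof -
    have "measure \<mu> (pattern q (insert w V) (s(w := j))) = c * tree_weight (insert w V) (s(w := j))"
      by (rule c) (use s j in auto)
    also have "tree_weight (insert w V) (s(w := j)) =
        tree_weight V (s(w := j)) * (\<kappa> * trans_prob ((s(w := j)) u) ((s(w := j)) w))"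
      by (rule tree_weight_insert[OF assms(1-5)])
    also have "tree_weight V (s(w := j)) = tree_weight V s"
      by (rule tree_weight_cong) (use assms(4) in auto)
    also have "(s(w := j)) u = s u" using assms(3,4) by auto
    also have "(s(w := j)) w = j" by simp
    finally show ?thesis by (simp only: mult.assoc)
  qed
  have "measure \<mu> (pattern q V s) = (\<Sum>j\<in>{1..q}. measure \<mu> (pattern q (insert w V) (s(w := j))))"
    by (rule measure_pattern_split[OF finite_measure_\<mu> sets_\<mu> assms(2,4)])
  also have "\<dots> = (\<Sum>j\<in>{1..q}. (c * tree_weight V s * \<kappa>) * trans_prob (s u) j)"
    by (intro sum.cong refl ins)
  also have "\<dots> = c * tree_weight V s * \<kappa>"
    using sum_trans_prob[of "s u"] s[of u] assms(3) by (simp add: sum_distrib_left[symmetric])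
  finally show ?thesis using ins[of "s w"] s[of w] by simp
qed

text \<open>The normalised \<open>tree_weight\<close> of a single vertex; all its
  \<open>d + 1\<close> edges are outer, hence the exponent.\<close>

definition site_prob :: "nat \<Rightarrow> real" where
  "site_prob i = exp (H i) * z i ^ (d + 1) / (\<Sum>j\<in>{1..q}. exp (H j) * z j ^ (d + 1))"

lemma site_prob_pos: "site_prob i > 0"
proof -
  have "(\<Sum>j\<in>{1..q}. exp (H j) * z j ^ (d + 1)) > 0"
    by (rule sum_pos) (use states z_pos in auto)
  then show ?thesis using z_pos by (simp add: site_prob_def)
qed

lemma measure_site:
  assumes "s v \<in> {1..q}"
  shows "measure \<mu> (pattern q {v} s) = site_prob (s v)"
proof -
  have "interaction E {v} t = 0" for t
    using interaction_insert[of "{}" v t] by (simp add: interaction_def edges_within_def)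
  moreover have "nbrs v - {v} = nbrs v" using E_irrefl by auto
  ultimately have tw: "tree_weight {v} t = exp (H (t v)) * z (t v) ^ (d + 1)" for t
    using card_nbrs[of v] by (simp add: tree_weight_def)
  obtain c where c: "\<And>t. t v \<in> {1..q} \<Longrightarrow> measure \<mu> (pattern q {v} t) = c * tree_weight {v} t"
    using pattern_law[of "{v}"] by auto
  have "1 = measure \<mu> (pattern q {} s)" using prob_space by (simp add: pattern_def)
  also have "\<dots> = (\<Sum>j\<in>{1..q}. measure \<mu> (pattern q {v} (s(v := j))))"
    by (rule measure_pattern_split[OF finite_measure_\<mu> sets_\<mu>]) auto
  also have "\<dots> = (\<Sum>j\<in>{1..q}. c * (exp (H j) * z j ^ (d + 1)))"
    using c by (intro sum.cong refl) (simp add: tw)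
  also have "\<dots> = c * (\<Sum>j\<in>{1..q}. exp (H j) * z j ^ (d + 1))" by (simp only: sum_distrib_left)
  finally have "c = 1 / (\<Sum>j\<in>{1..q}. exp (H j) * z j ^ (d + 1))"
    by (metis mult_eq_0_iff nonzero_eq_divide_eq zero_neq_one)
  then show ?thesis using c[of s] assms by (simp add: site_prob_def tw)
qed

lemma sum_site_prob: "(\<Sum>i\<in>{1..q}. site_prob i) = 1"
proof -
  have "(\<Sum>j\<in>{1..q}. exp (H j) * z j ^ (d + 1)) > 0"
    by (rule sum_pos) (use states z_pos in auto)
  then show ?thesis by (simp only: site_prob_def sum_divide_distrib[symmetric]) simp
qed

text \<open>Conditional independence given the spin at \<open>x\<close>: while \<open>W\<close>
  grows from \<open>{x}\<close> to \<open>V\<close>, each new leaf hangs on the same vertex in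
  \<open>W\<close> and in \<open>U \<union> W\<close>, so both sides gain the same factor.\<close>

lemma measure_pattern_glue:
  assumes U: "conn U" "finite U" and V: "conn V" "finite V" and "U \<inter> V = {x}"
    and s: "\<And>y. y \<in> U \<union> V \<Longrightarrow> s y \<in> {1..q}"
  shows "measure \<mu> (pattern q (U \<union> V) s) * site_prob (s x) = measure \<mu> (pattern q U s) * measure \<mu> (pattern q V s)"
proof -
  have x: "x \<in> U" "x \<in> V" using assms(5) by auto
  show ?thesis
  proof (rule grow_induct[of V "{x}" "\<lambda>W. measure \<mu> (pattern q (U \<union> W) s) * site_prob (s x) =
      measure \<mu> (pattern q U s) * measure \<mu> (pattern q W s)"])
    show "measure \<mu> (pattern q (U \<union> {x}) s) * site_prob (s x) =
      measure \<mu> (pattern q U s) * measure \<mu> (pattern q {x} s)"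
      using measure_site[of s x] s x by (simp add: insert_absorb)
    fix W u w
    assume W: "conn W" "finite W" "{x} \<subseteq> W" "insert w W \<subseteq> V" "u \<in> W" "w \<notin> W" "E u w"
      and IH: "measure \<mu> (pattern q (U \<union> W) s) * site_prob (s x) =
        measure \<mu> (pattern q U s) * measure \<mu> (pattern q W s)"
    have "w \<notin> U" using W assms(5) by auto
    have "conn (U \<union> W)" by (rule conn_Un) (use U W x in auto)
    then have "measure \<mu> (pattern q (insert w (U \<union> W)) s) = measure \<mu> (pattern q (U \<union> W) s) * trans_prob (s u) (s w)"
      by (rule measure_pattern_insert) (use U W \<open>w \<notin> U\<close> s in auto)
    moreover have "measure \<mu> (pattern q (insert w W) s) = measure \<mu> (pattern q W s) * trans_prob (s u) (s w)"
      by (rule measure_pattern_insert) (use W s in auto)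
    ultimately show "measure \<mu> (pattern q (U \<union> insert w W) s) * site_prob (s x) =
        measure \<mu> (pattern q U s) * measure \<mu> (pattern q (insert w W) s)"
      using IH by (simp add: algebra_simps)
  qed (use V x in auto)
qed

section \<open>Exponential decay of correlations\<close>

lemma measure_spin_beyond:
  assumes U: "conn U" "finite U" and x: "x \<in> U" "y \<notin> U" "E x y" and S: "S \<subseteq> configs q U" and j: "j \<in> {1..q}"
  shows "measure \<mu> (cylinder q U S \<inter> pattern q {y} (\<lambda>_. j)) =
    (\<Sum>i\<in>{1..q}. measure \<mu> (cylinder q U S \<inter> pattern q {x} (\<lambda>_. i)) * trans_prob i j)"
proof -
  have spin: "t u \<in> {1..q}" if "t \<in> S" "u \<in> U" for t u using S that by (auto simp: configs_iff)
  have "measure \<mu> (cylinder q U S \<inter> pattern q {y} (\<lambda>_. j)) = (\<Sum>t\<in>S. measure \<mu> (pattern q U t \<inter> pattern q {y} (\<lambda>_. j)))"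
    by (rule measure_cylinder_Int[OF finite_measure_\<mu> sets_\<mu> U(2) S]) simp
  also have "\<dots> = (\<Sum>t\<in>S. measure \<mu> (pattern q U t) * trans_prob (t x) j)"
  proof (rule sum.cong[OF refl])
    fix t assume t: "t \<in> S"
    have "pattern q U t \<inter> pattern q {y} (\<lambda>_. j) = pattern q (insert y U) (t(y := j))"
      by (subst pattern_Int[of U "t(y := j)" t "{y}" "\<lambda>_. j" q]) (use x(2) in auto)
    moreover have "measure \<mu> (pattern q (insert y U) (t(y := j))) =
        measure \<mu> (pattern q U (t(y := j))) * trans_prob ((t(y := j)) x) ((t(y := j)) y)"
      by (rule measure_pattern_insert[OF U x]) (use spin[OF t] j in auto)
    moreover have "pattern q U (t(y := j)) = pattern q U t"
      by (rule pattern_cong) (use x in auto)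
    moreover have "(t(y := j)) x = t x" using x by auto
    ultimately show "measure \<mu> (pattern q U t \<inter> pattern q {y} (\<lambda>_. j)) = measure \<mu> (pattern q U t) * trans_prob (t x) j"
      by simp
  qed
  also have "\<dots> = (\<Sum>t\<in>S. \<Sum>i\<in>{1..q}. measure \<mu> (pattern q U t \<inter> pattern q {x} (\<lambda>_. i)) * trans_prob i j)"
  proof (rule sum.cong[OF refl])
    fix t assume t: "t \<in> S"
    have "measure \<mu> (pattern q U t \<inter> pattern q {x} (\<lambda>_. i)) = (if i = t x then measure \<mu> (pattern q U t) else 0)" for i
    proof (cases "i = t x")
      case True
      then have "pattern q U t \<inter> pattern q {x} (\<lambda>_. i) = pattern q U t" using x by (auto simp: pattern_def)
      then show ?thesis using True by simp
    next
      case False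
      then have "pattern q U t \<inter> pattern q {x} (\<lambda>_. i) = {}" using x by (auto simp: pattern_def)
      then show ?thesis using False by simp
    qed
    then have "(\<Sum>i\<in>{1..q}. measure \<mu> (pattern q U t \<inter> pattern q {x} (\<lambda>_. i)) * trans_prob i j) =
        (\<Sum>i\<in>{1..q}. if i = t x then measure \<mu> (pattern q U t) * trans_prob i j else 0)"
      by (intro sum.cong) auto
    then show "measure \<mu> (pattern q U t) * trans_prob (t x) j =
        (\<Sum>i\<in>{1..q}. measure \<mu> (pattern q U t \<inter> pattern q {x} (\<lambda>_. i)) * trans_prob i j)"
      using spin[OF t x(1)] by (simp add: sum.delta)
  qed
  also have "\<dots> = (\<Sum>i\<in>{1..q}. (\<Sum>t\<in>S. measure \<mu> (pattern q U t \<inter> pattern q {x} (\<lambda>_. i))) * trans_prob i j)"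
    by (subst sum.swap) (simp add: sum_distrib_right)
  also have "\<dots> = (\<Sum>i\<in>{1..q}. measure \<mu> (cylinder q U S \<inter> pattern q {x} (\<lambda>_. i)) * trans_prob i j)"
    by (simp add: measure_cylinder_Int[OF finite_measure_\<mu> sets_\<mu> U(2) S])
  finally show ?thesis .
qed

text \<open>\<open>measure_spin_beyond\<close> for the sure event expresses the marginal at one end
  of an edge through the other, and both marginals are \<open>site_prob\<close>.\<close>

lemma site_prob_stationary:
  assumes "j \<in> {1..q}"
  shows "(\<Sum>i\<in>{1..q}. site_prob i * trans_prob i j) = site_prob j"
proof -
  have "nbrs r \<noteq> {}" using card_nbrs[of r] by auto
  then obtain y where y: "E r y" by auto
  have "y \<noteq> r" using y E_irrefl by auto
  have "cylinder q {r} (configs q {r}) = space \<Omega>" by (auto simp: cylinder_def restrict_in_configs)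
  moreover have "space \<Omega> \<inter> pattern q V s = pattern q V s" for V :: "'v set" and s by (auto simp: pattern_def)
  ultimately show ?thesis
    using measure_spin_beyond[of "{r}" r y "configs q {r}" j] y \<open>y \<noteq> r\<close> assms by (simp add: measure_site)
qed

definition \<epsilon> :: real where "\<epsilon> = Min ((\<lambda>(i, j). trans_prob i j) ` ({1..q} \<times> {1..q}))"

text \<open>The factor of \<open>stochastic_contraction\<close> for \<open>trans_prob\<close>. It is
  below 1 because the finitely many entries are all positive.\<close>

definition \<rho> :: real where "\<rho> = 1 - real q * \<epsilon>"

lemma \<epsilon>_le: "i \<in> {1..q} \<Longrightarrow> j \<in> {1..q} \<Longrightarrow> \<epsilon> \<le> trans_prob i j"
  unfolding \<epsilon>_def by (intro Min_le) auto

lemma \<rho>_bounds: "0 \<le> \<rho>" "\<rho> < 1"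
proof -
  have "\<epsilon> \<in> (\<lambda>(i, j). trans_prob i j) ` ({1..q} \<times> {1..q})"
    unfolding \<epsilon>_def by (rule Min_in) (use states in auto)
  then have "\<epsilon> > 0" using trans_prob_pos by auto
  then show "\<rho> < 1" using states by (simp add: \<rho>_def)
  have "(\<Sum>j\<in>{1..q}. \<epsilon>) \<le> (\<Sum>j\<in>{1..q}. trans_prob 1 j)"
    by (intro sum_mono \<epsilon>_le) (use states in auto)
  then show "0 \<le> \<rho>" using sum_trans_prob[of 1] states by (simp add: \<rho>_def)
qed

text \<open>The deviation vector has total 0 and is multiplied by \<open>trans_prob\<close> at each
  step away from the ball, so it contracts by \<open>\<rho>\<close>. At the start its norm is at
  most 2, as the difference of two nonnegative vectors of mass at most 1.\<close>

lemma spin_decorrelation: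
  assumes S: "S \<subseteq> configs q (tree_ball E r m)" and "y \<in> tree_ball E r (Suc (m + n)) - tree_ball E r (m + n)"
  shows "(\<Sum>j\<in>{1..q}. \<bar>measure \<mu> (cylinder q (tree_ball E r m) S \<inter> pattern q {y} (\<lambda>_. j)) -
      measure \<mu> (cylinder q (tree_ball E r m) S) * site_prob j\<bar>) \<le> 2 * \<rho> ^ n"
  using assms(2)
proof (induction n arbitrary: y)
  case 0
  let ?A = "cylinder q (tree_ball E r m) S"
  have sum: "(\<Sum>j\<in>{1..q}. measure \<mu> (?A \<inter> pattern q {y} (\<lambda>_. j))) \<le> 1"
  proof -
    have "(\<Sum>j\<in>{1..q}. measure \<mu> (?A \<inter> pattern q {y} (\<lambda>_. j))) \<le> (\<Sum>j\<in>{1..q}. measure \<mu> (pattern q {y} (\<lambda>_. j)))"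
      by (intro sum_mono finite_measure_mono) auto
    also have "\<dots> = 1" using sum_site_prob by (simp add: measure_site)
    finally show ?thesis .
  qed
  have "(\<Sum>j\<in>{1..q}. \<bar>measure \<mu> (?A \<inter> pattern q {y} (\<lambda>_. j)) - measure \<mu> ?A * site_prob j\<bar>)
      \<le> (\<Sum>j\<in>{1..q}. measure \<mu> (?A \<inter> pattern q {y} (\<lambda>_. j)) + 1 * site_prob j)"
  proof (rule sum_mono)
    fix j
    have "measure \<mu> ?A * site_prob j \<le> 1 * site_prob j" "0 \<le> measure \<mu> ?A * site_prob j"
      using site_prob_pos[of j] by (auto intro!: mult_right_mono)
    then show "\<bar>measure \<mu> (?A \<inter> pattern q {y} (\<lambda>_. j)) - measure \<mu> ?A * site_prob j\<bar>
        \<le> measure \<mu> (?A \<inter> pattern q {y} (\<lambda>_. j)) + 1 * site_prob j"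
      using measure_nonneg[of \<mu> "?A \<inter> pattern q {y} (\<lambda>_. j)"] by linarith
  qed
  also have "\<dots> \<le> 2" using sum sum_site_prob by (simp add: sum.distrib)
  finally show ?case by simp
next
  case (Suc n)
  let ?B = "tree_ball E r m" and ?U = "tree_ball E r (Suc (m + n))"
  let ?A = "cylinder q ?B S"
  let ?\<phi> = "\<lambda>x j. measure \<mu> (?A \<inter> pattern q {x} (\<lambda>_. j))"
  have "y \<notin> ?U" "y \<in> ?U \<union> (\<Union>x\<in>?U. nbrs x)"
    using Suc.prems unfolding ball_Suc[of r "Suc (m + n)", symmetric] by simp_all
  then obtain x where x: "x \<in> ?U" "E x y" "y \<notin> ?U" by auto
  have "x \<notin> tree_ball E r (m + n)" using x by (auto simp: ball_Suc)
  then have IH: "(\<Sum>j\<in>{1..q}. \<bar>?\<phi> x j - measure \<mu> ?A * site_prob j\<bar>) \<le> 2 * \<rho> ^ n"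
    using Suc.IH[of x] x by simp
  \<comment> \<open>Seen as an event on the larger ball \<open>?U\<close>, which has
    \<open>y\<close> just outside, \<open>?A\<close> satisfies the Markov step from \<open>x\<close>
    to \<open>y\<close>.\<close>
  have A: "?A = cylinder q ?U {t \<in> configs q ?U. restrict t ?B \<in> S}"
    by (rule cylinder_enlarge) (rule ball_mono, simp)
  have step: "?\<phi> y j = (\<Sum>i\<in>{1..q}. ?\<phi> x i * trans_prob i j)" if "j \<in> {1..q}" for j
    unfolding A by (rule measure_spin_beyond) (use x that in auto)
  have total: "(\<Sum>i\<in>{1..q}. ?\<phi> x i) = measure \<mu> ?A"
  proof -
    have "measure \<mu> ?A = measure \<mu> (\<Union>i\<in>{1..q}. ?A \<inter> pattern q {x} (\<lambda>_. i))"
      by (intro arg_cong[where f = "measure \<mu>"]) (auto simp: cylinder_def pattern_def space_config_space)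
    also have "\<dots> = (\<Sum>i\<in>{1..q}. ?\<phi> x i)"
      by (rule finite_measure_finite_Union) (use S in \<open>auto simp: disjoint_family_on_def pattern_def\<close>)
    finally show ?thesis by simp
  qed
  have "(\<Sum>j\<in>{1..q}. \<bar>?\<phi> y j - measure \<mu> ?A * site_prob j\<bar>) =
      (\<Sum>j\<in>{1..q}. \<bar>\<Sum>i\<in>{1..q}. (?\<phi> x i - measure \<mu> ?A * site_prob i) * trans_prob i j\<bar>)"
  proof (rule sum.cong[OF refl])
    fix j assume j: "j \<in> {1..q}"
    have "(\<Sum>i\<in>{1..q}. (?\<phi> x i - measure \<mu> ?A * site_prob i) * trans_prob i j) =
        ?\<phi> y j - measure \<mu> ?A * (\<Sum>i\<in>{1..q}. site_prob i * trans_prob i j)"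
      unfolding step[OF j] by (simp add: left_diff_distrib sum_subtractf sum_distrib_left mult.assoc)
    then show "\<bar>?\<phi> y j - measure \<mu> ?A * site_prob j\<bar> =
        \<bar>\<Sum>i\<in>{1..q}. (?\<phi> x i - measure \<mu> ?A * site_prob i) * trans_prob i j\<bar>"
      by (simp only: site_prob_stationary[OF j])
  qed
  also have "\<dots> \<le> (1 - real (card {1..q}) * \<epsilon>) * (\<Sum>i\<in>{1..q}. \<bar>?\<phi> x i - measure \<mu> ?A * site_prob i\<bar>)"
    by (rule stochastic_contraction)
      (use \<epsilon>_le sum_trans_prob total sum_site_prob in \<open>auto simp: sum_subtractf sum_distrib_left[symmetric]\<close>)
  also have "\<dots> \<le> \<rho> * (2 * \<rho> ^ n)"
    using IH \<rho>_bounds by (simp add: \<rho>_def mult_left_mono)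
  finally show ?case by simp
qed

text \<open>All dependence between the ball and \<open>V\<close> passes through the spin at a vertex
  of \<open>V\<close> nearest to the root. Conditioning on that spin divides by its probability,
  which explains the minimum of \<open>site_prob\<close>.\<close>

lemma decorrelation:
  assumes S: "S \<subseteq> configs q (tree_ball E r m)" and V: "conn V" "finite V" "V \<noteq> {}" "V \<inter> tree_ball E r (m + n) = {}"
    and T: "T \<subseteq> configs q V"
  shows "\<bar>measure \<mu> (cylinder q (tree_ball E r m) S \<inter> cylinder q V T) -
      measure \<mu> (cylinder q (tree_ball E r m) S) * measure \<mu> (cylinder q V T)\<bar> \<le> 2 * \<rho> ^ n / Min (site_prob ` {1..q})"
proof -
  let ?B = "tree_ball E r m" and ?p = "Min (site_prob ` {1..q})"
  let ?A = "cylinder q ?B S"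
  have "?p \<in> site_prob ` {1..q}" by (rule Min_in) (use states in auto)
  then have p: "?p > 0" using site_prob_pos by auto
  have "\<exists>k. tree_ball E r k \<inter> V \<noteq> {}" using V(3) ball_exhausts by blast
  then obtain k where k: "tree_ball E r k \<inter> V \<noteq> {}" and least: "\<And>l. l < k \<Longrightarrow> tree_ball E r l \<inter> V = {}"
    unfolding exists_least_iff[of "\<lambda>k. tree_ball E r k \<inter> V \<noteq> {}"] by blast
  have "m + n < k"
    using k V(4) ball_mono[of k "m + n" r] by (meson disjoint_iff linorder_not_le subsetD)
  then obtain n' where n': "k = Suc (m + n')" "n \<le> n'" using less_imp_Suc_add[of "m + n" k] by auto
  let ?K = "tree_ball E r (m + n')"
  have U0V: "?K \<inter> V = {}" by (rule least) (simp add: n')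
  obtain x where x: "x \<in> V" "x \<in> tree_ball E r (Suc (m + n'))" using k n' by auto
  then have "x \<notin> ?K" using U0V by auto
  then obtain y where y: "y \<in> ?K" "E y x" using x by (auto simp: ball_Suc)
  \<comment> \<open>\<open>?U\<close> contains the ball of radius \<open>m\<close> and meets
    \<open>V\<close> only in the entry vertex \<open>x\<close>, as
    \<open>measure_pattern_glue\<close> requires.\<close>
  let ?U = "insert x ?K"
  have U: "conn ?U" "finite ?U" using conn_insert[OF conn_ball y] by auto
  have UV: "?U \<inter> V = {x}" using U0V x by auto
  have B_U: "?B \<subseteq> ?U" using ball_mono[of m "m + n'" r] by auto
  have A: "?A = cylinder q ?U {t \<in> configs q ?U. restrict t ?B \<in> S}" (is "_ = cylinder q ?U ?S'")
    by (rule cylinder_enlarge[OF B_U])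
  have single: "\<bar>measure \<mu> (?A \<inter> pattern q V t) - measure \<mu> ?A * measure \<mu> (pattern q V t)\<bar> \<le>
      measure \<mu> (pattern q V t) * (2 * \<rho> ^ n / ?p)" if t: "t \<in> T" for t
  proof -
    have spin: "t u \<in> {1..q}" if "u \<in> V" for u using T t that by (auto simp: configs_iff)
    have "measure \<mu> (?A \<inter> pattern q V t) * site_prob (t x) =
        (\<Sum>s\<in>?S'. measure \<mu> (pattern q ?U s \<inter> pattern q V t) * site_prob (t x))"
      unfolding A by (subst measure_cylinder_Int[OF finite_measure_\<mu> sets_\<mu> U(2)]) (auto simp: V sum_distrib_right)
    also have "\<dots> = (\<Sum>s\<in>?S'. measure \<mu> (pattern q ?U s \<inter> pattern q {x} t) * measure \<mu> (pattern q V t))"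
    proof (rule sum.cong[OF refl])
      fix s assume s: "s \<in> ?S'"
      show "measure \<mu> (pattern q ?U s \<inter> pattern q V t) * site_prob (t x) =
          measure \<mu> (pattern q ?U s \<inter> pattern q {x} t) * measure \<mu> (pattern q V t)"
      proof (cases "s x = t x")
        case False
        then have "pattern q ?U s \<inter> pattern q V t = {}" "pattern q ?U s \<inter> pattern q {x} t = {}"
          using x by (auto simp: pattern_def)
        then show ?thesis by simp
      next
        case True
        define u where "u w = (if w \<in> V then t w else s w)" for w
        have us: "u w = s w" if "w \<in> ?U" for w using that UV True U0V by (auto simp: u_def)
        have ut: "u w = t w" if "w \<in> V" for w using that by (simp add: u_def)
        have "measure \<mu> (pattern q (?U \<union> V) u) * site_prob (u x) = measure \<mu> (pattern q ?U u) * measure \<mu> (pattern q V u)"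
          by (rule measure_pattern_glue[OF U V(1,2) UV]) (use s spin in \<open>auto simp: u_def configs_iff\<close>)
        moreover have "pattern q ?U u = pattern q ?U s" "pattern q V u = pattern q V t"
          using us ut by (auto intro!: pattern_cong)
        moreover have "pattern q ?U s \<inter> pattern q V t = pattern q (?U \<union> V) u"
          by (rule pattern_Int) (use us ut in auto)
        moreover have "pattern q ?U s \<inter> pattern q {x} t = pattern q ?U s"
          using True by (auto simp: pattern_def)
        ultimately show ?thesis using ut x by simp
      qed
    qed
    also have "\<dots> = measure \<mu> (?A \<inter> pattern q {x} t) * measure \<mu> (pattern q V t)"
      unfolding A by (subst measure_cylinder_Int[OF finite_measure_\<mu> sets_\<mu> U(2)]) (auto simp: sum_distrib_right)
    also have "pattern q {x} t = pattern q {x} (\<lambda>_. t x)" by (rule pattern_cong) simp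
    finally have eq: "measure \<mu> (?A \<inter> pattern q V t) * site_prob (t x) =
        measure \<mu> (?A \<inter> pattern q {x} (\<lambda>_. t x)) * measure \<mu> (pattern q V t)" .
    let ?\<delta> = "\<lambda>j. \<bar>measure \<mu> (?A \<inter> pattern q {x} (\<lambda>_. j)) - measure \<mu> ?A * site_prob j\<bar>"
    have "?\<delta> (t x) \<le> (\<Sum>j\<in>{1..q}. ?\<delta> j)"
      by (rule member_le_sum) (use spin[OF x(1)] in auto)
    also have "\<dots> \<le> 2 * \<rho> ^ n'"
      by (rule spin_decorrelation[OF S]) (use x \<open>x \<notin> ?K\<close> in auto)
    also have "\<dots> \<le> 2 * \<rho> ^ n" using power_decreasing[OF n'(2), of \<rho>] \<rho>_bounds by simp
    finally have \<delta>: "?\<delta> (t x) \<le> 2 * \<rho> ^ n" .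
    \<comment> \<open>Multiplying by \<open>site_prob (t x)\<close> lets \<open>eq\<close> replace
      the deviation for the whole pattern by the deviation for the single spin at
      \<open>x\<close>.\<close>
    have "\<bar>measure \<mu> (?A \<inter> pattern q V t) - measure \<mu> ?A * measure \<mu> (pattern q V t)\<bar> * site_prob (t x) =
        \<bar>(measure \<mu> (?A \<inter> pattern q V t) - measure \<mu> ?A * measure \<mu> (pattern q V t)) * site_prob (t x)\<bar>"
      using site_prob_pos[of "t x"] by (simp add: abs_mult)
    also have "(measure \<mu> (?A \<inter> pattern q V t) - measure \<mu> ?A * measure \<mu> (pattern q V t)) * site_prob (t x) =
        (measure \<mu> (?A \<inter> pattern q {x} (\<lambda>_. t x)) - measure \<mu> ?A * site_prob (t x)) * measure \<mu> (pattern q V t)"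
      using eq by (simp add: algebra_simps)
    also have "\<bar>\<dots>\<bar> = ?\<delta> (t x) * measure \<mu> (pattern q V t)" by (simp add: abs_mult)
    also have "\<dots> \<le> 2 * \<rho> ^ n * measure \<mu> (pattern q V t)" using \<delta> by (intro mult_right_mono) auto
    finally have "\<bar>measure \<mu> (?A \<inter> pattern q V t) - measure \<mu> ?A * measure \<mu> (pattern q V t)\<bar> \<le>
        2 * \<rho> ^ n * measure \<mu> (pattern q V t) / site_prob (t x)"
      using site_prob_pos[of "t x"] by (simp add: field_simps)
    also have "\<dots> \<le> 2 * \<rho> ^ n * measure \<mu> (pattern q V t) / ?p"
      using p spin[OF x(1)] \<rho>_bounds by (intro divide_left_mono Min_le mult_nonneg_nonneg mult_pos_pos site_prob_pos) auto
    finally show ?thesis by (simp add: algebra_simps)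
  qed
  have "measure \<mu> (?A \<inter> cylinder q V T) = (\<Sum>t\<in>T. measure \<mu> (?A \<inter> pattern q V t))"
    using measure_cylinder_Int[OF finite_measure_\<mu> sets_\<mu> V(2) T, of ?A] S by (simp add: Int_commute)
  moreover have BT: "measure \<mu> (cylinder q V T) = (\<Sum>t\<in>T. measure \<mu> (pattern q V t))"
    by (rule measure_cylinder[OF finite_measure_\<mu> V(2) T sets_\<mu>])
  ultimately have "\<bar>measure \<mu> (?A \<inter> cylinder q V T) - measure \<mu> ?A * measure \<mu> (cylinder q V T)\<bar> =
      \<bar>\<Sum>t\<in>T. measure \<mu> (?A \<inter> pattern q V t) - measure \<mu> ?A * measure \<mu> (pattern q V t)\<bar>"
    by (simp add: sum_subtractf sum_distrib_left)
  also have "\<dots> \<le> (\<Sum>t\<in>T. measure \<mu> (pattern q V t) * (2 * \<rho> ^ n / ?p))"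
    by (intro order_trans[OF sum_abs] sum_mono single)
  also have "\<dots> = measure \<mu> (cylinder q V T) * (2 * \<rho> ^ n / ?p)" by (simp only: BT sum_distrib_right)
  also have "\<dots> \<le> 1 * (2 * \<rho> ^ n / ?p)"
    using p \<rho>_bounds by (intro mult_right_mono) auto
  finally show ?thesis by simp
qed

section \<open>Invariance and mixing under automorphisms\<close>

lemma measurable_relabel [measurable]: "(\<lambda>\<omega>. \<omega> \<circ> g) \<in> measurable \<Omega> \<Omega>"
  unfolding o_def by (intro measurable_into_config_space measurable_spin)

lemma pattern_automorphism:
  assumes g: "automorphism g" and V: "finite V" "conn V" "V \<noteq> {}" and s: "\<And>x. x \<in> V \<Longrightarrow> s x \<in> {1..q}"
  shows "measure \<mu> (pattern q (g ` V) (s \<circ> inv g)) = measure \<mu> (pattern q V s)"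
proof -
  have inv: "inv g (g x) = x" for x using g by (simp add: automorphism_def bij_is_inj)
  have inj: "g x \<in> g ` U \<longleftrightarrow> x \<in> U" for x U using g by (auto simp: automorphism_def bij_def inj_image_mem_iff)
  obtain v where v: "v \<in> V" using V by blast
  show ?thesis
    using V(1,2)
  proof (rule grow_induct[of V "{v}" "\<lambda>W. measure \<mu> (pattern q (g ` W) (s \<circ> inv g)) = measure \<mu> (pattern q W s)"])
    show "measure \<mu> (pattern q (g ` {v}) (s \<circ> inv g)) = measure \<mu> (pattern q {v} s)"
      using measure_site[of s v] measure_site[of "s \<circ> inv g" "g v"] s v by (simp add: inv)
    fix U u w assume U: "conn U" "finite U" "insert w U \<subseteq> V" "u \<in> U" "w \<notin> U" "E u w"
      and IH: "measure \<mu> (pattern q (g ` U) (s \<circ> inv g)) = measure \<mu> (pattern q U s)"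
    have "measure \<mu> (pattern q (insert (g w) (g ` U)) (s \<circ> inv g)) =
        measure \<mu> (pattern q (g ` U) (s \<circ> inv g)) * trans_prob ((s \<circ> inv g) (g u)) ((s \<circ> inv g) (g w))"
    proof (rule measure_pattern_insert)
      show "conn (g ` U)" using conn_image automorphism_partial_iso[OF g] U by blast
      show "E (g u) (g w)" using g U by (simp add: automorphism_def)
      show "(s \<circ> inv g) x \<in> {1..q}" if "x \<in> insert (g w) (g ` U)" for x
        using that s U inv by auto
    qed (use U inj in auto)
    moreover have "measure \<mu> (pattern q (insert w U) s) = measure \<mu> (pattern q U s) * trans_prob (s u) (s w)"
      by (rule measure_pattern_insert) (use U s in auto)
    ultimately show "measure \<mu> (pattern q (g ` insert w U) (s \<circ> inv g)) = measure \<mu> (pattern q (insert w U) s)"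
      using IH by (simp add: inv)
  qed (use v in auto)
qed

lemma distr_relabel:
  assumes g: "automorphism g"
  shows "distr \<mu> \<Omega> (\<lambda>\<omega>. \<omega> \<circ> g) = \<mu>"
proof (rule config_measure_eqI)
  fix V :: "'v set" assume "finite V"
  then obtain n where n: "V \<subseteq> tree_ball E r n" using finite_subset_ball by blast
  have "emeasure (distr \<mu> \<Omega> (\<lambda>\<omega>. \<omega> \<circ> g)) (pattern q (tree_ball E r n) t) = emeasure \<mu> (pattern q (tree_ball E r n) t)"
    if t: "t \<in> configs q (tree_ball E r n)" for t
  proof -
    have inv: "inv g (g x) = x" for x using g by (simp add: automorphism_def bij_is_inj)
    have "(\<lambda>\<omega>. \<omega> \<circ> g) -` pattern q (tree_ball E r n) t \<inter> space \<mu> = pattern q (g ` tree_ball E r n) (t \<circ> inv g)"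
      by (auto simp: pattern_def space_config_space inv)
    then have "emeasure (distr \<mu> \<Omega> (\<lambda>\<omega>. \<omega> \<circ> g)) (pattern q (tree_ball E r n) t) =
        emeasure \<mu> (pattern q (g ` tree_ball E r n) (t \<circ> inv g))"
      by (simp add: emeasure_distr)
    also have "\<dots> = emeasure \<mu> (pattern q (tree_ball E r n) t)"
      unfolding emeasure_eq_measure
      by (subst pattern_automorphism[OF g]) (use t in \<open>auto simp: configs_iff\<close>)
    finally show ?thesis .
  qed
  then show "\<exists>W. finite W \<and> V \<subseteq> W \<and> (\<forall>t\<in>configs q W.
      emeasure (distr \<mu> \<Omega> (\<lambda>\<omega>. \<omega> \<circ> g)) (pattern q W t) = emeasure \<mu> (pattern q W t))"
    using n finite_ball by blast
qed (auto intro: finite_measure_distr)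

lemma measure_relabel:
  assumes "automorphism g" "A \<in> sets \<Omega>"
  shows "measure \<mu> {\<omega> \<in> space \<Omega>. \<omega> \<circ> g \<in> A} = measure \<mu> A"
proof -
  have "measure \<mu> A = measure (distr \<mu> \<Omega> (\<lambda>\<omega>. \<omega> \<circ> g)) A" by (simp add: distr_relabel[OF assms(1)])
  also have "\<dots> = measure \<mu> ((\<lambda>\<omega>. \<omega> \<circ> g) -` A \<inter> space \<mu>)"
    by (rule measure_distr) (use assms(2) in auto)
  also have "(\<lambda>\<omega>. \<omega> \<circ> g) -` A \<inter> space \<mu> = {\<omega> \<in> space \<Omega>. \<omega> \<circ> g \<in> A}" by auto
  finally show ?thesis by simp
qed

lemma abs_measure_diff_le:
  assumes "A \<in> sets \<mu>" "B \<in> sets \<mu>"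
  shows "\<bar>measure \<mu> A - measure \<mu> B\<bar> \<le> measure \<mu> (sym_diff A B)"
proof -
  have "measure \<mu> A \<le> measure \<mu> (B \<union> sym_diff A B)" "measure \<mu> B \<le> measure \<mu> (A \<union> sym_diff A B)"
    using assms by (auto intro!: finite_measure_mono)
  moreover have "measure \<mu> (B \<union> sym_diff A B) \<le> measure \<mu> B + measure \<mu> (sym_diff A B)"
    "measure \<mu> (A \<union> sym_diff A B) \<le> measure \<mu> A + measure \<mu> (sym_diff A B)"
    using assms by (auto intro!: measure_Un_le)
  ultimately show ?thesis by linarith
qed

text \<open>Both events are approximated by cylinders on one ball, and \<open>g\<close> moves the
  copy belonging to \<open>A\<close> far off. Invariance of \<open>\<mu>\<close> keeps the mass of
  \<open>A\<close> and its approximation error unchanged.\<close>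

lemma mixing:
  assumes C: "C \<in> sets \<Omega>" and A: "A \<in> sets \<Omega>" and "0 < e"
  shows "\<exists>g. automorphism g \<and> \<bar>measure \<mu> (C \<inter> {\<omega> \<in> space \<Omega>. \<omega> \<circ> g \<in> A}) - measure \<mu> C * measure \<mu> A\<bar> < e"
proof -
  \<comment> \<open>One share pays for the decorrelation bound, two for the approximation of the
    intersection and two for that of the product.\<close>
  let ?a = "e / 5"
  have a: "?a > 0" using assms(3) by simp
  obtain V1 S1 where 1: "finite V1" "S1 \<subseteq> configs q V1" "measure \<mu> (sym_diff C (cylinder q V1 S1)) < ?a"
    using cylinder_approximation[OF finite_measure_\<mu> sets_\<mu> C a] by blast
  obtain V2 S2 where 2: "finite V2" "S2 \<subseteq> configs q V2" "measure \<mu> (sym_diff A (cylinder q V2 S2)) < ?a"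
    using cylinder_approximation[OF finite_measure_\<mu> sets_\<mu> A a] by blast
  obtain m where m: "V1 \<union> V2 \<subseteq> tree_ball E r m" using finite_subset_ball[of "V1 \<union> V2" r] 1 2 by blast
  let ?B = "tree_ball E r m"
  define S where "S = {t \<in> configs q ?B. restrict t V1 \<in> S1}"
  define T where "T = {t \<in> configs q ?B. restrict t V2 \<in> S2}"
  let ?D = "cylinder q ?B S" and ?F = "cylinder q ?B T"
  have D: "cylinder q V1 S1 = ?D" unfolding S_def by (rule cylinder_enlarge) (use m in auto)
  have F: "cylinder q V2 S2 = ?F" unfolding T_def by (rule cylinder_enlarge) (use m in auto)
  have sets: "?D \<in> sets \<Omega>" "?F \<in> sets \<Omega>" by (auto simp: S_def T_def)
  let ?p = "Min (site_prob ` {1..q})"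
  have "(\<lambda>n. 2 * \<rho> ^ n / ?p) \<longlonglongrightarrow> 0"
    using \<rho>_bounds by (intro tendsto_divide_zero tendsto_mult_right_zero LIMSEQ_realpow_zero) auto
  then have "\<forall>\<^sub>F n in sequentially. 2 * \<rho> ^ n / ?p < ?a"
    by (rule order_tendstoD(2)) (use a in simp)
  then obtain n where n: "2 * \<rho> ^ n / ?p < ?a" by (auto simp: eventually_sequentially)
  obtain g where g: "automorphism g" "g ` ?B \<inter> tree_ball E r (m + n) = {}"
    using far_automorphism[OF degree, of r m "m + n"] by blast
  define G where "G X = {\<omega> \<in> space \<Omega>. \<omega> \<circ> g \<in> X}" for X
  have G_sets: "G X \<in> sets \<Omega>" if "X \<in> sets \<Omega>" for X
    using measurable_sets[OF measurable_relabel that] by (simp add: G_def vimage_def Int_def conj_commute)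
  have G_measure: "measure \<mu> (G X) = measure \<mu> X" if "X \<in> sets \<Omega>" for X
    using measure_relabel[OF g(1) that] by (simp add: G_def)
  let ?T = "{t \<in> configs q (g ` ?B). restrict (t \<circ> g) ?B \<in> T}"
  have "restrict (restrict \<omega> (g ` ?B) \<circ> g) ?B = restrict (\<omega> \<circ> g) ?B" for \<omega> :: "'v \<Rightarrow> nat"
    by (auto simp: fun_eq_iff restrict_def)
  moreover have "\<omega> \<circ> g \<in> space \<Omega>" if "\<omega> \<in> space \<Omega>" for \<omega>
    using that by (auto simp: space_config_space)
  ultimately have GF: "G ?F = cylinder q (g ` ?B) ?T"
    unfolding G_def cylinder_def[of q "g ` ?B"] cylinder_def[of q ?B T] by (auto simp: restrict_in_configs)
  have "\<bar>measure \<mu> (?D \<inter> G ?F) - measure \<mu> ?D * measure \<mu> (G ?F)\<bar> \<le> 2 * \<rho> ^ n / ?p"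
    unfolding GF
    by (rule decorrelation)
      (use g conn_image[OF automorphism_partial_iso[OF g(1)] conn_ball] in \<open>auto simp: S_def\<close>)
  then have main: "\<bar>measure \<mu> (?D \<inter> G ?F) - measure \<mu> ?D * measure \<mu> ?F\<bar> < ?a"
    using n G_measure sets by simp
  have "sym_diff (C \<inter> G A) (?D \<inter> G ?F) \<subseteq> sym_diff C ?D \<union> G (sym_diff A ?F)"
    by (auto simp: G_def)
  then have "measure \<mu> (sym_diff (C \<inter> G A) (?D \<inter> G ?F)) \<le> measure \<mu> (sym_diff C ?D \<union> G (sym_diff A ?F))"
    by (rule finite_measure_mono) (use C A sets G_sets in auto)
  also have "\<dots> \<le> measure \<mu> (sym_diff C ?D) + measure \<mu> (G (sym_diff A ?F))"
    by (rule measure_Un_le) (use C A sets G_sets in auto)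
  also have "\<dots> < ?a + ?a"
    using 1(3) 2(3) D F G_measure[of "sym_diff A ?F"] A sets by (simp add: add_strict_mono)
  finally have i: "\<bar>measure \<mu> (C \<inter> G A) - measure \<mu> (?D \<inter> G ?F)\<bar> < 2 * ?a"
    using abs_measure_diff_le[of "C \<inter> G A" "?D \<inter> G ?F"] C A sets G_sets by simp
  have c: "\<bar>measure \<mu> C - measure \<mu> ?D\<bar> < ?a" "\<bar>measure \<mu> A - measure \<mu> ?F\<bar> < ?a"
    using abs_measure_diff_le[of C ?D] abs_measure_diff_le[of A ?F] C A sets 1(3) 2(3) D F by simp_all
  have "measure \<mu> C * measure \<mu> A - measure \<mu> ?D * measure \<mu> ?F =
      measure \<mu> C * (measure \<mu> A - measure \<mu> ?F) + (measure \<mu> C - measure \<mu> ?D) * measure \<mu> ?F"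
    by (simp add: algebra_simps)
  also have "\<bar>\<dots>\<bar> \<le> 1 * \<bar>measure \<mu> A - measure \<mu> ?F\<bar> + \<bar>measure \<mu> C - measure \<mu> ?D\<bar> * 1"
    by (rule order_trans[OF abs_triangle_ineq])
      (auto simp: abs_mult intro!: add_mono mult_left_le_one_le mult_right_le_one_le)
  finally have "\<bar>measure \<mu> C * measure \<mu> A - measure \<mu> ?D * measure \<mu> ?F\<bar> \<le>
      \<bar>measure \<mu> A - measure \<mu> ?F\<bar> + \<bar>measure \<mu> C - measure \<mu> ?D\<bar>" by simp
  also have "\<dots> < ?a + ?a" by (rule add_strict_mono[OF c(2) c(1)])
  finally have ii: "\<bar>measure \<mu> C * measure \<mu> A - measure \<mu> ?D * measure \<mu> ?F\<bar> < ?a + ?a" .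
  have "\<bar>x - u\<bar> < e" if "\<bar>x - y\<bar> < 2 * ?a" "\<bar>y - w\<bar> < ?a" "\<bar>u - w\<bar> < ?a + ?a" for x y u w
    using that by linarith
  from this[OF i main ii] have "\<bar>measure \<mu> (C \<inter> G A) - measure \<mu> C * measure \<mu> A\<bar> < e" .
  then show ?thesis using g by (auto simp: G_def)
qed

end


section \<open>Extremality and the decomposition measure\<close>

context potts
begin

text \<open>Invariance is asked only almost everywhere, since it is applied to level sets of a
  density. It then depends on \<open>M\<close> through null sets alone and passes to absolutely
  continuous measures.\<close>

definition swap_invariant :: "('v \<Rightarrow> nat) measure \<Rightarrow> ('v \<Rightarrow> nat) set \<Rightarrow> bool" where
  "swap_invariant M A \<longleftrightarrow> (\<forall>v. \<forall>i\<in>{1..q}. \<forall>j\<in>{1..q}. AE \<omega> in M. swap_spins v i j \<omega> \<in> A \<longleftrightarrow> \<omega> \<in> A)"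

lemma quasi_invariant_density:
  assumes M: "quasi_invariant M" "sets M = sets \<Omega>" and f [measurable]: "f \<in> borel_measurable \<Omega>"
    and inv: "\<And>v i j. i \<in> {1..q} \<Longrightarrow> j \<in> {1..q} \<Longrightarrow> AE \<omega> in M. f (swap_spins v i j \<omega>) = f \<omega>"
  shows "quasi_invariant (density M f)"
  unfolding quasi_invariant_def
proof (intro allI ballI)
  fix v :: 'v and i j assume ij: "i \<in> {1..q}" "j \<in> {1..q}"
  let ?T = "swap_spins v i j"
  note [measurable_cong] = M(2)
  note [measurable] = measurable_swap_spins[OF ij]
  show "distr (density M f) \<Omega> ?T = density (density M f) (\<lambda>\<omega>. ennreal (swap_density v i j \<omega>))"
  proof (rule measure_eqI)
    fix B assume "B \<in> sets (distr (density M f) \<Omega> ?T)"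
    then have B [measurable]: "B \<in> sets \<Omega>" by simp
    have "emeasure (distr (density M f) \<Omega> ?T) B = (\<integral>\<^sup>+\<omega>. indicator B \<omega> \<partial>distr (density M f) \<Omega> ?T)" by simp
    also have "\<dots> = (\<integral>\<^sup>+\<omega>. indicator B (?T \<omega>) \<partial>density M f)"
      by (rule nn_integral_distr) measurable
    also have "\<dots> = (\<integral>\<^sup>+\<omega>. f \<omega> * indicator B (?T \<omega>) \<partial>M)"
      by (rule nn_integral_density) measurable
    also have "\<dots> = (\<integral>\<^sup>+\<omega>. f (?T \<omega>) * indicator B (?T \<omega>) \<partial>M)"
      by (rule nn_integral_cong_AE) (use inv[OF ij, of v] in \<open>eventually_elim, simp\<close>)
    also have "\<dots> = (\<integral>\<^sup>+\<omega>. ennreal (swap_density v i j \<omega>) * (f \<omega> * indicator B \<omega>) \<partial>M)"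
      by (rule nn_integral_swap[OF M ij, of "\<lambda>\<omega>. f \<omega> * indicator B \<omega>"]) measurable
    also have "\<dots> = (\<integral>\<^sup>+\<omega>. f \<omega> * (ennreal (swap_density v i j \<omega>) * indicator B \<omega>) \<partial>M)"
      by (simp add: ac_simps)
    also have "\<dots> = (\<integral>\<^sup>+\<omega>. ennreal (swap_density v i j \<omega>) * indicator B \<omega> \<partial>density M f)"
      by (rule nn_integral_density[symmetric]) measurable
    also have "\<dots> = emeasure (density (density M f) (\<lambda>\<omega>. ennreal (swap_density v i j \<omega>))) B"
      by (rule emeasure_density[symmetric]) measurable
    finally show "emeasure (distr (density M f) \<Omega> ?T) B =
        emeasure (density (density M f) (\<lambda>\<omega>. ennreal (swap_density v i j \<omega>))) B" .
  qed (simp add: M(2))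
qed

text \<open>\<open>M\<close> and \<open>density M f\<close> have the same exchange density. Changing
  variables under \<open>M\<close> and back under \<open>density M f\<close> shows that
  \<open>f\<close> and its exchanged version have equal integrals over every event.\<close>

lemma density_swap_invariant:
  assumes "prob_space M" and M: "quasi_invariant M" "sets M = sets \<Omega>" and f [measurable]: "f \<in> borel_measurable \<Omega>"
    and Mf: "quasi_invariant (density M f)" and ij: "i \<in> {1..q}" "j \<in> {1..q}"
  shows "AE \<omega> in M. f (swap_spins v i j \<omega>) = f \<omega>"
proof -
  interpret prob_space M by fact
  let ?T = "swap_spins v i j"
  note [measurable_cong] = M(2)
  note [measurable] = measurable_swap_spins[OF ij]
  show ?thesis
  proof (rule density_unique2)
    fix B assume B': "B \<in> sets M"
    then have B [measurable]: "B \<in> sets \<Omega>" by (simp add: M(2))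
    have "(\<integral>\<^sup>+\<omega>\<in>B. f (?T \<omega>) \<partial>M) = (\<integral>\<^sup>+\<omega>. f (?T \<omega>) * indicator B (?T (?T \<omega>)) \<partial>M)" by simp
    also have "\<dots> = (\<integral>\<^sup>+\<omega>. ennreal (swap_density v i j \<omega>) * (f \<omega> * indicator B (?T \<omega>)) \<partial>M)"
      by (rule nn_integral_swap[OF M ij, of "\<lambda>\<omega>. f \<omega> * indicator B (?T \<omega>)"]) measurable
    also have "\<dots> = (\<integral>\<^sup>+\<omega>. f \<omega> * (ennreal (swap_density v i j \<omega>) * indicator B (?T \<omega>)) \<partial>M)"
      by (simp add: ac_simps)
    also have "\<dots> = (\<integral>\<^sup>+\<omega>. ennreal (swap_density v i j \<omega>) * indicator B (?T \<omega>) \<partial>density M f)"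
      by (rule nn_integral_density[symmetric]) measurable
    also have "\<dots> = (\<integral>\<^sup>+\<omega>. indicator B (?T (?T \<omega>)) \<partial>density M f)"
      by (rule nn_integral_swap[OF Mf _ ij, of "\<lambda>\<omega>. indicator B (?T \<omega>)", symmetric])
        (use M(2) in \<open>simp, measurable\<close>)
    also have "\<dots> = (\<integral>\<^sup>+\<omega>\<in>B. f \<omega> \<partial>M)"
      by (simp, subst emeasure_density) (use B' in measurable)
    finally show "(\<integral>\<^sup>+\<omega>\<in>B. f (?T \<omega>) \<partial>M) = (\<integral>\<^sup>+\<omega>\<in>B. f \<omega> \<partial>M)" .
  qed measurable
qed

text \<open>Conditioning on an invariant event is passing to an invariant density.\<close>

lemma conditioned_gibbs:
  assumes M: "M \<in> gibbs_measures E q \<beta> H" and A: "A \<in> sets \<Omega>" "swap_invariant M A" "measure M A \<noteq> 0"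
  shows "uniform_measure M A \<in> gibbs_measures E q \<beta> H"
proof (rule quasi_invariant_imp_gibbs)
  have "prob_space M" and sets_M: "sets M = sets \<Omega>" using M by (auto simp: gibbs_measures_def)
  then interpret prob_space M by simp
  show "prob_space (uniform_measure M A)"
    by (rule prob_space_uniform_measure) (use A(3) in \<open>auto simp: emeasure_eq_measure\<close>)
  show "quasi_invariant (uniform_measure M A)"
    unfolding uniform_measure_def
  proof (rule quasi_invariant_density[OF gibbs_imp_quasi_invariant[OF M] sets_M])
    show "(\<lambda>x. indicator A x / emeasure M A) \<in> borel_measurable \<Omega>" using A by measurable
    fix v i j assume "i \<in> {1..q}" "j \<in> {1..q}"
    then have "AE \<omega> in M. swap_spins v i j \<omega> \<in> A \<longleftrightarrow> \<omega> \<in> A" using A(2) by (simp add: swap_invariant_def)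
    then show "AE \<omega> in M. indicator A (swap_spins v i j \<omega>) / emeasure M A = indicator A \<omega> / emeasure M A"
      by eventually_elim (simp add: indicator_def)
  qed
qed (use M in \<open>simp add: gibbs_measures_def\<close>)

text \<open>Otherwise \<open>\<nu>\<close> would be a proper mixture of its conditionings on
  \<open>A\<close> and on the complement, both Gibbs, and different because they disagree on
  \<open>A\<close>.\<close>

lemma extremal_trivial:
  assumes \<nu>: "\<nu> \<in> extremal_gibbs_measures E q \<beta> H" and A: "A \<in> sets \<Omega>" "swap_invariant \<nu> A"
  shows "measure \<nu> A = 0 \<or> measure \<nu> A = 1"
proof (rule ccontr)
  assume neither: "\<not> ?thesis"
  have gibbs: "\<nu> \<in> gibbs_measures E q \<beta> H" using \<nu> by (simp add: extremal_measures_def)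
  then have "prob_space \<nu>" and sets_\<nu>: "sets \<nu> = sets \<Omega>" by (auto simp: gibbs_measures_def)
  then interpret prob_space \<nu> by simp
  have space_\<nu>: "space \<nu> = space \<Omega>" using sets_\<nu> by (rule sets_eq_imp_space_eq)
  let ?A' = "space \<nu> - A"
  have p: "0 < prob A" "prob A < 1" using neither measure_nonneg[of \<nu> A] prob_le_1[of A] by linarith+
  have A': "prob ?A' = 1 - prob A" using A sets_\<nu> by (simp add: prob_compl)
  have "swap_invariant \<nu> ?A'"
    unfolding swap_invariant_def
  proof (intro allI ballI)
    fix v i j assume ij: "i \<in> {1..q}" "j \<in> {1..q}"
    have "AE \<omega> in \<nu>. swap_spins v i j \<omega> \<in> A \<longleftrightarrow> \<omega> \<in> A" using A(2) ij by (simp add: swap_invariant_def)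
    with AE_space show "AE \<omega> in \<nu>. swap_spins v i j \<omega> \<in> ?A' \<longleftrightarrow> \<omega> \<in> ?A'"
      by eventually_elim (use swap_spins_in_space[OF ij] space_\<nu> in auto)
  qed
  then have G: "uniform_measure \<nu> A \<in> gibbs_measures E q \<beta> H" "uniform_measure \<nu> ?A' \<in> gibbs_measures E q \<beta> H"
    using conditioned_gibbs[OF gibbs] A A' p sets_\<nu> by (auto simp: sets.compl_sets space_\<nu>)
  have cond: "measure (uniform_measure \<nu> A) B = prob (A \<inter> B) / prob A"
    "measure (uniform_measure \<nu> ?A') B = prob (?A' \<inter> B) / prob ?A'" if "B \<in> events" for B
    using that p A' by (auto simp: emeasure_eq_measure)
  have "measure (uniform_measure \<nu> A) A = 1" "measure (uniform_measure \<nu> ?A') A = 0"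
    using cond[of A] A sets_\<nu> p by (auto simp: Int_absorb Diff_Int_distrib2)
  then have "uniform_measure \<nu> A \<noteq> uniform_measure \<nu> ?A'" by auto
  moreover have "prob B = prob A * measure (uniform_measure \<nu> A) B + (1 - prob A) * measure (uniform_measure \<nu> ?A') B"
    if B: "B \<in> events" for B
  proof -
    have "B = (A \<inter> B) \<union> (?A' \<inter> B)" using sets.sets_into_space[OF B] by blast
    moreover have "prob ((A \<inter> B) \<union> (?A' \<inter> B)) = prob (A \<inter> B) + prob (?A' \<inter> B)"
      by (rule finite_measure_Union) (use A B sets_\<nu> in auto)
    ultimately have "prob B = prob (A \<inter> B) + prob (?A' \<inter> B)" by simp
    then show ?thesis using cond[OF B] p A' by simp
  qed
  ultimately show False using \<nu> G p unfolding extremal_measures_def by blast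
qed

end

section \<open>Extremal measures absolutely continuous with respect to a splitting measure\<close>

context splitting_measure
begin

lemma relabel_swap_invariant:
  assumes g: "automorphism g" and A: "A \<in> sets \<Omega>" "swap_invariant \<mu> A"
  shows "swap_invariant \<mu> {\<omega> \<in> space \<Omega>. \<omega> \<circ> g \<in> A}"
  unfolding swap_invariant_def
proof (intro allI ballI)
  fix v i j assume ij: "i \<in> {1..q}" "j \<in> {1..q}"
  \<comment> \<open>Exchanging at \<open>v\<close> before relabelling is exchanging at
    \<open>inv g v\<close> afterwards; invariance of \<open>\<mu>\<close> then transports the
    exceptional null set.\<close>
  have comm: "swap_spins v i j \<omega> \<circ> g = swap_spins (inv g v) i j (\<omega> \<circ> g)" for \<omega>
    using g by (auto simp: fun_eq_iff swap_spins_apply automorphism_def bij_is_surj surj_f_inv_f bij_is_inj)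
  have "AE \<omega> in distr \<mu> \<Omega> (\<lambda>\<omega>. \<omega> \<circ> g). swap_spins (inv g v) i j \<omega> \<in> A \<longleftrightarrow> \<omega> \<in> A"
    using A(2) ij unfolding distr_relabel[OF g] swap_invariant_def by blast
  then have "AE \<omega> in \<mu>. swap_spins (inv g v) i j (\<omega> \<circ> g) \<in> A \<longleftrightarrow> \<omega> \<circ> g \<in> A"
    by (rule AE_distrD[rotated]) measurable
  with AE_space show "AE \<omega> in \<mu>. swap_spins v i j \<omega> \<in> {\<omega> \<in> space \<Omega>. \<omega> \<circ> g \<in> A} \<longleftrightarrow>
      \<omega> \<in> {\<omega> \<in> space \<Omega>. \<omega> \<circ> g \<in> A}"
    by eventually_elim (use swap_spins_in_space[OF ij] comm in auto)
qed

lemma extremal_absolutely_continuous_eq: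
  assumes \<nu>: "\<nu> \<in> extremal_gibbs_measures E q \<beta> H" and ac: "absolutely_continuous \<mu> \<nu>"
  shows "\<nu> = \<mu>"
proof -
  have gibbs_\<nu>: "\<nu> \<in> gibbs_measures E q \<beta> H" using \<nu> by (simp add: extremal_measures_def)
  then have "prob_space \<nu>" and sets_\<nu>: "sets \<nu> = sets \<Omega>" by (auto simp: gibbs_measures_def)
  then interpret \<nu>: prob_space \<nu> by simp
  have space_\<nu>: "space \<nu> = space \<Omega>" using sets_\<nu> by (rule sets_eq_imp_space_eq)
  define f where "f = RN_deriv \<mu> \<nu>"
  have dens: "density \<mu> f = \<nu>" unfolding f_def by (rule density_RN_deriv) (use ac sets_\<nu> in auto)
  have f [measurable]: "f \<in> borel_measurable \<Omega>"
    using borel_measurable_RN_deriv[of \<mu> \<nu>] by (simp add: f_def cong: measurable_cong_sets)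
  have inv: "AE \<omega> in \<mu>. f (swap_spins v i j \<omega>) = f \<omega>" if "i \<in> {1..q}" "j \<in> {1..q}" for v i j
    by (rule density_swap_invariant[OF prob_space_\<mu> gibbs_imp_quasi_invariant[OF gibbs] sets_\<mu> f])
      (use that dens gibbs_imp_quasi_invariant[OF gibbs_\<nu>] in auto)
  have em: "emeasure \<nu> B = (\<integral>\<^sup>+\<omega>. f \<omega> * indicator B \<omega> \<partial>\<mu>)" if "B \<in> sets \<Omega>" for B
    using that by (subst dens[symmetric], subst emeasure_density) auto
  define C where "C = {\<omega> \<in> space \<Omega>. f \<omega> > 0}"
  have C: "C \<in> sets \<Omega>" unfolding C_def by measurable
  have "measure \<nu> C = 1"
  proof -
    have "AE \<omega> in \<mu>. 0 < f \<omega> \<longrightarrow> \<omega> \<in> C" by (rule AE_I2) (simp add: C_def)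
    then have "AE \<omega> in \<nu>. \<omega> \<in> C" by (subst dens[symmetric], subst AE_density) auto
    then show ?thesis using C sets_\<nu> by (simp add: \<nu>.prob_eq_1)
  qed
  \<comment> \<open>On \<open>C\<close> the density is positive, so there the converse of absolute
    continuity holds.\<close>
  have C_null: "measure \<mu> (C \<inter> B) = 0" if B: "B \<in> sets \<Omega>" "measure \<nu> B = 0" for B
  proof -
    have "(\<integral>\<^sup>+\<omega>. f \<omega> * indicator B \<omega> \<partial>\<mu>) = 0"
      using em[OF B(1)] B(2) by (simp add: \<nu>.emeasure_eq_measure)
    then have "AE \<omega> in \<mu>. f \<omega> * indicator B \<omega> = 0"
      using B(1) by (subst (asm) nn_integral_0_iff_AE) auto
    then have "AE \<omega> in \<mu>. \<omega> \<notin> C \<inter> B"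
      by eventually_elim (auto simp: C_def indicator_def split: if_splits)
    then show ?thesis using B C by (simp add: prob_eq_0)
  qed
  have C_pos: "measure \<mu> C > 0"
  proof (rule ccontr)
    assume "\<not> ?thesis"
    then have "emeasure \<mu> C = 0" using measure_nonneg[of \<mu> C] by (simp add: emeasure_eq_measure)
    then have "C \<in> null_sets \<nu>" using ac C by (auto simp: absolutely_continuous_def null_sets_def)
    then show False using \<open>measure \<nu> C = 1\<close> by (auto simp: measure_def null_sets_def)
  qed
  have trivial: "measure \<mu> A = 0 \<or> measure \<mu> A = 1" if A: "A \<in> sets \<Omega>" "swap_invariant \<mu> A" for A
  proof (rule ccontr)
    assume neither: "\<not> ?thesis"
    then have p: "0 < measure \<mu> A" "measure \<mu> A < 1" using measure_nonneg[of \<mu> A] prob_le_1[of A] by linarith+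
    \<comment> \<open>The smaller of the distances from the mixing limit to the values 0 and
      \<open>measure \<mu> C\<close>, one of which the intersection must attain.\<close>
    let ?e = "min (measure \<mu> C * measure \<mu> A) (measure \<mu> C - measure \<mu> C * measure \<mu> A)"
    have "measure \<mu> C * measure \<mu> A < measure \<mu> C * 1" using p C_pos by (intro mult_strict_left_mono) auto
    then have "?e > 0" using p C_pos by simp
    then obtain g where g: "automorphism g"
      "\<bar>measure \<mu> (C \<inter> {\<omega> \<in> space \<Omega>. \<omega> \<circ> g \<in> A}) - measure \<mu> C * measure \<mu> A\<bar> < ?e"
      using mixing[OF C A(1)] by blast
    let ?G = "{\<omega> \<in> space \<Omega>. \<omega> \<circ> g \<in> A}"
    have G: "?G \<in> sets \<Omega>" using A(1) by measurable
    have "swap_invariant \<mu> ?G" by (rule relabel_swap_invariant[OF g(1) A])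
    then have "swap_invariant \<nu> ?G"
      using absolutely_continuous_AE[OF _ ac] sets_\<nu> by (simp add: swap_invariant_def)
    then consider "measure \<nu> ?G = 0" | "measure \<nu> ?G = 1" using extremal_trivial[OF \<nu> G] by blast
    then have "measure \<mu> (C \<inter> ?G) = 0 \<or> measure \<mu> (C \<inter> ?G) = measure \<mu> C"
    proof cases
      case 1
      then show ?thesis using C_null[OF G] by simp
    next
      case 2
      have "measure \<nu> (space \<nu> - ?G) = 0" using 2 G sets_\<nu> by (simp add: \<nu>.prob_compl)
      then have "measure \<mu> (C \<inter> (space \<Omega> - ?G)) = 0" using C_null[of "space \<Omega> - ?G"] G space_\<nu> by simp
      moreover have "C \<inter> (space \<Omega> - ?G) = C - C \<inter> ?G" using C_def by auto
      ultimately show ?thesis using finite_measure_Diff[of C "C \<inter> ?G"] C G by simp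
    qed
    then show False using g(2) by linarith
  qed
  define A where "A = {\<omega> \<in> space \<Omega>. f \<omega> > 1}"
  have A: "A \<in> sets \<Omega>" unfolding A_def by measurable
  have "swap_invariant \<mu> A"
    unfolding swap_invariant_def
  proof (intro allI ballI)
    fix v i j assume ij: "i \<in> {1..q}" "j \<in> {1..q}"
    from inv[OF ij, of v] AE_space show "AE \<omega> in \<mu>. swap_spins v i j \<omega> \<in> A \<longleftrightarrow> \<omega> \<in> A"
      by eventually_elim (use swap_spins_in_space[OF ij] in \<open>auto simp: A_def\<close>)
  qed
  then consider "measure \<mu> A = 0" | "measure \<mu> A = 1" using trivial[OF A] by blast
  then have "(\<forall>B\<in>sets \<Omega>. measure \<nu> B \<le> measure \<mu> B) \<or> (\<forall>B\<in>sets \<Omega>. measure \<mu> B \<le> measure \<nu> B)"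
  proof cases
    case 1
    then have "AE \<omega> in \<mu>. \<omega> \<notin> A" using A by (simp add: prob_eq_0)
    with AE_space have "AE \<omega> in \<mu>. f \<omega> \<le> 1" by eventually_elim (simp add: A_def)
    then have "emeasure \<nu> B \<le> emeasure \<mu> B" if B: "B \<in> sets \<Omega>" for B
    proof -
      have "(\<integral>\<^sup>+\<omega>. f \<omega> * indicator B \<omega> \<partial>\<mu>) \<le> (\<integral>\<^sup>+\<omega>. indicator B \<omega> \<partial>\<mu>)"
        by (rule nn_integral_mono_AE) (use \<open>AE \<omega> in \<mu>. f \<omega> \<le> 1\<close> in \<open>eventually_elim, auto simp: indicator_def\<close>)
      then show ?thesis using em[OF B] B by simp
    qed
    then show ?thesis by (auto simp: emeasure_eq_measure \<nu>.emeasure_eq_measure)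
  next
    case 2
    then have "AE \<omega> in \<mu>. \<omega> \<in> A" using A by (simp add: prob_eq_1)
    then have "AE \<omega> in \<mu>. 1 \<le> f \<omega>" by eventually_elim (simp add: A_def less_imp_le)
    then have "emeasure \<mu> B \<le> emeasure \<nu> B" if B: "B \<in> sets \<Omega>" for B
    proof -
      have "(\<integral>\<^sup>+\<omega>. indicator B \<omega> \<partial>\<mu>) \<le> (\<integral>\<^sup>+\<omega>. f \<omega> * indicator B \<omega> \<partial>\<mu>)"
        by (rule nn_integral_mono_AE) (use \<open>AE \<omega> in \<mu>. 1 \<le> f \<omega>\<close> in \<open>eventually_elim, auto simp: indicator_def\<close>)
      then show ?thesis using em[OF B] B by simp
    qed
    then show ?thesis by (auto simp: emeasure_eq_measure \<nu>.emeasure_eq_measure)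
  qed
  \<comment> \<open>Taking complements reverses a domination between probability measures, which
    forces equality.\<close>
  moreover have "measure \<mu> (space \<Omega> - B) = 1 - measure \<mu> B \<and> measure \<nu> (space \<Omega> - B) = 1 - measure \<nu> B"
    if "B \<in> sets \<Omega>" for B
    using prob_compl[of B] \<nu>.prob_compl[of B] that sets_\<nu> space_\<nu> by simp
  ultimately have "measure \<nu> B = measure \<mu> B" if "B \<in> sets \<Omega>" for B
    using that by (smt (verit) sets.compl_sets)
  then show ?thesis
    by (intro measure_eqI) (auto simp: sets_\<nu> emeasure_eq_measure \<nu>.emeasure_eq_measure)
qed

end

section \<open>The local topology and the support of an atomless measure\<close>

lemma countable_local_events:
  assumes "countable (UNIV :: 'v set)"
  shows "countable (local_events q :: ('v \<Rightarrow> nat) set set)"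
proof -
  have "local_events q = (\<Union>\<Lambda>\<in>{\<Lambda> :: 'v set. finite \<Lambda>}. cylinder q \<Lambda> ` Pow (configs q \<Lambda>))"
    by (auto simp: local_events_def)
  moreover have "countable {\<Lambda> :: 'v set. finite \<Lambda>}"
    using countable_Collect_finite_subset[OF assms] by simp
  ultimately show ?thesis by (simp, intro countable_UN countable_image) (auto intro: countable_finite)
qed

lemma local_events_sets: "C \<in> local_events q \<Longrightarrow> C \<in> sets (config_space q)"
  by (auto simp: local_events_def)

lemma measurable_measure_prob_algebra:
  "C \<in> sets M \<Longrightarrow> (\<lambda>\<nu>. measure \<nu> C) \<in> borel_measurable (prob_algebra M)"
  unfolding prob_algebra_def by (intro measurable_restrict_space1 measurable_measure_subprob_algebra)

text \<open>A measure is determined by its values on the countably many local events, so a singleton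
  is a countable intersection of measurable conditions.\<close>

lemma singleton_sets_prob_algebra:
  assumes "countable (UNIV :: 'v set)" and \<nu>: "\<nu> \<in> space (prob_algebra (config_space q :: ('v \<Rightarrow> nat) measure))"
  shows "{\<nu>} \<in> sets (prob_algebra (config_space q))"
proof -
  let ?P = "prob_algebra (config_space q) :: ('v \<Rightarrow> nat) measure measure"
  let ?L = "local_events q :: ('v \<Rightarrow> nat) set set"
  have "{} = cylinder q ({} :: 'v set) {}" by (simp add: cylinder_def)
  then have ne: "{} \<in> ?L" unfolding local_events_def by blast
  have "{\<nu>} = (\<Inter>C\<in>?L. {\<nu>' \<in> space ?P. measure \<nu>' C = measure \<nu> C})"
  proof (intro set_eqI iffI)
    fix \<nu>' assume "\<nu>' \<in> (\<Inter>C\<in>?L. {\<nu>' \<in> space ?P. measure \<nu>' C = measure \<nu> C})"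
    then have \<nu>': "\<nu>' \<in> space ?P" and eq: "\<And>C. C \<in> ?L \<Longrightarrow> measure \<nu>' C = measure \<nu> C" using ne by auto
    have p: "prob_space \<nu>'" "prob_space \<nu>" "sets \<nu>' = sets (config_space q)" "sets \<nu> = sets (config_space q)"
      using \<nu> \<nu>' by (auto simp: space_prob_algebra)
    have "\<nu>' = \<nu>"
    proof (rule config_measure_eqI[OF p(3,4)])
      show "finite_measure \<nu>'" using p by (simp add: prob_space.finite_measure)
      fix V :: "'v set" assume V: "finite V"
      have "emeasure \<nu>' (pattern q V t) = emeasure \<nu> (pattern q V t)" if "t \<in> configs q V" for t
      proof -
        have "pattern q V t \<in> ?L"
          unfolding local_events_def cylinder_singleton[OF that, symmetric] using V that by blast
        from eq[OF this] show ?thesis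
          using p by (simp add: finite_measure.emeasure_eq_measure prob_space.finite_measure)
      qed
      then show "\<exists>W. finite W \<and> V \<subseteq> W \<and> (\<forall>t\<in>configs q W. emeasure \<nu>' (pattern q W t) = emeasure \<nu> (pattern q W t))"
        using V by blast
    qed
    then show "\<nu>' \<in> {\<nu>}" by simp
  qed (use \<nu> in auto)
  also have "\<dots> \<in> sets ?P"
  proof (rule sets.countable_INT')
    show "countable ?L" by (rule countable_local_events[OF assms(1)])
    show "?L \<noteq> {}" using ne by blast
    have "{\<nu>' \<in> space ?P. measure \<nu>' C = measure \<nu> C} \<in> sets ?P" if "C \<in> ?L" for C
    proof -
    from that have [measurable]: "(\<lambda>\<nu>'. measure \<nu>' C) \<in> borel_measurable ?P"
      by (intro measurable_measure_prob_algebra local_events_sets)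
    show ?thesis by measurable
    qed
    then show "(\<lambda>C. {\<nu>' \<in> space ?P. measure \<nu>' C = measure \<nu> C}) ` ?L \<subseteq> sets ?P" by blast
  qed
  finally show ?thesis .
qed

text \<open>For finite \<open>F\<close> with local events these are basic open sets; rational
  endpoints leave only countably many of them.\<close>

definition local_box :: "nat \<Rightarrow> (('v \<Rightarrow> nat) set \<times> real \<times> real) set \<Rightarrow> ('v \<Rightarrow> nat) measure set" where
  "local_box q F = {\<nu> \<in> space (prob_algebra (config_space q)). \<forall>(C, a, b)\<in>F. a < measure \<nu> C \<and> measure \<nu> C < b}"

lemma local_box_sets:
  assumes "finite F" "F \<subseteq> local_events q \<times> UNIV"
  shows "local_box q F \<in> sets (prob_algebra (config_space q))"
proof -
  have "{\<nu> \<in> space (prob_algebra (config_space q)). a < measure \<nu> C \<and> measure \<nu> C < b} \<in> sets (prob_algebra (config_space q))"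
    if "(C, a, b) \<in> F" for C a b
  proof -
    have [measurable]: "(\<lambda>\<nu>. measure \<nu> C) \<in> borel_measurable (prob_algebra (config_space q))"
      using that assms(2) by (intro measurable_measure_prob_algebra local_events_sets) auto
    show ?thesis by measurable
  qed
  then show ?thesis
    unfolding local_box_def by (intro sets.sets_Collect_finite_All assms(1)) auto
qed

lemma countable_rational_boxes:
  assumes "countable (UNIV :: 'v set)"
  shows "countable {F. finite F \<and> F \<subseteq> (local_events q :: ('v \<Rightarrow> nat) set set) \<times> (\<rat> :: real set) \<times> (\<rat> :: real set)}"
  by (intro countable_Collect_finite_subset countable_SIGMA countable_local_events assms countable_rat)

lemma local_box_base:
  assumes "openin (local_topology q) U" "\<nu> \<in> U"
  shows "\<exists>F. finite F \<and> F \<subseteq> local_events q \<times> \<rat> \<times> \<rat> \<and> \<nu> \<in> local_box q F \<and> local_box q F \<subseteq> U"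
proof -
  let ?P = "prob_algebra (config_space q)"
  let ?m = "\<lambda>\<nu>. restrict (measure \<nu>) (local_events q)"
  obtain Q where Q: "openin (product_topology (\<lambda>_. euclideanreal) (local_events q)) Q" "U = ?m -` Q \<inter> space ?P"
    using assms(1) unfolding local_topology_def openin_pullback_topology by blast
  have "?m \<nu> \<in> Q" "\<nu> \<in> space ?P" using assms(2) Q(2) by auto
  then obtain W where W: "finite {C \<in> local_events q. W C \<noteq> topspace euclideanreal}"
    "\<forall>C\<in>local_events q. openin euclideanreal (W C)" "?m \<nu> \<in> Pi\<^sub>E (local_events q) W" "Pi\<^sub>E (local_events q) W \<subseteq> Q"
    using Q(1) unfolding openin_product_topology_alt by blast
  \<comment> \<open>A basic open set of the product constrains these finitely many coordinates only;
    the others take no part in the box.\<close>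
  let ?J = "{C \<in> local_events q. W C \<noteq> UNIV}"
  have "\<forall>C\<in>?J. \<exists>p. fst p \<in> \<rat> \<and> snd p \<in> \<rat> \<and> measure \<nu> C \<in> {fst p<..<snd p} \<and> {fst p<..<snd p} \<subseteq> W C"
  proof
    fix C assume C: "C \<in> ?J"
    then have "open (W C)" "measure \<nu> C \<in> W C" using W(2,3) by (auto simp: PiE_iff)
    then obtain e where e: "e > 0" "ball (measure \<nu> C) e \<subseteq> W C" by (meson open_contains_ball)
    obtain a where a: "a \<in> \<rat>" "measure \<nu> C - e < a" "a < measure \<nu> C"
      using Rats_dense_in_real[of "measure \<nu> C - e" "measure \<nu> C"] e by auto
    obtain b where b: "b \<in> \<rat>" "measure \<nu> C < b" "b < measure \<nu> C + e"
      using Rats_dense_in_real[of "measure \<nu> C" "measure \<nu> C + e"] e by auto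
    have "{a<..<b} \<subseteq> ball (measure \<nu> C) e" using a b by (auto simp: dist_real_def)
    then show "\<exists>p. fst p \<in> \<rat> \<and> snd p \<in> \<rat> \<and> measure \<nu> C \<in> {fst p<..<snd p} \<and> {fst p<..<snd p} \<subseteq> W C"
      using a b e by (intro exI[of _ "(a, b)"]) auto
  qed
  from bchoice[OF this] obtain p where p: "\<And>C. C \<in> ?J \<Longrightarrow> fst (p C) \<in> \<rat>" "\<And>C. C \<in> ?J \<Longrightarrow> snd (p C) \<in> \<rat>"
    "\<And>C. C \<in> ?J \<Longrightarrow> measure \<nu> C \<in> {fst (p C)<..<snd (p C)}"
    "\<And>C. C \<in> ?J \<Longrightarrow> {fst (p C)<..<snd (p C)} \<subseteq> W C" by blast
  let ?F = "(\<lambda>C. (C, p C)) ` ?J"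
  have "local_box q ?F \<subseteq> U"
  proof
    fix \<nu>' assume "\<nu>' \<in> local_box q ?F"
    then have \<nu>': "\<nu>' \<in> space ?P" "\<And>C. C \<in> ?J \<Longrightarrow> measure \<nu>' C \<in> {fst (p C)<..<snd (p C)}"
      by (auto simp: local_box_def split_beta)
    have "measure \<nu>' C \<in> W C" if "C \<in> local_events q" for C
      using \<nu>'(2)[of C] p(4)[of C] that by (cases "W C = UNIV") auto
    then have "?m \<nu>' \<in> Q" using W(4) by auto
    then show "\<nu>' \<in> U" using Q(2) \<nu>' by simp
  qed
  moreover have "\<nu> \<in> local_box q ?F" using p(3) \<open>\<nu> \<in> space ?P\<close> by (auto simp: local_box_def split_beta)
  moreover have "finite ?F" using W(1) by simp
  moreover have "?F \<subseteq> local_events q \<times> \<rat> \<times> \<rat>"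
    by (intro image_subsetI) (use p(1,2) in \<open>simp add: mem_Times_iff\<close>)
  ultimately show ?thesis by blast
qed

text \<open>By the countable base, an open set is a countable union of measurable boxes.\<close>

lemma openin_local_topology_sets:
  assumes "countable (UNIV :: 'v set)" and U: "openin (local_topology q) (U :: ('v \<Rightarrow> nat) measure set)"
  shows "U \<in> sets (prob_algebra (config_space q))"
proof -
  let ?\<F> = "{F. finite F \<and> F \<subseteq> local_events q \<times> \<rat> \<times> \<rat> \<and> local_box q F \<subseteq> U}"
  have "U = (\<Union>F\<in>?\<F>. local_box q F)"
  proof
    show "U \<subseteq> (\<Union>F\<in>?\<F>. local_box q F)"
    proof
      fix \<nu> assume "\<nu> \<in> U"
      from local_box_base[OF U this] show "\<nu> \<in> (\<Union>F\<in>?\<F>. local_box q F)" by auto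
    qed
  qed auto
  also have "\<dots> \<in> sets (prob_algebra (config_space q))"
    by (intro sets.countable_UN' countable_subset[OF _ countable_rational_boxes[OF assms(1)]])
      (auto intro: local_box_sets)
  finally show ?thesis .
qed

text \<open>Each point of the space outside the support lies in a null rational box. If the support
  were countable, it would be null as well, and countably many null sets would cover the
  space.\<close>

lemma uncountable_support:
  fixes \<Theta> :: "('v \<Rightarrow> nat) measure measure"
  assumes "countable (UNIV :: 'v set)" and "prob_space \<Theta>"
    and sets_\<Theta>: "sets \<Theta> = sets (restrict_space (prob_algebra (config_space q)) G)"
    and atomless: "\<And>\<nu>. \<nu> \<in> space \<Theta> \<Longrightarrow> {\<nu>} \<in> null_sets \<Theta>"
  shows "uncountable (support_of (local_topology q) \<Theta>)"
proof
  let ?P = "prob_algebra (config_space q) :: ('v \<Rightarrow> nat) measure measure"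
  let ?S = "support_of (local_topology q) \<Theta>"
  interpret prob_space \<Theta> by fact
  have space_\<Theta>: "space \<Theta> = G \<inter> space ?P"
    using sets_eq_imp_space_eq[OF sets_\<Theta>] by (simp add: space_restrict_space)
  assume "countable ?S"
  have "?S \<subseteq> space \<Theta>" by (auto simp: support_of_def)
  then have N1: "(\<Union>\<nu>\<in>?S. {\<nu>}) \<in> null_sets \<Theta>"
    using \<open>countable ?S\<close> atomless by (intro null_sets_UN') auto
  define \<F> where "\<F> = {F. finite F \<and> F \<subseteq> local_events q \<times> \<rat> \<times> \<rat> \<and> local_box q F \<inter> space \<Theta> \<in> null_sets \<Theta>}"
  have "countable \<F>"
  proof (rule countable_subset)
    show "\<F> \<subseteq> {F. finite F \<and> F \<subseteq> local_events q \<times> \<rat> \<times> \<rat>}" by (auto simp: \<F>_def)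
  qed (rule countable_rational_boxes[OF assms(1)])
  then have N2: "(\<Union>F\<in>\<F>. local_box q F \<inter> space \<Theta>) \<in> null_sets \<Theta>"
    by (rule null_sets_UN') (simp add: \<F>_def)
  have "space \<Theta> \<subseteq> (\<Union>\<nu>\<in>?S. {\<nu>}) \<union> (\<Union>F\<in>\<F>. local_box q F \<inter> space \<Theta>)"
  proof
    fix \<nu> assume \<nu>: "\<nu> \<in> space \<Theta>"
    show "\<nu> \<in> (\<Union>\<nu>\<in>?S. {\<nu>}) \<union> (\<Union>F\<in>\<F>. local_box q F \<inter> space \<Theta>)"
    proof (cases "\<nu> \<in> ?S")
      case False
      have "\<nu> \<in> topspace (local_topology q)"
        using \<nu> space_\<Theta> by (simp add: local_topology_def topspace_pullback_topology)
      then obtain U where U: "openin (local_topology q) U" "\<nu> \<in> U" "emeasure \<Theta> (U \<inter> space \<Theta>) = 0"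
        using False \<nu> by (auto simp: support_of_def)
      obtain F where F: "finite F" "F \<subseteq> local_events q \<times> \<rat> \<times> \<rat>" "\<nu> \<in> local_box q F" "local_box q F \<subseteq> U"
        using local_box_base[OF U(1,2)] by blast
      have "local_box q F \<inter> space \<Theta> \<in> null_sets \<Theta>"
      proof (rule null_sets_subset)
        have trace: "X \<inter> space \<Theta> \<in> sets \<Theta>" if "X \<in> sets ?P" for X
          unfolding sets_\<Theta> sets_restrict_space space_\<Theta>
          using that sets.sets_into_space[OF that] by (intro image_eqI[of _ _ X]) auto
        show "U \<inter> space \<Theta> \<in> null_sets \<Theta>"
          using trace[OF openin_local_topology_sets[OF assms(1) U(1)]] U(3) by (simp add: null_sets_def)
        show "local_box q F \<inter> space \<Theta> \<in> sets \<Theta>"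
          by (rule trace, rule local_box_sets) (use F in auto)
      qed (use F in auto)
      then show ?thesis using F \<nu> by (auto simp: \<F>_def)
    qed simp
  qed
  then have "space \<Theta> \<in> null_sets \<Theta>"
    by (rule null_sets_subset[OF null_sets.Un[OF N1 N2] sets.top])
  then show False using emeasure_space_1 by (simp add: null_sets_def)
qed

theorem theorem2:
  fixes E :: "'v \<Rightarrow> 'v \<Rightarrow> bool" and r :: 'v and d q :: nat and \<beta> :: real and H :: "nat \<Rightarrow> real"
    and \<mu> :: "('v \<Rightarrow> nat) measure" and \<Theta> :: "('v \<Rightarrow> nat) measure measure"
  assumes "d \<ge> 2" and "q \<ge> 2" and "\<beta> \<ge> 0"
    and "regular_tree d E"
    and "CHSGM d E r q \<beta> H \<mu>"
    and "extremal_decomposition E q \<beta> H \<mu> \<Theta>"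
  shows "\<mu> \<in> extremal_gibbs_measures E q \<beta> H \<or>
         (\<forall>\<nu>\<in>extremal_gibbs_measures E q \<beta> H. {\<nu>} \<in> null_sets \<Theta>) \<and>
         uncountable (support_of (local_topology q) \<Theta> \<inter> extremal_gibbs_measures E q \<beta> H)"
proof (cases "\<mu> \<in> extremal_gibbs_measures E q \<beta> H")
  case False
  let ?ex = "extremal_gibbs_measures E q \<beta> H"
  let ?P = "prob_algebra (config_space q) :: ('v \<Rightarrow> nat) measure measure"
  have "\<exists>h. splitting_measure d E q \<beta> H \<mu> r h"
    using assms(1,2,4,5)
    unfolding CHSGM_def splitting_measure_def splitting_measure_axioms_def potts_def reg_tree_def
    by (elim conjE exE, intro exI conjI allI impI) (auto simp only: one_le_numeral elim: order_trans[rotated])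
  then obtain h where "splitting_measure d E q \<beta> H \<mu> r h" ..
  then interpret splitting_measure d E q \<beta> H \<mu> r h .
  have \<Theta>: "prob_space \<Theta>" "sets \<Theta> = sets (restrict_space ?P ?ex)"
    and decomp: "\<And>B. B \<in> sets (config_space q) \<Longrightarrow> emeasure \<mu> B = (\<integral>\<^sup>+\<nu>. emeasure \<nu> B \<partial>\<Theta>)"
    using assms(6) by (auto simp: extremal_decomposition_def)
  \<comment> \<open>Extremal Gibbs measures are probability measures on the configuration space, so
    restricting \<open>?P\<close> to them loses none.\<close>
  have space_\<Theta>: "space \<Theta> = ?ex"
    using sets_eq_imp_space_eq[OF \<Theta>(2)]
    by (auto simp: space_restrict_space space_prob_algebra extremal_measures_def gibbs_measures_def)
  have single: "{\<nu>} \<in> sets \<Theta>" if "\<nu> \<in> ?ex" for \<nu>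
  proof -
    have "\<nu> \<in> space ?P" using that by (auto simp: space_prob_algebra extremal_measures_def gibbs_measures_def)
    then have "{\<nu>} \<in> sets ?P" by (rule singleton_sets_prob_algebra[OF countable_vertices])
    then show ?thesis unfolding \<Theta>(2) sets_restrict_space using that by (auto intro!: image_eqI[of _ _ "{\<nu>}"])
  qed
  have null: "{\<nu>} \<in> null_sets \<Theta>" if \<nu>: "\<nu> \<in> ?ex" for \<nu>
  proof (rule ccontr)
    assume "{\<nu>} \<notin> null_sets \<Theta>"
    then have atom: "emeasure \<Theta> {\<nu>} \<noteq> 0" using single[OF \<nu>] by (simp add: null_sets_def)
    have sets_\<nu>: "sets \<nu> = sets (config_space q)" using \<nu> by (auto simp: extremal_measures_def gibbs_measures_def)
    have "absolutely_continuous \<mu> \<nu>"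
      unfolding absolutely_continuous_def
    proof
      fix B assume B: "B \<in> null_sets \<mu>"
      then have B': "B \<in> sets (config_space q)" by auto
      \<comment> \<open>Keeping only the atom in the decomposition bounds a positive multiple of
        \<open>\<nu>\<close> by \<open>\<mu>\<close>, which gives absolute continuity.\<close>
      have "emeasure \<nu> B * emeasure \<Theta> {\<nu>} = (\<integral>\<^sup>+\<nu>'. emeasure \<nu> B * indicator {\<nu>} \<nu>' \<partial>\<Theta>)"
        using single[OF \<nu>] by (simp add: nn_integral_cmult_indicator)
      also have "\<dots> \<le> (\<integral>\<^sup>+\<nu>'. emeasure \<nu>' B \<partial>\<Theta>)"
        by (rule nn_integral_mono) (auto simp: indicator_def)
      also have "\<dots> = 0" using decomp[OF B'] B by (simp add: null_sets_def)
      finally show "B \<in> null_sets \<nu>" using atom B' sets_\<nu> by (auto simp: null_sets_def)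
    qed
    then have "\<nu> = \<mu>" by (rule extremal_absolutely_continuous_eq[OF \<nu>])
    then show False using False \<nu> by simp
  qed
  have "uncountable (support_of (local_topology q) \<Theta>)"
    by (rule uncountable_support[OF countable_vertices \<Theta>]) (use null space_\<Theta> in auto)
  moreover have "support_of (local_topology q) \<Theta> \<inter> ?ex = support_of (local_topology q) \<Theta>"
    using space_\<Theta> by (auto simp: support_of_def)
  ultimately show ?thesis using null by simp
qed simp

end
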